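(* Let $q\ge1$ and $x_0\in\mathbb R^d$. Let $l\ge2$ be an integer and let the kernel be $\mathbf K=u_l$. For all $(\beta,p,\mathcal P)\in(0,l]^d\times[1,\infty]^d\times\mathfrak P$ such that $r(\beta,p,\mathcal P)>0$ and all $L\in(0,\infty)^d$, $$\limsup_{n\to+\infty}\Big\{\varphi_n^{-1}(\beta,p,\mathcal P)\,\mathcal R_n^{(q)}\big[\widehat f^{(n)}_{(\mathbf h,\mathcal P)},N_{p,d}(\beta,L,\mathcal P)\big]\Big\}<\infty.$$
   Context: **Setting.** $X_1,X_2,\dots$ are i.i.d. $\mathbb R^d$-valued random vectors with density $f$ with respect to Lebesgue measure; $X^{(n)}=(X_1,\dots,X_n)$, $\mathbb E_f^{(n)}$ is the expectation under the law of $X^{(n)}$. For a set $\Sigma$ of densities, $\mathcal R_n^{(q)}[\widehat f,\Sigma]=\sup_{f\in\Sigma}(\mathbb E_f^{(n)}|\widehat f(x_0)-f(x_0)|^q)^{1/q}$. **Partitions.** $\mathfrak P$ is the set of all partitions of $\{1,\dots,d\}$; for $I\subseteq\{1,\dots,d\}$, $x_I=(x_i)_{i\in I}$ (similarly $\beta_I,p_I,L_I$) and $f_I(x_I)=\int f(x)\,dx_{\overline I}$, $\overline I=\{1,\dots,d\}\setminus I$, is the marginal density. **Nikolskii class.** For $p\in[1,\infty]^s$, $\beta,L\in(0,\infty)^s$, $\mathbb N_{p,s}(\beta,L)$ is the set of functions $f:\mathbb R^s\to\mathbb R$ such that for all $i=1,\dots,s$: (i) $\|D_i^kf\|_{p_i}\le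 L_i$ for all $k=0,\dots,\lfloor\beta_i\rfloor$; (ii) $\|D_i^{\lfloor\beta_i\rfloor}f(\cdot+te_i)-D_i^{\lfloor\beta_i\rfloor}f(\cdot)\|_{p_i}\le L_i|t|^{\beta_i-\lfloor\beta_i\rfloor}$ for all $t\in\mathbb R$. Here $D_i^kf$ is the $k$-th order partial derivative in the $i$-th variable, $(e_i)$ the canonical basis, and $\lfloor\beta_i\rfloor$ the largest integer strictly less than $\beta_i$. **Class with independence structure.** $N_{p,d}(\beta,L,\mathcal P)$ is the set of probability densities $f:\mathbb R^d\to\mathbb R_+$ with $f(x)=\prod_{I\in\mathcal P}f_I(x_I)$ for all $x\in\mathbb R^d$ and $f_I\in\mathbb N_{p_I,|I|}(\beta_I,L_I)$ for all $I\in\mathcal P$. (When $r(\beta,p,\mathcal P)>0$ the functions $f_I$, $I\in\mathcal P$, are understood as their continuous versions, so that the value $f(x_0)$ is meaningful.) **Rates.** $\gamma_I(\beta,p)=\dfrac{1-\sum_{i\in I}\frac1{\beta_ip_i}}{\sum_{i\in I}\frac1{\beta_i}}$, $r=r(\beta,p,\mathcal P)=\inf_{I\in\mathcal P}\gamma_I(\beta,p)$, $\varphi_n(\beta,p,\mathcal P)=(1/n)^{r/(2r+1)}$. **Kernel.** $u:\mathbb R\to\mathbb R$ is a given symmetric Lipschitz function with $\mathrm{supp}(u)\subseteq[-1/(2l),1/(2l)]$ and $\int_{\mathbb R}u=1$, and $u_l(z)=\sum_{i=1}^l\binom li(-1)^{i+1}\frac1i\,u(z/i)$. **Estimator.** $\widehat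 f^{(n)}_{(h,\mathcal P)}(x_0)=\prod_{I\in\mathcal P}\Big[\frac1n\sum_{k=1}^n\prod_{i\in I}\frac1{h_i}\mathbf K\big(\frac{X_{k,i}-x_{0,i}}{h_i}\big)\Big]$. The bandwidth $\mathbf h=(\mathbf h_1,\dots,\mathbf h_d)$ is $$\mathbf h_i=n^{-\frac{\gamma_I(\beta,p)}{2\gamma_I(\beta,p)+1}\cdot\frac1{\beta_i(I)}},\qquad i\in I,\ I\in\mathcal P,$$ where $\beta_i(I)=\kappa(I)\beta_i\kappa_i^{-1}(I)$, $\kappa(I)=1-\sum_{k\in I}(\beta_kp_k)^{-1}$, $\kappa_i(I)=1-\sum_{k\in I}(p_k^{-1}-p_i^{-1})\beta_k^{-1}$. *)

theory Defs
  imports "HOL-Probability.Probability"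
begin

text \<open>
  For a finite index set \<open>I\<close> the space \<open>R^I\<close> is the carrier of
  \<^term>\<open>PiM I (\<lambda>_. lborel)\<close>, i.e. the functions from indices to reals that are extensional on \<open>I\<close>;
  \<open>R^d\<close> is the case \<open>I = {1..d}\<close>. Vector parameters such as \<open>\<beta>\<close>, \<open>p\<close>, \<open>L\<close> are plain functions
  on indices, so that \<open>\<beta>_I\<close> is \<open>\<beta>\<close> read on \<open>I\<close> only.
\<close>

type_synonym point = "nat \<Rightarrow> real"

definition Leb :: "nat set \<Rightarrow> point measure" where
  "Leb I = PiM I (\<lambda>_. lborel)"

subsection \<open>\<open>L^p\<close> norms\<close>

text \<open>Meant for exponents \<open>a > 0\<close>.\<close>

definition epowr :: "ennreal \<Rightarrow> real \<Rightarrow> ennreal" where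
  "epowr y a = (if y = \<infinity> then \<infinity> else ennreal (enn2real y powr a))"

definition Lp_norm :: "'a measure \<Rightarrow> ennreal \<Rightarrow> ('a \<Rightarrow> real) \<Rightarrow> ennreal" where
  "Lp_norm M p g =
     (if p = \<infinity> then esssup M (\<lambda>x. ennreal \<bar>g x\<bar>)
      else epowr (\<integral>\<^sup>+x. ennreal (\<bar>g x\<bar> powr enn2real p) \<partial>M) (1 / enn2real p))"

text \<open>\<open>1/p\<close> as a real number, with \<open>1/\<infinity> = 0\<close>.\<close>

definition rec :: "ennreal \<Rightarrow> real" where
  "rec p = enn2real (inverse p)"

subsection \<open>Nikolskii classes\<close>

text \<open>The largest integer strictly less than \<open>b\<close>, for \<open>b > 0\<close>.\<close>

definition strict_floor :: "real \<Rightarrow> nat" where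
  "strict_floor b = nat (\<lceil>b\<rceil> - 1)"

text \<open>
  Elements of Nikolskii classes are functions up to equality almost everywhere, and derivatives are
  generalized partial derivatives in the sense of Nikolskii and Sobolev: \<open>g\<close> is the partial derivative
  of \<open>f\<close> in the \<open>i\<close>-th variable if \<open>f\<close> has a version \<open>F\<close> that, on almost every line parallel to the
  \<open>i\<close>-th axis, is locally absolutely continuous with derivative \<open>g\<close>, that is, a locally integrable
  \<open>g\<close> of which \<open>F\<close> is a primitive. An everywhere existing classical partial derivative of a
  measurable \<open>f\<close> is of this kind as soon as it is locally integrable on almost every such line, in
  particular if it belongs to some \<open>L^p\<close> space with \<open>p \<ge> 1\<close>.
\<close>

definition is_partial_deriv :: "nat set \<Rightarrow> nat \<Rightarrow> (point \<Rightarrow> real) \<Rightarrow> (point \<Rightarrow> real) \<Rightarrow> bool" where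
  "is_partial_deriv I i f g \<longleftrightarrow>
     f \<in> borel_measurable (Leb I) \<and> g \<in> borel_measurable (Leb I) \<and>
     (\<exists>F \<in> borel_measurable (Leb I).
        (AE x in Leb I. F x = f x) \<and>
        (AE x in Leb I. \<forall>a b. a \<le> b \<longrightarrow>
            set_integrable lborel {a..b} (\<lambda>s. g (x(i := s))) \<and>
            F (x(i := b)) - F (x(i := a)) = (LINT s:{a..b}|lborel. g (x(i := s)))))"

text \<open>In the following definition \<open>D k\<close> plays the role of the \<open>k\<close>-th derivative of \<open>f\<close> in the
  \<open>i\<close>-th variable; it is determined up to null sets.\<close>

definition Nikolskii :: "nat set \<Rightarrow> (nat \<Rightarrow> ennreal) \<Rightarrow> (nat \<Rightarrow> real) \<Rightarrow> (nat \<Rightarrow> real) \<Rightarrow> (point \<Rightarrow> real) set" where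
  "Nikolskii I p \<beta> L = {f \<in> borel_measurable (Leb I). \<forall>i\<in>I. \<exists>D.
     D 0 = f \<and>
     (\<forall>k<strict_floor (\<beta> i). is_partial_deriv I i (D k) (D (Suc k))) \<and>
     (\<forall>k\<le>strict_floor (\<beta> i). Lp_norm (Leb I) (p i) (D k) \<le> ennreal (L i)) \<and>
     (\<forall>t. Lp_norm (Leb I) (p i)
            (\<lambda>x. D (strict_floor (\<beta> i)) (x(i := x i + t)) - D (strict_floor (\<beta> i)) x)
          \<le> ennreal (L i * \<bar>t\<bar> powr (\<beta> i - real (strict_floor (\<beta> i)))))}"

subsection \<open>Rates\<close>

definition gam :: "(nat \<Rightarrow> real) \<Rightarrow> (nat \<Rightarrow> ennreal) \<Rightarrow> nat set \<Rightarrow> real" where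
  "gam \<beta> p I = (1 - (\<Sum>i\<in>I. rec (p i) / \<beta> i)) / (\<Sum>i\<in>I. 1 / \<beta> i)"

definition rate_exp :: "(nat \<Rightarrow> real) \<Rightarrow> (nat \<Rightarrow> ennreal) \<Rightarrow> nat set set \<Rightarrow> real" where
  "rate_exp \<beta> p P = (INF I\<in>P. gam \<beta> p I)"

definition rate :: "nat \<Rightarrow> (nat \<Rightarrow> real) \<Rightarrow> (nat \<Rightarrow> ennreal) \<Rightarrow> nat set set \<Rightarrow> real" where
  "rate n \<beta> p P = (1 / real n) powr (rate_exp \<beta> p P / (2 * rate_exp \<beta> p P + 1))"

subsection \<open>Densities with independence structure\<close>

definition marginal :: "nat \<Rightarrow> nat set \<Rightarrow> (point \<Rightarrow> real) \<Rightarrow> point \<Rightarrow> real" where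
  "marginal d I f y = (\<integral>z. f (merge I ({1..d} - I) (y, z)) \<partial>Leb ({1..d} - I))"

text \<open>
  The last conjunct selects the continuous versions when \<open>r > 0\<close>. Nothing is lost by requiring it of
  the marginal integrals themselves: if \<open>g_I\<close> are continuous versions of the marginals and \<open>f\<close> is the
  product of the \<open>g_I\<close>, then integrating the product shows that \<open>g_I\<close> equals \<^term>\<open>marginal d I f\<close>
  everywhere.
\<close>

definition indep_class ::
  "nat \<Rightarrow> (nat \<Rightarrow> ennreal) \<Rightarrow> (nat \<Rightarrow> real) \<Rightarrow> (nat \<Rightarrow> real) \<Rightarrow> nat set set \<Rightarrow> (point \<Rightarrow> real) set" where
  "indep_class d p \<beta> L P = {f \<in> borel_measurable (Leb {1..d}).
     (\<forall>x\<in>space (Leb {1..d}). 0 \<le> f x) \<and>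
     (\<integral>\<^sup>+x. ennreal (f x) \<partial>Leb {1..d}) = 1 \<and>
     (\<forall>x\<in>space (Leb {1..d}). f x = (\<Prod>I\<in>P. marginal d I f (restrict x I))) \<and>
     (\<forall>I\<in>P. marginal d I f \<in> Nikolskii I p \<beta> L) \<and>
     (rate_exp \<beta> p P > 0 \<longrightarrow>
        (\<forall>I\<in>P. continuous_map (product_topology (\<lambda>_. euclideanreal) I) euclideanreal (marginal d I f)))}"

subsection \<open>Risk and estimator\<close>

text \<open>A sample is \<open>X\<close> with \<open>X k i\<close> the \<open>i\<close>-th coordinate of the \<open>k\<close>-th observation; \<open>T X\<close> is the
  estimate of \<open>f x0\<close>.\<close>

definition sample_law :: "nat \<Rightarrow> nat \<Rightarrow> (point \<Rightarrow> real) \<Rightarrow> (nat \<Rightarrow> point) measure" where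
  "sample_law n d f = PiM {1..n} (\<lambda>_. density (Leb {1..d}) (\<lambda>x. ennreal (f x)))"

definition risk ::
  "nat \<Rightarrow> nat \<Rightarrow> real \<Rightarrow> point \<Rightarrow> ((nat \<Rightarrow> point) \<Rightarrow> real) \<Rightarrow> (point \<Rightarrow> real) set \<Rightarrow> ennreal" where
  "risk n d q x0 T S =
     (SUP f\<in>S. epowr (\<integral>\<^sup>+X. ennreal (\<bar>T X - f x0\<bar> powr q) \<partial>sample_law n d f) (1 / q))"

definition kernel_l :: "(real \<Rightarrow> real) \<Rightarrow> nat \<Rightarrow> real \<Rightarrow> real" where
  "kernel_l u l z = (\<Sum>i=1..l. real (l choose i) * (-1) ^ (i + 1) * (1 / real i) * u (z / real i))"

definition estimator ::
  "nat \<Rightarrow> (real \<Rightarrow> real) \<Rightarrow> (nat \<Rightarrow> real) \<Rightarrow> nat set set \<Rightarrow> point \<Rightarrow> (nat \<Rightarrow> point) \<Rightarrow> real" where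
  "estimator n K h P x0 X =
     (\<Prod>I\<in>P. 1 / real n * (\<Sum>k=1..n. \<Prod>i\<in>I. 1 / h i * K ((X k i - x0 i) / h i)))"

definition kap :: "(nat \<Rightarrow> real) \<Rightarrow> (nat \<Rightarrow> ennreal) \<Rightarrow> nat set \<Rightarrow> real" where
  "kap \<beta> p I = 1 - (\<Sum>k\<in>I. rec (p k) / \<beta> k)"

definition kap_i :: "(nat \<Rightarrow> real) \<Rightarrow> (nat \<Rightarrow> ennreal) \<Rightarrow> nat set \<Rightarrow> nat \<Rightarrow> real" where
  "kap_i \<beta> p I i = 1 - (\<Sum>k\<in>I. (rec (p k) - rec (p i)) / \<beta> k)"

definition beta_i :: "(nat \<Rightarrow> real) \<Rightarrow> (nat \<Rightarrow> ennreal) \<Rightarrow> nat set \<Rightarrow> nat \<Rightarrow> real" where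
  "beta_i \<beta> p I i = kap \<beta> p I * \<beta> i / kap_i \<beta> p I i"

definition block :: "nat set set \<Rightarrow> nat \<Rightarrow> nat set" where
  "block P i = (THE I. I \<in> P \<and> i \<in> I)"

definition bandwidth ::
  "nat \<Rightarrow> (nat \<Rightarrow> real) \<Rightarrow> (nat \<Rightarrow> ennreal) \<Rightarrow> nat set set \<Rightarrow> nat \<Rightarrow> real" where
  "bandwidth n \<beta> p P i =
     (let I = block P i in
      real n powr (- (gam \<beta> p I / (2 * gam \<beta> p I + 1) * (1 / beta_i \<beta> p I i))))"

end

theory Submission
  imports Defs
begin

text \<open>
  Let \<open>T\<^sub>h g (x) = \<integral> \<Prod>\<^sub>i h\<^sub>i\<^bsup>-1\<^esup> K((y\<^sub>i - x\<^sub>i)/h\<^sub>i) g(y) dy\<close>, which is the mean of the estimator of the marginal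
  density \<open>g\<close>. The operators \<open>T\<^sub>h\<close> commute, so \<open>T\<^sub>h - T\<^sub>h\<^sub>' = T\<^sub>h (1 - T\<^sub>h\<^sub>') - T\<^sub>h\<^sub>' (1 - T\<^sub>h)\<close>. For the
  kernel \<open>u\<^sub>l\<close>, the factor \<open>1 - T\<^sub>h\<^sub>'\<close> is, one coordinate at a time, an average of \<open>l\<close>-th order differences,
  whose \<open>L\<^bsup>p\<^sub>i\<^esup>\<close> norm is \<open>O(h'\<^sub>i\<^bsup>\<beta>\<^sub>i\<^esup>)\<close>; testing against the kernel of \<open>T\<^sub>h\<close> turns this into a pointwise bound
  \<open>O(h'\<^sub>i\<^bsup>\<beta>\<^sub>i\<^esup> (\<Prod> h)\<^bsup>-1/p\<^sub>i\<^esup>)\<close>. With \<open>h\<^sub>i = \<delta>\<^bsup>1/\<beta>\<^sub>i(I)\<^esup>\<close> this is \<open>O(\<delta>)\<close> as long as \<open>h'\<close> belongs to a \<open>\<delta>'\<close>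
  comparable to \<open>\<delta>\<close>. Summing over \<open>\<delta> 2\<^bsup>-k\<^esup>\<close> and using the continuity of \<open>g\<close> at \<open>x\<close> bounds the bias by
  \<open>O(\<delta>)\<close>, without any embedding theorem for anisotropic classes. The bandwidth is such that
  \<open>\<delta> = n\<^bsup>-\<gamma>/(2\<gamma>+1)\<^esup>\<close> and \<open>n \<Prod> h = \<delta>\<^bsup>-2\<^esup>\<close>, hence the standard deviation is \<open>O(\<delta>)\<close> as well, and the errors of all
  blocks, divided by the rate, have uniformly bounded exponential moments. These control the
  moments of the error of the product, whatever the dependence between the blocks.
\<close>

subsection \<open>Lebesgue measure on \<open>R\<^sup>I\<close>\<close>

text \<open>Smoothness in direction \<open>i\<close> is measured in its own norm \<open>p i\<close>,
  so no single norm controls the bias; instead every direction has to produce the same power of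
  \<delta>. With \<open>h i = \<delta> powr e i\<close> the pointwise bound in direction
  \<open>i\<close> has exponent \<open>\<beta> i * e i - rec (p i) * sum e I\<close>. Requiring the
  value 1 for all \<open>i\<close> is a linear system; its solution is
  \<open>e i = 1 / beta_i \<beta> p I i\<close>, with \<open>sum e I = 1 / gam \<beta> p I\<close>.
  This is the origin of the bandwidth, and r > 0 makes the \<open>e i\<close> positive. Derivatives
  are only generalized ones, so all differences are put on the kernel, and the function enters
  through integrals against bounded functions whose support has finite measure. Its value at a point
  enters only through continuity, in the limit of the telescoping sum. The variance needs a uniform
  bound on the marginal density; the bias bound at \<delta> = 1 supplies it. The error of a product
  contains products of errors of several blocks, and its moments do not factor if the blocks are
  dependent. With exponential moments such products are dominated by a sum of terms that involve one
  block each.\<close>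

interpretation lborel_product: product_sigma_finite "\<lambda>_::nat. lborel :: real measure"
  by standard

lemma space_Leb: "space (Leb I) = extensional I"
  by (simp add: Leb_def space_PiM PiE_UNIV_domain PiE_def)

lemma fun_upd_in_space_Leb: "i \<in> I \<Longrightarrow> x \<in> space (Leb I) \<Longrightarrow> x(i := a) \<in> space (Leb I)"
  by (auto simp: space_Leb extensional_def)

lemma measurable_Leb_component [measurable (raw)]: "i \<in> I \<Longrightarrow> (\<lambda>x. x i) \<in> borel_measurable (Leb I)"
  unfolding Leb_def by (metis measurable_component_singleton measurable_lborel1)

lemma measurable_Leb_component' [measurable_dest]:
  "f \<in> measurable N (Leb I) \<Longrightarrow> g \<in> measurable L N \<Longrightarrow> i \<in> I \<Longrightarrow> (\<lambda>x. f (g x) i) \<in> borel_measurable L"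
  by (rule measurable_compose[OF measurable_compose[of g L N f "Leb I"] measurable_Leb_component])

lemma sigma_finite_Leb: "finite I \<Longrightarrow> sigma_finite_measure (Leb I)"
  unfolding Leb_def by (rule lborel_product.sigma_finite)

lemma pair_sigma_finite_Leb: "finite I \<Longrightarrow> finite J \<Longrightarrow> pair_sigma_finite (Leb I) (Leb J)"
  by (simp add: pair_sigma_finite_def sigma_finite_Leb)

lemma pair_sigma_finite_Leb_lborel: "finite I \<Longrightarrow> pair_sigma_finite (Leb I) (lborel :: real measure)"
  by (simp add: pair_sigma_finite_def sigma_finite_Leb sigma_finite_lborel)

lemma measurable_fun_upd_Leb [measurable (raw)]:
  assumes "i \<in> I" "f \<in> measurable N (Leb I)" "g \<in> borel_measurable N"
  shows "(\<lambda>w. (f w)(i := g w)) \<in> measurable N (Leb I)"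
proof -
  have "(\<lambda>w. (f w)(i := g w)) \<in> measurable N (PiM I (\<lambda>_. lborel))"
  proof (rule measurable_fun_upd[where J=I])
    show "I = I \<union> {i}" using assms by auto
  qed (use assms in \<open>auto simp: Leb_def\<close>)
  then show ?thesis by (simp add: Leb_def)
qed

subsection \<open>Translations in one coordinate\<close>

definition shift :: "nat \<Rightarrow> real \<Rightarrow> (point \<Rightarrow> real) \<Rightarrow> point \<Rightarrow> real" where
  "shift i s W = (\<lambda>x. W (x(i := x i + s)))"

text \<open>The step is backward because \<open>dif\<close> acts on the test function: by
  translation invariance, pairing \<open>dif i t W\<close> with \<Phi> equals pairing
  \<open>W\<close> with the forward increment \<open>shift i t \<Phi> - \<Phi>\<close>.\<close>

definition dif :: "nat \<Rightarrow> real \<Rightarrow> (point \<Rightarrow> real) \<Rightarrow> point \<Rightarrow> real" where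
  "dif i t W = (\<lambda>x. shift i (- t) W x - W x)"

lemma measurable_translate:
  assumes "i \<in> I" shows "(\<lambda>x. x(i := x i + s)) \<in> measurable (Leb I) (Leb I)"
  using assms by measurable

text \<open>A product measure is determined by its values on boxes. The preimage of a box is a box
  in which only the \<open>i\<close>-th side is moved, and Lebesgue measure on the line is
  translation invariant.\<close>

lemma distr_translate_Leb:
  assumes "finite I" "i \<in> I"
  shows "distr (Leb I) (Leb I) (\<lambda>x. x(i := x i + s)) = Leb I"
proof -
  have "distr (Leb I) (Leb I) (\<lambda>x. x(i := x i + s)) = PiM I (\<lambda>_. lborel)"
  proof (rule lborel_product.PiM_eqI[OF assms(1)])
    show "sets (distr (Leb I) (Leb I) (\<lambda>x. x(i := x i + s))) = sets (PiM I (\<lambda>_. lborel))"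
      by (simp add: Leb_def)
    fix A :: "nat \<Rightarrow> real set" assume A: "\<And>j. j \<in> I \<Longrightarrow> A j \<in> sets lborel"
    define B where "B = (\<lambda>j. if j = i then (\<lambda>a. a + s) -` A j else A j)"
    have Bm: "B j \<in> sets lborel" if "j \<in> I" for j
    proof -
      have "(\<lambda>a::real. a + s) -` A j \<inter> space lborel \<in> sets lborel"
        by (rule measurable_sets[OF _ A[OF that]]) simp
      then show ?thesis using A[OF that] by (cases "j = i") (simp_all add: B_def)
    qed
    have Bi: "emeasure lborel (B j) = emeasure lborel (A j)" if "j \<in> I" for j
    proof (cases "j = i")
      case True
      have "emeasure lborel (A j) = emeasure (distr lborel borel ((+) s)) (A j)"
        by (simp add: lborel_distr_plus)
      also have "\<dots> = emeasure lborel ((+) s -` A j \<inter> space lborel)"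
        using A[OF that] by (subst emeasure_distr) auto
      finally show ?thesis using True by (simp add: B_def add.commute[of _ s])
    qed (simp add: B_def)
    have pre: "(\<lambda>x. x(i := x i + s)) -` (Pi\<^sub>E I A) \<inter> space (Leb I) = Pi\<^sub>E I B"
      using assms by (auto simp: space_Leb PiE_iff B_def extensional_def split: if_splits)
    have "emeasure (distr (Leb I) (Leb I) (\<lambda>x. x(i := x i + s))) (Pi\<^sub>E I A)
        = emeasure (Leb I) ((\<lambda>x. x(i := x i + s)) -` (Pi\<^sub>E I A) \<inter> space (Leb I))"
      using assms A by (intro emeasure_distr measurable_translate) (auto simp: Leb_def intro!: sets_PiM_I_finite)
    also have "\<dots> = (\<Prod>j\<in>I. emeasure lborel (B j))"
      unfolding pre unfolding Leb_def using assms Bm by (intro lborel_product.emeasure_PiM) auto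
    also have "\<dots> = (\<Prod>j\<in>I. emeasure lborel (A j))"
      by (intro prod.cong Bi) auto
    finally show "emeasure (distr (Leb I) (Leb I) (\<lambda>x. x(i := x i + s))) (Pi\<^sub>E I A)
        = (\<Prod>j\<in>I. emeasure lborel (A j))" .
  qed
  then show ?thesis by (simp add: Leb_def)
qed

lemma shift_measurable:
  "i \<in> I \<Longrightarrow> W \<in> borel_measurable (Leb I) \<Longrightarrow> shift i s W \<in> borel_measurable (Leb I)"
  unfolding shift_def by (rule measurable_compose[OF measurable_translate])

lemma shift_shift: "shift i s (shift i t W) = shift i (s + t) W"
  by (auto simp: shift_def fun_eq_iff add.assoc)

lemma shift_0: "shift i 0 W = W"
  by (simp add: shift_def)

lemma shift_dif: "shift i s (dif i t W) = dif i t (shift i s W)"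
  by (auto simp: shift_def dif_def fun_eq_iff algebra_simps)

lemma shift_dif_iter: "shift i s ((dif i t ^^ k) W) = (dif i t ^^ k) (shift i s W)"
  by (induction k) (auto simp: shift_dif)

lemma integral_shift:
  assumes "finite I" "i \<in> I" "f \<in> borel_measurable (Leb I)"
  shows "(\<integral>x. shift i s f x \<partial>Leb I) = (\<integral>x. f x \<partial>Leb I)"
proof -
  have "(\<integral>x. f x \<partial>Leb I) = (\<integral>x. f x \<partial>distr (Leb I) (Leb I) (\<lambda>x. x(i := x i + s)))"
    by (simp add: distr_translate_Leb assms)
  also have "\<dots> = (\<integral>x. shift i s f x \<partial>Leb I)"
    unfolding shift_def using assms by (intro integral_distr measurable_translate) auto
  finally show ?thesis by simp
qed

lemma nn_integral_translate:
  fixes f :: "point \<Rightarrow> ennreal"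
  assumes "finite I" "i \<in> I" "f \<in> borel_measurable (Leb I)"
  shows "(\<integral>\<^sup>+x. f (x(i := x i + s)) \<partial>Leb I) = (\<integral>\<^sup>+x. f x \<partial>Leb I)"
proof -
  have "(\<integral>\<^sup>+x. f x \<partial>Leb I) = (\<integral>\<^sup>+x. f x \<partial>distr (Leb I) (Leb I) (\<lambda>x. x(i := x i + s)))"
    by (simp add: distr_translate_Leb assms)
  also have "\<dots> = (\<integral>\<^sup>+x. f (x(i := x i + s)) \<partial>Leb I)"
    using assms by (intro nn_integral_distr measurable_translate) auto
  finally show ?thesis by simp
qed

lemma AE_translate:
  assumes "finite I" "i \<in> I" "AE x in Leb I. Q x"
  shows "AE x in Leb I. Q (x(i := x i + s))"
proof -
  have "AE x in distr (Leb I) (Leb I) (\<lambda>x. x(i := x i + s)). Q x"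
    using assms(3) by (simp only: distr_translate_Leb[OF assms(1,2)])
  then show ?thesis
    by (rule AE_distrD[OF measurable_translate[OF assms(2)]])
qed

subsection \<open>Test functions\<close>

text \<open>A height bound and a bound on the measure of the support are all that a Hoelder-type
  estimate against an L^p function requires. The class is invariant under \<open>shift\<close>, and
  each \<open>dif\<close> at most doubles both numbers; estimates that are uniform over the class
  therefore survive translation, which is what the inductions below rely on.\<close>

definition test_fun :: "nat set \<Rightarrow> real \<Rightarrow> real \<Rightarrow> (point \<Rightarrow> real) set" where
  "test_fun I B V = {W \<in> borel_measurable (Leb I). (\<forall>x. \<bar>W x\<bar> \<le> B) \<and>
     emeasure (Leb I) {x \<in> space (Leb I). W x \<noteq> 0} \<le> ennreal V}"

lemma test_fun_measurable: "W \<in> test_fun I B V \<Longrightarrow> W \<in> borel_measurable (Leb I)"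
  by (simp add: test_fun_def)

lemma shift_test_fun:
  assumes "finite I" "i \<in> I" "W \<in> test_fun I B V"
  shows "shift i s W \<in> test_fun I B V"
proof -
  have [measurable]: "W \<in> borel_measurable (Leb I)" using assms by (simp add: test_fun_def)
  have "emeasure (Leb I) {x \<in> space (Leb I). shift i s W x \<noteq> 0}
      = (\<integral>\<^sup>+x. indicator {x \<in> space (Leb I). W x \<noteq> 0} (x(i := x i + s)) \<partial>Leb I)"
  proof -
    have [measurable]: "shift i s W \<in> borel_measurable (Leb I)"
      using assms by (intro shift_measurable) auto
    have "emeasure (Leb I) {x \<in> space (Leb I). shift i s W x \<noteq> 0}
      = (\<integral>\<^sup>+x. indicator {x \<in> space (Leb I). shift i s W x \<noteq> 0} x \<partial>Leb I)"
      by (rule nn_integral_indicator[symmetric]) measurable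
    also have "\<dots> = (\<integral>\<^sup>+x. indicator {x \<in> space (Leb I). W x \<noteq> 0} (x(i := x i + s)) \<partial>Leb I)"
      using assms by (intro nn_integral_cong)
        (auto simp: shift_def fun_upd_in_space_Leb split: split_indicator)
    finally show ?thesis .
  qed
  also have "\<dots> = (\<integral>\<^sup>+x. indicator {x \<in> space (Leb I). W x \<noteq> 0} x \<partial>Leb I)"
    using assms by (intro nn_integral_translate) auto
  also have "\<dots> = emeasure (Leb I) {x \<in> space (Leb I). W x \<noteq> 0}" by simp
  finally show ?thesis
    using assms shift_measurable[of i I W s] by (auto simp: test_fun_def shift_def)
qed

lemma dif_test_fun:
  assumes "finite I" "i \<in> I" "W \<in> test_fun I B V" "V \<ge> 0"
  shows "dif i t W \<in> test_fun I (2 * B) (2 * V)"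
proof -
  have sh: "shift i (-t) W \<in> test_fun I B V" by (rule shift_test_fun) fact+
  have [measurable]: "W \<in> borel_measurable (Leb I)" "shift i (-t) W \<in> borel_measurable (Leb I)"
    using assms(3) sh by (auto simp: test_fun_def)
  have "emeasure (Leb I) {x \<in> space (Leb I). dif i t W x \<noteq> 0}
     \<le> emeasure (Leb I) ({x \<in> space (Leb I). shift i (-t) W x \<noteq> 0} \<union> {x \<in> space (Leb I). W x \<noteq> 0})"
    by (intro emeasure_mono) (auto simp: dif_def)
  also have "\<dots> \<le> emeasure (Leb I) {x \<in> space (Leb I). shift i (-t) W x \<noteq> 0}
     + emeasure (Leb I) {x \<in> space (Leb I). W x \<noteq> 0}"
    by (rule emeasure_subadditive) auto
  also have "\<dots> \<le> ennreal V + ennreal V"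
    using assms(3) sh by (intro add_mono) (auto simp: test_fun_def)
  also have "\<dots> = ennreal (2 * V)" using assms(4) by (simp flip: ennreal_plus)
  finally have 1: "emeasure (Leb I) {x \<in> space (Leb I). dif i t W x \<noteq> 0} \<le> ennreal (2 * V)" .
  have "\<bar>dif i t W x\<bar> \<le> 2 * B" for x
  proof -
    have "\<bar>shift i (-t) W x\<bar> \<le> B" "\<bar>W x\<bar> \<le> B" using assms(3) sh by (auto simp: test_fun_def)
    then show ?thesis by (auto simp: dif_def)
  qed
  moreover have "dif i t W \<in> borel_measurable (Leb I)" unfolding dif_def by measurable
  ultimately show ?thesis using 1 by (simp add: test_fun_def)
qed

lemma dif_iter_test_fun:
  assumes "finite I" "i \<in> I" "V \<ge> 0" "W \<in> test_fun I B V"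
  shows "(dif i t ^^ k) W \<in> test_fun I (2 ^ k * B) (2 ^ k * V)"
proof (induction k)
  case (Suc k)
  then have "dif i t ((dif i t ^^ k) W) \<in> test_fun I (2 * (2 ^ k * B)) (2 * (2 ^ k * V))"
    using assms by (intro dif_test_fun) auto
  then show ?case by (simp add: mult.assoc)
qed (use assms in simp)

lemma rec_nonneg: "0 \<le> rec p" by (simp add: rec_def)

text \<open>A substitute for Hoelder's inequality: integrate \<open>|\<Phi>| \<le> \<tau> + \<tau>\<^bsup>1-p\<^esup>|\<Phi>|\<^bsup>p\<^esup>\<close> over \<open>S\<close> with
  \<open>\<tau> = A V\<^bsup>-1/p\<^esup>\<close>.\<close>

lemma nn_integral_Lp_indicator_le:
  assumes [measurable]: "\<Phi> \<in> borel_measurable M" "S \<in> sets M"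
    and Lp: "Lp_norm M p \<Phi> \<le> ennreal A" and A: "A > 0" and p: "1 \<le> p"
    and S: "emeasure M S \<le> ennreal V" and V: "V > 0"
  shows "(\<integral>\<^sup>+x. ennreal \<bar>\<Phi> x\<bar> * indicator S x \<partial>M) \<le> ennreal (2 * A * V powr (1 - rec p))"
proof (cases "p = \<infinity>")
  case True
  have "AE x in M. ennreal \<bar>\<Phi> x\<bar> \<le> ennreal A"
    using esssup_AE[where M=M and f="\<lambda>x. ennreal \<bar>\<Phi> x\<bar>"] Lp True
    by (auto simp: Lp_norm_def elim!: eventually_mono)
  then have "(\<integral>\<^sup>+x. ennreal \<bar>\<Phi> x\<bar> * indicator S x \<partial>M) \<le> (\<integral>\<^sup>+x. ennreal A * indicator S x \<partial>M)"
    by (intro nn_integral_mono_AE) (auto elim!: eventually_mono simp: indicator_def)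
  also have "\<dots> = ennreal A * emeasure M S" by (simp add: nn_integral_cmult)
  also have "\<dots> \<le> ennreal A * ennreal V" using S by (intro mult_left_mono) auto
  also have "\<dots> = ennreal (A * V)" using A V by (simp add: ennreal_mult)
  also have "\<dots> \<le> ennreal (2 * A * V powr (1 - rec p))"
    using True A V by (intro ennreal_leI) (simp add: rec_def)
  finally show ?thesis .
next
  case False
  define r where "r = enn2real p"
  have pr: "p = ennreal r" using False by (simp add: r_def less_top)
  have r1: "r \<ge> 1" using p unfolding pr by simp
  have rec: "rec p = 1 / r"
    using r1 by (simp add: rec_def pr inverse_ennreal inverse_eq_divide)
  define Z where "Z = (\<integral>\<^sup>+x. ennreal (\<bar>\<Phi> x\<bar> powr r) \<partial>M)"
  have eZ: "epowr Z (1 / r) \<le> ennreal A" using Lp False by (simp add: Lp_norm_def Z_def r_def)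
  then have Zf: "Z \<noteq> \<infinity>" by (auto simp: epowr_def top_unique)
  then have "enn2real Z powr (1 / r) \<le> A" using eZ A by (simp add: epowr_def)
  then have "(enn2real Z powr (1 / r)) powr r \<le> A powr r"
    using r1 by (intro powr_mono2) auto
  then have "enn2real Z \<le> A powr r" using r1 by (simp add: powr_powr)
  then have ZA: "Z \<le> ennreal (A powr r)"
    using Zf by (metis ennreal_enn2real_if ennreal_leI infinity_ennreal_def)
  define \<tau> where "\<tau> = A * V powr (- (1 / r))"
  have \<tau>: "\<tau> > 0" using A V by (simp add: \<tau>_def)
  have pt: "\<bar>y\<bar> \<le> \<tau> + \<tau> powr (1 - r) * \<bar>y\<bar> powr r" for y :: real
  proof (cases "\<bar>y\<bar> \<le> \<tau>")
    case True
    moreover have "0 \<le> \<tau> powr (1 - r) * \<bar>y\<bar> powr r" by simp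
    ultimately show ?thesis by linarith
  next
    case False
    then have y: "\<tau> < \<bar>y\<bar>" by simp
    have "\<bar>y\<bar> powr (1 - r) \<le> \<tau> powr (1 - r)"
      using y \<tau> r1 by (intro powr_mono2') auto
    then have "\<bar>y\<bar> powr (1 - r) * \<bar>y\<bar> powr r \<le> \<tau> powr (1 - r) * \<bar>y\<bar> powr r"
      by (intro mult_right_mono) auto
    moreover have "\<bar>y\<bar> powr (1 - r) * \<bar>y\<bar> powr r = \<bar>y\<bar>"
      using y \<tau> by (simp flip: powr_add)
    ultimately show ?thesis using \<tau> by linarith
  qed
  have "(\<integral>\<^sup>+x. ennreal \<bar>\<Phi> x\<bar> * indicator S x \<partial>M)
     \<le> (\<integral>\<^sup>+x. ennreal \<tau> * indicator S x + ennreal (\<tau> powr (1 - r)) * ennreal (\<bar>\<Phi> x\<bar> powr r) \<partial>M)"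
  proof (intro nn_integral_mono)
    fix x
    have "ennreal \<bar>\<Phi> x\<bar> \<le> ennreal (\<tau> + \<tau> powr (1 - r) * \<bar>\<Phi> x\<bar> powr r)"
      by (intro ennreal_leI pt)
    also have "\<dots> = ennreal \<tau> + ennreal (\<tau> powr (1 - r)) * ennreal (\<bar>\<Phi> x\<bar> powr r)"
      using \<tau> by (simp add: ennreal_mult)
    finally show "ennreal \<bar>\<Phi> x\<bar> * indicator S x
      \<le> ennreal \<tau> * indicator S x + ennreal (\<tau> powr (1 - r)) * ennreal (\<bar>\<Phi> x\<bar> powr r)"
      by (cases "x \<in> S") auto
  qed
  also have "\<dots> = ennreal \<tau> * emeasure M S + ennreal (\<tau> powr (1 - r)) * Z"
    unfolding Z_def by (subst nn_integral_add) (auto simp: nn_integral_cmult)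
  also have "\<dots> \<le> ennreal \<tau> * ennreal V + ennreal (\<tau> powr (1 - r)) * ennreal (A powr r)"
    using S ZA by (intro add_mono mult_left_mono) auto
  also have "\<dots> = ennreal (\<tau> * V + \<tau> powr (1 - r) * A powr r)"
    using \<tau> V by (simp add: ennreal_mult)
  \<comment> \<open>The choice of \<tau> makes both terms equal to
    \<open>A * V powr (1 - 1 / r)\<close>; this is the factor 2.\<close>
  also have "\<tau> * V + \<tau> powr (1 - r) * A powr r = 2 * A * V powr (1 - rec p)"
  proof -
    have 1: "\<tau> * V = A * V powr (1 - 1 / r)"
      using V by (simp add: \<tau>_def powr_diff powr_minus field_simps)
    have "\<tau> powr (1 - r) = A powr (1 - r) * V powr ((- (1 / r)) * (1 - r))"
      using A V by (simp add: \<tau>_def powr_mult powr_powr)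
    also have "(- (1 / r)) * (1 - r) = 1 - 1 / r" using r1 by (simp add: field_simps)
    finally have "\<tau> powr (1 - r) = A powr (1 - r) * V powr (1 - 1 / r)" .
    moreover have "A powr (1 - r) * A powr r = A" using A by (simp flip: powr_add)
    ultimately have "\<tau> powr (1 - r) * A powr r = A * V powr (1 - 1 / r)"
      by (metis mult.assoc mult.commute)
    then show ?thesis using 1 rec by simp
  qed
  finally show ?thesis .
qed

lemma nn_integral_test_fun_le:
  assumes \<Phi>[measurable]: "\<Phi> \<in> borel_measurable (Leb I)" and "Lp_norm (Leb I) p \<Phi> \<le> ennreal A" "A > 0" "1 \<le> p"
    and W: "W \<in> test_fun I B V" "V > 0"
  shows "(\<integral>\<^sup>+x. ennreal \<bar>W x * \<Phi> x\<bar> \<partial>Leb I) \<le> ennreal (2 * B * A * V powr (1 - rec p))"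
proof -
  have [measurable]: "W \<in> borel_measurable (Leb I)" using W by (simp add: test_fun_def)
  have Wb: "\<bar>W x\<bar> \<le> B" for x using W by (auto simp: test_fun_def)
  have B: "B \<ge> 0" using Wb[of undefined] by linarith
  define S where "S = {x \<in> space (Leb I). W x \<noteq> 0}"
  have [measurable]: "S \<in> sets (Leb I)" unfolding S_def by measurable
  have "(\<integral>\<^sup>+x. ennreal \<bar>W x * \<Phi> x\<bar> \<partial>Leb I) \<le> (\<integral>\<^sup>+x. ennreal B * (ennreal \<bar>\<Phi> x\<bar> * indicator S x) \<partial>Leb I)"
  proof (intro nn_integral_mono)
    fix x assume x: "x \<in> space (Leb I)"
    have "\<bar>W x * \<Phi> x\<bar> \<le> B * \<bar>\<Phi> x\<bar>" using Wb[of x] by (auto simp: abs_mult intro: mult_right_mono)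
    then have "ennreal \<bar>W x * \<Phi> x\<bar> \<le> ennreal B * ennreal \<bar>\<Phi> x\<bar>"
      using B by (simp add: ennreal_leI flip: ennreal_mult)
    then show "ennreal \<bar>W x * \<Phi> x\<bar> \<le> ennreal B * (ennreal \<bar>\<Phi> x\<bar> * indicator S x)"
      using x by (auto simp: S_def indicator_def)
  qed
  also have "\<dots> = ennreal B * (\<integral>\<^sup>+x. ennreal \<bar>\<Phi> x\<bar> * indicator S x \<partial>Leb I)"
    by (rule nn_integral_cmult) auto
  also have "\<dots> \<le> ennreal B * ennreal (2 * A * V powr (1 - rec p))"
    using W assms by (intro mult_left_mono nn_integral_Lp_indicator_le) (auto simp: test_fun_def S_def)
  also have "\<dots> = ennreal (2 * B * A * V powr (1 - rec p))"
    using B assms by (simp add: mult_ac flip: ennreal_mult)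
  finally show ?thesis .
qed

subsection \<open>Iterated differences in Nikolskii classes\<close>

lemma test_fun_bound_nonneg:
  assumes "W \<in> test_fun I B V" shows "B \<ge> 0"
proof -
  have "\<bar>W undefined\<bar> \<le> B" using assms by (simp add: test_fun_def)
  then show ?thesis by linarith
qed

lemma integrable_test_fun:
  assumes [measurable]: "\<Phi> \<in> borel_measurable (Leb I)" and "Lp_norm (Leb I) p \<Phi> \<le> ennreal A" "A > 0" "1 \<le> p"
    and W: "W \<in> test_fun I B V" "V > 0"
  shows "integrable (Leb I) (\<lambda>x. W x * \<Phi> x)"
proof (rule integrableI_bounded)
  have [measurable]: "W \<in> borel_measurable (Leb I)" using W by (simp add: test_fun_def)
  show "(\<lambda>x. W x * \<Phi> x) \<in> borel_measurable (Leb I)" by measurable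
  show "(\<integral>\<^sup>+x. ennreal (norm (W x * \<Phi> x)) \<partial>Leb I) < \<infinity>"
    using nn_integral_test_fun_le[OF assms] by (simp add: le_less_trans)
qed

text \<open>Translations in opposite directions are adjoint. This is the tool that moves differences
  between the function and the kernel.\<close>

lemma integral_shift_mult:
  assumes "finite I" "i \<in> I" and [measurable]: "W \<in> borel_measurable (Leb I)" "\<Phi> \<in> borel_measurable (Leb I)"
  shows "(\<integral>x. shift i (- s) W x * \<Phi> x \<partial>Leb I) = (\<integral>x. W x * shift i s \<Phi> x \<partial>Leb I)"
proof -
  have [measurable]: "shift i s \<Phi> \<in> borel_measurable (Leb I)"
    using assms by (intro shift_measurable)
  have "(\<integral>x. W x * shift i s \<Phi> x \<partial>Leb I) = (\<integral>x. shift i (- s) (\<lambda>x. W x * shift i s \<Phi> x) x \<partial>Leb I)"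
    using assms by (intro integral_shift[symmetric]) measurable
  also have "\<dots> = (\<integral>x. shift i (- s) W x * \<Phi> x \<partial>Leb I)"
    by (simp add: shift_def)
  finally show ?thesis ..
qed

lemma nn_integral_shift_mult:
  assumes "finite I" "i \<in> I" and [measurable]: "W \<in> borel_measurable (Leb I)" "\<Phi> \<in> borel_measurable (Leb I)"
  shows "(\<integral>\<^sup>+x. ennreal \<bar>W x * shift i s \<Phi> x\<bar> \<partial>Leb I) = (\<integral>\<^sup>+x. ennreal \<bar>shift i (- s) W x * \<Phi> x\<bar> \<partial>Leb I)"
proof -
  have [measurable]: "shift i s \<Phi> \<in> borel_measurable (Leb I)"
    using assms by (intro shift_measurable)
  have "(\<integral>\<^sup>+x. ennreal \<bar>W x * shift i s \<Phi> x\<bar> \<partial>Leb I)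
    = (\<integral>\<^sup>+x. (\<lambda>x. ennreal \<bar>W x * shift i s \<Phi> x\<bar>) (x(i := x i + - s)) \<partial>Leb I)"
    using assms by (intro nn_integral_translate[symmetric]) measurable
  also have "\<dots> = (\<integral>\<^sup>+x. ennreal \<bar>shift i (- s) W x * \<Phi> x\<bar> \<partial>Leb I)"
    by (simp add: shift_def)
  finally show ?thesis .
qed

text \<open>The sign of the step is absorbed into the weight \<open>c\<close>, so that no oriented integral is needed.\<close>

lemma partial_deriv_increment:
  assumes "finite I" "i \<in> I" and D: "is_partial_deriv I i \<Phi> \<Phi>'"
    and c: "c = (\<lambda>s. indicator {0..t} s - indicator {t..0} s :: real)"
  shows "AE x in Leb I. shift i t \<Phi> x - \<Phi> x = (\<integral>s. c s * shift i s \<Phi>' x \<partial>lborel)"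
proof -
  obtain F where F: "AE x in Leb I. F x = \<Phi> x" and
    l: "AE x in Leb I. \<forall>a b. a \<le> b \<longrightarrow>
          F (x(i := b)) - F (x(i := a)) = (LINT s:{a..b}|lborel. \<Phi>' (x(i := s)))"
  proof -
    obtain F where "AE x in Leb I. F x = \<Phi> x" and
      l: "AE x in Leb I. \<forall>a b. a \<le> b \<longrightarrow> set_integrable lborel {a..b} (\<lambda>s. \<Phi>' (x(i := s))) \<and>
            F (x(i := b)) - F (x(i := a)) = (LINT s:{a..b}|lborel. \<Phi>' (x(i := s)))"
      using D unfolding is_partial_deriv_def by blast
    moreover have "AE x in Leb I. \<forall>a b. a \<le> b \<longrightarrow>
          F (x(i := b)) - F (x(i := a)) = (LINT s:{a..b}|lborel. \<Phi>' (x(i := s)))"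
      using l by eventually_elim blast
    ultimately show ?thesis using that by blast
  qed
  \<comment> \<open>The increment also needs the version \<open>F\<close> to agree with \<Phi> at
    the translated point; translations preserve null sets.\<close>
  have F': "AE x in Leb I. F (x(i := x i + t)) = \<Phi> (x(i := x i + t))"
    by (rule AE_translate[OF assms(1,2) F])
  have sub: "(LINT s:{x i + a..x i + b}|lborel. \<Phi>' (x(i := s))) = (\<integral>s. indicator {a..b} s * shift i s \<Phi>' x \<partial>lborel)"
    for a b and x :: point
  proof -
    have "(LINT s:{x i + a..x i + b}|lborel. \<Phi>' (x(i := s)))
       = (\<integral>s. indicator {x i + a..x i + b} s * \<Phi>' (x(i := s)) \<partial>lborel)"
      by (simp add: set_lebesgue_integral_def)
    also have "\<dots> = (\<integral>s. indicator {x i + a..x i + b} (x i + 1 * s) * \<Phi>' (x(i := x i + 1 * s)) \<partial>lborel)"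
      by (subst lborel_integral_real_affine[where c=1 and t="x i"]) auto
    also have "\<dots> = (\<integral>s. indicator {a..b} s * shift i s \<Phi>' x \<partial>lborel)"
      by (intro Bochner_Integration.integral_cong) (auto simp: shift_def indicator_def)
    finally show ?thesis .
  qed
  from F F' l show ?thesis
  proof eventually_elim
    case (elim x)
    consider "t = 0" | "t > 0" | "t < 0" by linarith
    then show ?case
    proof cases
      case 1 then show ?thesis by (simp add: c shift_0)
    next
      case 2
      then have "c = indicator {0..t}" by (auto simp: c)
      moreover have "F (x(i := x i + t)) - F (x(i := x i)) = (LINT s:{x i..x i + t}|lborel. \<Phi>' (x(i := s)))"
        using elim(3) 2 by (auto simp del: fun_upd_triv)
      ultimately show ?thesis using elim(1,2) sub[of x 0 t] by (simp add: shift_def)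
    next
      case 3
      then have c': "c = (\<lambda>s. - indicator {t..0} s)" by (auto simp: c)
      have "F (x(i := x i)) - F (x(i := x i + t)) = (LINT s:{x i + t..x i}|lborel. \<Phi>' (x(i := s)))"
        using elim(3) 3 by (auto simp del: fun_upd_triv)
      then show ?thesis using elim(1,2) sub[of x t 0] unfolding c' by (simp add: shift_def)
    qed
  qed
qed

text \<open>One difference is exchanged for one derivative. By adjointness the outermost difference
  falls on \<Phi>, whose increment is an integral of translates of \<open>\<Phi>'\<close> over an
  interval of length |t|. After Fubini each translation is moved back to the test function. The
  assumption on \<open>N\<close> ranges over the whole class since it is applied to all these
  translates.\<close>

lemma pairing_partial_deriv_step:
  assumes fin: "finite I" "i \<in> I" and D: "is_partial_deriv I i \<Phi> \<Phi>'"
    and A: "Lp_norm (Leb I) p \<Phi> \<le> ennreal A" "Lp_norm (Leb I) p \<Phi>' \<le> ennreal A" "A > 0" "1 \<le> p"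
    and V: "V > 0" and W: "W \<in> test_fun I B V"
    and N: "\<And>W. W \<in> test_fun I B V \<Longrightarrow> \<bar>\<integral>x. (dif i t ^^ k) W x * \<Phi>' x \<partial>Leb I\<bar> \<le> N"
  shows "\<bar>\<integral>x. (dif i t ^^ Suc k) W x * \<Phi> x \<partial>Leb I\<bar> \<le> \<bar>t\<bar> * N"
proof -
  interpret pair_sigma_finite "Leb I" "lborel :: real measure" by (rule pair_sigma_finite_Leb_lborel[OF fin(1)])
  have \<Phi>m[measurable]: "\<Phi> \<in> borel_measurable (Leb I)" and \<Phi>'m[measurable]: "\<Phi>' \<in> borel_measurable (Leb I)"
    using D by (auto simp: is_partial_deriv_def)
  define U where "U = (dif i t ^^ k) W"
  have U: "U \<in> test_fun I (2 ^ k * B) (2 ^ k * V)"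
    unfolding U_def using fin V W by (intro dif_iter_test_fun) auto
  have V': "2 ^ k * V > 0" using V by simp
  have Um[measurable]: "U \<in> borel_measurable (Leb I)" by (rule test_fun_measurable[OF U])
  have N0: "N \<ge> 0" using N[OF W] by linarith
  define c where "c = (\<lambda>s. indicator {0..t} s - indicator {t..0} s :: real)"
  have [measurable]: "c \<in> borel_measurable borel" unfolding c_def by measurable
  have cb: "\<bar>c s\<bar> \<le> indicator {min 0 t..max 0 t} s" for s by (auto simp: c_def indicator_def)
  have c1: "(\<integral>\<^sup>+s. ennreal \<bar>c s\<bar> \<partial>lborel) \<le> ennreal \<bar>t\<bar>"
  proof -
    have "(\<integral>\<^sup>+s. ennreal \<bar>c s\<bar> \<partial>lborel) \<le> (\<integral>\<^sup>+s. indicator {min 0 t..max 0 t} s \<partial>lborel)"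
      using cb by (intro nn_integral_mono) (auto simp: ennreal_indicator[symmetric] intro!: ennreal_leI)
    also have "\<dots> = ennreal \<bar>t\<bar>" by (simp add: emeasure_lborel_Icc_eq max_def min_def)
    finally show ?thesis .
  qed
  \<comment> \<open>A bound for the inner integral that does not depend on \<open>s\<close>; it only
    serves to justify Fubini.\<close>
  define C where "C = 2 * (2 ^ k * B) * A * (2 ^ k * V) powr (1 - rec p)"
  have C: "(\<integral>\<^sup>+x. ennreal \<bar>U x * shift i s \<Phi>' x\<bar> \<partial>Leb I) \<le> ennreal C" for s
    unfolding C_def nn_integral_shift_mult[OF fin Um \<Phi>'m]
    using fin A V' U by (intro nn_integral_test_fun_le shift_test_fun) auto
  have m: "(\<lambda>(x, s). U x * (c s * shift i s \<Phi>' x)) \<in> borel_measurable (Leb I \<Otimes>\<^sub>M lborel)"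
    unfolding shift_def using fin by measurable
  have int: "integrable (Leb I \<Otimes>\<^sub>M lborel) (\<lambda>(x, s). U x * (c s * shift i s \<Phi>' x))"
  proof (rule integrableI_bounded[OF m])
    have "(\<integral>\<^sup>+z. ennreal (norm (case z of (x, s) \<Rightarrow> U x * (c s * shift i s \<Phi>' x))) \<partial>(Leb I \<Otimes>\<^sub>M lborel))
        = (\<integral>\<^sup>+s. \<integral>\<^sup>+x. ennreal (norm (U x * (c s * shift i s \<Phi>' x))) \<partial>Leb I \<partial>lborel)"
      using m by (subst nn_integral_snd[symmetric]) auto
    also have "\<dots> = (\<integral>\<^sup>+s. ennreal \<bar>c s\<bar> * (\<integral>\<^sup>+x. ennreal \<bar>U x * shift i s \<Phi>' x\<bar> \<partial>Leb I) \<partial>lborel)"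
    proof (intro nn_integral_cong)
      fix s
      have [measurable]: "shift i s \<Phi>' \<in> borel_measurable (Leb I)"
        using fin by (intro shift_measurable) auto
      show "(\<integral>\<^sup>+x. ennreal (norm (U x * (c s * shift i s \<Phi>' x))) \<partial>Leb I)
         = ennreal \<bar>c s\<bar> * (\<integral>\<^sup>+x. ennreal \<bar>U x * shift i s \<Phi>' x\<bar> \<partial>Leb I)"
        by (subst nn_integral_cmult[symmetric]) (auto intro!: nn_integral_cong simp: abs_mult mult_ac simp flip: ennreal_mult)
    qed
    also have "\<dots> \<le> (\<integral>\<^sup>+s. ennreal \<bar>c s\<bar> * ennreal C \<partial>lborel)"
      using C by (intro nn_integral_mono mult_left_mono) auto
    also have "\<dots> = (\<integral>\<^sup>+s. ennreal \<bar>c s\<bar> \<partial>lborel) * ennreal C"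
      by (rule nn_integral_multc) auto
    also have "\<dots> \<le> ennreal \<bar>t\<bar> * ennreal C" using c1 by (intro mult_right_mono) auto
    also have "\<dots> < \<infinity>" by (simp add: ennreal_mult_less_top)
    finally show "(\<integral>\<^sup>+z. ennreal (norm (case z of (x, s) \<Rightarrow> U x * (c s * shift i s \<Phi>' x))) \<partial>(Leb I \<Otimes>\<^sub>M lborel)) < \<infinity>" .
  qed
  have i1: "integrable (Leb I) (\<lambda>x. U x * \<Phi> x)"
    using A U V' by (intro integrable_test_fun[where p=p and A=A and V="2 ^ k * V"]) auto
  have i2: "integrable (Leb I) (\<lambda>x. shift i (- t) U x * \<Phi> x)"
    using A U V' fin by (intro integrable_test_fun[where p=p and A=A and V="2 ^ k * V"] shift_test_fun) auto
  have [measurable]: "shift i t \<Phi> \<in> borel_measurable (Leb I)"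
    using fin by (intro shift_measurable) auto
  have i3: "integrable (Leb I) (\<lambda>x. U x * shift i t \<Phi> x)"
  proof (rule integrableI_bounded)
    show "(\<integral>\<^sup>+x. ennreal (norm (U x * shift i t \<Phi> x)) \<partial>Leb I) < \<infinity>"
      using i2 nn_integral_shift_mult[OF fin Um \<Phi>m, of t] by (simp add: integrable_iff_bounded)
  qed measurable
  have "(\<integral>x. (dif i t ^^ Suc k) W x * \<Phi> x \<partial>Leb I) = (\<integral>x. shift i (- t) U x * \<Phi> x - U x * \<Phi> x \<partial>Leb I)"
    by (simp add: U_def dif_def left_diff_distrib)
  also have "\<dots> = (\<integral>x. U x * (shift i t \<Phi> x - \<Phi> x) \<partial>Leb I)"
    using i1 i2 i3 integral_shift_mult[OF fin Um \<Phi>m, of t]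
    by (simp add: right_diff_distrib)
  also have "\<dots> = (\<integral>x. U x * (\<integral>s. c s * shift i s \<Phi>' x \<partial>lborel) \<partial>Leb I)"
  proof (rule integral_cong_AE)
    show "AE x in Leb I. U x * (shift i t \<Phi> x - \<Phi> x) = U x * (\<integral>s. c s * shift i s \<Phi>' x \<partial>lborel)"
      using partial_deriv_increment[OF fin D c_def] by eventually_elim simp
    show "(\<lambda>x. U x * (\<integral>s. c s * shift i s \<Phi>' x \<partial>lborel)) \<in> borel_measurable (Leb I)"
      unfolding shift_def using fin by measurable
  qed measurable
  also have "\<dots> = (\<integral>x. \<integral>s. U x * (c s * shift i s \<Phi>' x) \<partial>lborel \<partial>Leb I)"
    by simp
  also have "\<dots> = (\<integral>s. \<integral>x. U x * (c s * shift i s \<Phi>' x) \<partial>Leb I \<partial>lborel)"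
    by (rule Fubini_integral[OF int, symmetric])
  finally have eq: "(\<integral>x. (dif i t ^^ Suc k) W x * \<Phi> x \<partial>Leb I)
      = (\<integral>s. \<integral>x. U x * (c s * shift i s \<Phi>' x) \<partial>Leb I \<partial>lborel)" .
  \<comment> \<open>Translations commute with \<open>dif\<close>, so the translate of
    \<open>U\<close> is the iterated difference of a translate of \<open>W\<close>, which lies in
    the same class.\<close>
  have J: "\<bar>\<integral>x. U x * (c s * shift i s \<Phi>' x) \<partial>Leb I\<bar> \<le> \<bar>c s\<bar> * N" for s
  proof -
    have "(\<integral>x. U x * (c s * shift i s \<Phi>' x) \<partial>Leb I) = c s * (\<integral>x. U x * shift i s \<Phi>' x \<partial>Leb I)"
      by (subst integral_mult_right_zero[symmetric]) (simp add: mult_ac)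
    also have "(\<integral>x. U x * shift i s \<Phi>' x \<partial>Leb I) = (\<integral>x. shift i (- s) U x * \<Phi>' x \<partial>Leb I)"
      using fin by (intro integral_shift_mult[symmetric]) auto
    also have "\<dots> = (\<integral>x. (dif i t ^^ k) (shift i (- s) W) x * \<Phi>' x \<partial>Leb I)"
      by (simp add: U_def shift_dif_iter)
    finally show ?thesis
      using N[OF shift_test_fun[OF fin W, of "- s"]] by (simp add: abs_mult mult_left_mono)
  qed
  have "ennreal (norm (\<integral>s. \<integral>x. U x * (c s * shift i s \<Phi>' x) \<partial>Leb I \<partial>lborel))
      \<le> (\<integral>\<^sup>+s. ennreal (norm (\<integral>x. U x * (c s * shift i s \<Phi>' x) \<partial>Leb I)) \<partial>lborel)"
    using integrable_snd[OF int] by (intro integral_norm_bound_ennreal) auto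
  also have "\<dots> \<le> (\<integral>\<^sup>+s. ennreal \<bar>c s\<bar> * ennreal N \<partial>lborel)"
    using J N0 by (intro nn_integral_mono) (auto intro!: ennreal_leI simp flip: ennreal_mult)
  also have "\<dots> = (\<integral>\<^sup>+s. ennreal \<bar>c s\<bar> \<partial>lborel) * ennreal N"
    by (rule nn_integral_multc) auto
  also have "\<dots> \<le> ennreal \<bar>t\<bar> * ennreal N" using c1 by (intro mult_right_mono) auto
  also have "\<dots> = ennreal (\<bar>t\<bar> * N)" using N0 by (simp add: ennreal_mult)
  finally show ?thesis using eq N0 by (simp add: ennreal_le_iff)
qed

lemma strict_floor_bounds:
  assumes "0 < b" shows "real (strict_floor b) < b" "b \<le> real (strict_floor b) + 1"
  using assms unfolding strict_floor_def by linarith+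

text \<open>The \<open>l\<close> differences are spent in three ways, with \<open>m\<close> the
  strict floor of \<open>\<beta> i\<close>: \<open>m\<close> of them are exchanged for derivatives
  at a factor |t| each, one meets the Hoelder condition on the top derivative and yields the power
  \<open>\<beta> i - m\<close>, and the remaining \<open>l - m - 1\<close> cost a factor 2 each. The
  condition \<open>\<beta> i \<le> l\<close> guarantees \<open>m < l\<close>.\<close>

lemma pairing_iterated_difference_le:
  assumes fin: "finite I" "i \<in> I" and f: "f \<in> Nikolskii I p \<beta> L" and \<beta>: "0 < \<beta> i" "\<beta> i \<le> real l"
    and L: "L i > 0" and p: "1 \<le> p i" and V: "V > 0" and W: "W \<in> test_fun I B V" and t: "t \<noteq> 0"
  shows "\<bar>\<integral>x. (dif i t ^^ l) W x * f x \<partial>Leb I\<bar>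
     \<le> 2 ^ l * (2 * B * L i * \<bar>t\<bar> powr \<beta> i * V powr (1 - rec (p i)))"
proof -
  define m where "m = strict_floor (\<beta> i)"
  have m: "real m < \<beta> i" "m < l" using strict_floor_bounds[OF \<beta>(1)] \<beta> by (auto simp: m_def)
  have [measurable]: "f \<in> borel_measurable (Leb I)" using f by (simp add: Nikolskii_def)
  obtain D where D0: "D 0 = f" and Dk: "\<And>k. k < m \<Longrightarrow> is_partial_deriv I i (D k) (D (Suc k))"
    and DL: "\<And>k. k \<le> m \<Longrightarrow> Lp_norm (Leb I) (p i) (D k) \<le> ennreal (L i)"
    and Dt: "\<And>t. Lp_norm (Leb I) (p i) (\<lambda>x. D m (x(i := x i + t)) - D m x) \<le> ennreal (L i * \<bar>t\<bar> powr (\<beta> i - real m))"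
    using f fin unfolding Nikolskii_def m_def by blast
  have Dm[measurable]: "D k \<in> borel_measurable (Leb I)" if "k \<le> m" for k
  proof (cases k)
    case (Suc k')
    then show ?thesis using Dk[of k'] that by (auto simp: is_partial_deriv_def)
  qed (simp add: D0)
  define N where "N = 2 * B * (L i * \<bar>t\<bar> powr (\<beta> i - real m)) * V powr (1 - rec (p i))"
  \<comment> \<open>The induction runs from the top derivative downwards: \<open>D m\<close> absorbs
    one difference by the Hoelder condition, and every lower derivative absorbs one more.\<close>
  have step: "\<bar>\<integral>x. (dif i t ^^ Suc j) W x * D (m - j) x \<partial>Leb I\<bar> \<le> \<bar>t\<bar> ^ j * N"
    if "j \<le> m" "W \<in> test_fun I B V" for j W
    using that
  proof (induction j arbitrary: W)
    case 0
    have Wm[measurable]: "W \<in> borel_measurable (Leb I)" and Dmm[measurable]: "D m \<in> borel_measurable (Leb I)"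
      and sDm[measurable]: "shift i t (D m) \<in> borel_measurable (Leb I)"
      using 0 Dm[of m] fin by (auto simp: test_fun_def intro: shift_measurable)
    have i1: "integrable (Leb I) (\<lambda>x. W x * D m x)"
      using DL L p 0 V by (intro integrable_test_fun[where p="p i" and A="L i" and V=V]) auto
    have i2: "integrable (Leb I) (\<lambda>x. shift i (- t) W x * D m x)"
      using DL L p 0 V fin by (intro integrable_test_fun[where p="p i" and A="L i" and V=V] shift_test_fun) auto
    have i3: "integrable (Leb I) (\<lambda>x. W x * shift i t (D m) x)"
    proof (rule integrableI_bounded)
      show "(\<integral>\<^sup>+x. ennreal (norm (W x * shift i t (D m) x)) \<partial>Leb I) < \<infinity>"
        using i2 nn_integral_shift_mult[OF fin Wm Dmm, of t] by (simp add: integrable_iff_bounded)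
    qed measurable
    have "(\<integral>x. (dif i t ^^ Suc 0) W x * D m x \<partial>Leb I) = (\<integral>x. shift i (- t) W x * D m x - W x * D m x \<partial>Leb I)"
      by (simp add: dif_def left_diff_distrib)
    also have "\<dots> = (\<integral>x. W x * (shift i t (D m) x - D m x) \<partial>Leb I)"
      using i1 i2 i3 integral_shift_mult[OF fin Wm Dmm, of t]
      by (simp add: right_diff_distrib)
    finally have eq: "(\<integral>x. (dif i t ^^ Suc 0) W x * D m x \<partial>Leb I) = (\<integral>x. W x * (shift i t (D m) x - D m x) \<partial>Leb I)" .
    have A: "L i * \<bar>t\<bar> powr (\<beta> i - real m) > 0" using L t by simp
    have [measurable]: "(\<lambda>x. D m (x(i := x i + t)) - D m x) \<in> borel_measurable (Leb I)"
      using borel_measurable_diff[OF sDm Dmm] by (simp add: shift_def)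
    have "integrable (Leb I) (\<lambda>x. W x * (shift i t (D m) x - D m x))"
      using i1 i3 by (simp add: right_diff_distrib)
    then have "ennreal (norm (\<integral>x. W x * (shift i t (D m) x - D m x) \<partial>Leb I))
       \<le> (\<integral>\<^sup>+x. ennreal (norm (W x * (shift i t (D m) x - D m x))) \<partial>Leb I)"
      by (rule integral_norm_bound_ennreal)
    also have "\<dots> \<le> ennreal N"
      unfolding N_def real_norm_def
      using Dt[of t] A p 0 V by (intro nn_integral_test_fun_le) (auto simp: shift_def[abs_def])
    finally have "ennreal \<bar>\<integral>x. (dif i t ^^ Suc 0) W x * D m x \<partial>Leb I\<bar> \<le> ennreal N"
      using eq by simp
    moreover have "N \<ge> 0"
      using test_fun_bound_nonneg[OF W] A by (simp add: N_def)
    ultimately show ?case by (simp add: ennreal_le_iff)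
  next
    case (Suc j)
    have "is_partial_deriv I i (D (m - Suc j)) (D (m - j))"
      using Dk[of "m - Suc j"] Suc.prems by (simp add: Suc_diff_Suc)
    then have "\<bar>\<integral>x. (dif i t ^^ Suc (Suc j)) W x * D (m - Suc j) x \<partial>Leb I\<bar> \<le> \<bar>t\<bar> * (\<bar>t\<bar> ^ j * N)"
      using Suc DL L p V by (intro pairing_partial_deriv_step[OF fin]) auto
    then show ?case by (simp add: mult.assoc)
  qed
  \<comment> \<open>A surplus difference splits into the pairings for \<open>W\<close> and for a
    translate of \<open>W\<close>; both obey the same bound, hence a factor 2 each time.\<close>
  have ext: "\<bar>\<integral>x. (dif i t ^^ (Suc m + j)) W x * f x \<partial>Leb I\<bar> \<le> 2 ^ j * (\<bar>t\<bar> ^ m * N)"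
    if "W \<in> test_fun I B V" for j W
    using that
  proof (induction j arbitrary: W)
    case 0
    then show ?case using step[of m W] by (simp add: D0)
  next
    case (Suc j)
    define n where "n = Suc m + j"
    have sW: "shift i (- t) W \<in> test_fun I B V" using fin Suc by (intro shift_test_fun)
    have int: "integrable (Leb I) (\<lambda>x. (dif i t ^^ n) W' x * f x)" if "W' \<in> test_fun I B V" for W'
      using dif_iter_test_fun[OF fin _ that, where t=t and k=n] DL[of 0] V L p D0
      by (intro integrable_test_fun[where p="p i" and A="L i" and V="2 ^ n * V"]) auto
    have "(dif i t ^^ Suc n) W = (\<lambda>x. (dif i t ^^ n) (shift i (- t) W) x - (dif i t ^^ n) W x)"
      by (simp add: dif_def[of i t "(dif i t ^^ n) W"] shift_dif_iter)
    then have "(\<integral>x. (dif i t ^^ Suc n) W x * f x \<partial>Leb I)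
      = (\<integral>x. (dif i t ^^ n) (shift i (- t) W) x * f x \<partial>Leb I) - (\<integral>x. (dif i t ^^ n) W x * f x \<partial>Leb I)"
      using int[OF sW] int[OF Suc.prems] by (simp add: left_diff_distrib del: funpow.simps)
    then have "\<bar>\<integral>x. (dif i t ^^ Suc n) W x * f x \<partial>Leb I\<bar> \<le> 2 * (2 ^ j * (\<bar>t\<bar> ^ m * N))"
      using Suc.IH[OF sW] Suc.IH[OF Suc.prems] unfolding n_def by linarith
    then show ?case by (simp add: n_def mult.assoc)
  qed
  define j where "j = l - Suc m"
  have l: "l = Suc m + j" "j \<le> l" using m by (auto simp: j_def)
  have tm: "\<bar>t\<bar> ^ m * N = 2 * B * L i * \<bar>t\<bar> powr \<beta> i * V powr (1 - rec (p i))"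
  proof -
    have "\<bar>t\<bar> ^ m * \<bar>t\<bar> powr (\<beta> i - real m) = \<bar>t\<bar> powr \<beta> i"
      using t by (simp add: powr_realpow[symmetric] flip: powr_add)
    then show ?thesis unfolding N_def by (simp add: mult_ac)
  qed
  have "\<bar>\<integral>x. (dif i t ^^ l) W x * f x \<partial>Leb I\<bar> \<le> 2 ^ j * (\<bar>t\<bar> ^ m * N)"
    using ext[OF W, of j] l by simp
  also have "\<dots> \<le> 2 ^ l * (\<bar>t\<bar> ^ m * N)"
  proof (rule mult_right_mono)
    show "(2::real) ^ j \<le> 2 ^ l" using l by (intro power_increasing) auto
    show "0 \<le> \<bar>t\<bar> ^ m * N" using L test_fun_bound_nonneg[OF W] by (simp add: N_def)
  qed
  finally show ?thesis by (simp only: tm)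
qed

subsection \<open>Kernels\<close>

text \<open>Pascal's rule. It is the induction step for the expansion of iterated differences in
  \<open>dif_iter_eq\<close>.\<close>

lemma alternating_binomial_sum_Suc:
  fixes a :: "nat \<Rightarrow> real"
  shows "(\<Sum>j\<le>Suc l. (-1) ^ j * real (Suc l choose j) * a j)
    = (\<Sum>j\<le>l. (-1) ^ j * real (l choose j) * a j) - (\<Sum>j\<le>l. (-1) ^ j * real (l choose j) * a (Suc j))"
proof -
  have 1: "(\<Sum>j\<le>l. (-1) ^ j * real (l choose j) * a j)
      = a 0 + (\<Sum>j\<le>l. (-1) ^ Suc j * real (l choose Suc j) * a (Suc j))"
  proof -
    have "(\<Sum>j\<le>l. (-1) ^ j * real (l choose j) * a j) = (\<Sum>j\<le>Suc l. (-1) ^ j * real (l choose j) * a j)"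
      by (simp add: binomial_eq_0)
    then show ?thesis by (subst (asm) sum.atMost_Suc_shift) simp
  qed
  have "(\<Sum>j\<le>Suc l. (-1) ^ j * real (Suc l choose j) * a j)
      = a 0 + (\<Sum>j\<le>l. (-1) ^ Suc j * real (Suc l choose Suc j) * a (Suc j))"
    by (subst sum.atMost_Suc_shift) simp
  also have "(\<Sum>j\<le>l. (-1) ^ Suc j * real (Suc l choose Suc j) * a (Suc j))
      = (\<Sum>j\<le>l. (-1) ^ Suc j * real (l choose Suc j) * a (Suc j) - (-1) ^ j * real (l choose j) * a (Suc j))"
    by (intro sum.cong refl) (simp add: algebra_simps)
  finally show ?thesis using 1 by (simp add: sum_subtractf)
qed

text \<open>The binomial theorem for powers of a translation minus the identity. Pulling out the
  sign leaves the alternating sum in the form in which it arises from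
  \<open>kernel_l\<close>.\<close>

lemma dif_iter_eq:
  "(dif i t ^^ l) W x = (-1) ^ l * (\<Sum>j\<le>l. (-1) ^ j * real (l choose j) * shift i (- (real j * t)) W x)"
proof (induction l arbitrary: W)
  case (Suc l)
  have "(dif i t ^^ Suc l) W x = (dif i t ^^ l) (shift i (- t) W) x - (dif i t ^^ l) W x"
    by (simp add: dif_def[of i t "(dif i t ^^ l) W"] shift_dif_iter)
  also have "\<dots> = (-1) ^ Suc l * ((\<Sum>j\<le>l. (-1) ^ j * real (l choose j) * shift i (- (real j * t)) W x)
     - (\<Sum>j\<le>l. (-1) ^ j * real (l choose j) * shift i (- (real (Suc j) * t)) W x))"
  proof -
    have "- (real j * t) + - t = - (real (Suc j) * t)" for j by (simp add: algebra_simps)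
    then show ?thesis by (simp only: Suc.IH shift_shift power_Suc) (simp add: right_diff_distrib)
  qed
  finally show ?case by (simp only: alternating_binomial_sum_Suc)
qed (simp add: shift_0)

text \<open>The radius \<open>1 / (2 * l)\<close> is such that all rescalings
  \<open>u (z / i)\<close> with \<open>i \<le> l\<close>, and hence \<open>kernel_l u l\<close>,
  vanish outside [-1/2, 1/2].\<close>

definition kernel_base :: "nat \<Rightarrow> (real \<Rightarrow> real) \<Rightarrow> bool" where
  "kernel_base l u \<longleftrightarrow> l \<ge> 1 \<and> continuous_on UNIV u \<and> (\<forall>z. \<bar>z\<bar> > 1 / (2 * real l) \<longrightarrow> u z = 0) \<and> (\<integral>z. u z \<partial>lborel) = 1"

lemma bounded_compact_support:
  fixes u :: "real \<Rightarrow> real"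
  assumes "continuous_on UNIV u" "\<And>z. \<bar>z\<bar> > a \<Longrightarrow> u z = 0"
  obtains B where "B > 0" "\<And>z. \<bar>u z\<bar> \<le> B"
proof -
  have "compact (u ` {-a..a})"
    using assms by (intro compact_continuous_image) (auto intro: continuous_on_subset)
  then obtain b where b: "\<forall>y\<in>u ` {-a..a}. norm y \<le> b"
    using compact_imp_bounded bounded_iff by blast
  have "\<bar>u z\<bar> \<le> max b 1" for z
  proof (cases "\<bar>z\<bar> > a")
    case False
    then have "u z \<in> u ` {-a..a}" by (intro imageI) auto
    then show ?thesis using b by (force simp: max_def)
  qed (simp add: assms(2))
  then show ?thesis using that[of "max b 1"] by auto
qed

lemma integrable_compact_support:
  fixes u :: "real \<Rightarrow> real"
  assumes [measurable]: "u \<in> borel_measurable borel" and "\<And>z. \<bar>u z\<bar> \<le> B" "\<And>z. \<bar>z\<bar> > a \<Longrightarrow> u z = 0"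
  shows "integrable lborel u"
proof (rule Bochner_Integration.integrable_bound)
  show "integrable lborel (\<lambda>z. B * indicator {-a..a} z :: real)"
    by (intro integrable_mult_right integrable_real_indicator) (auto simp: emeasure_lborel_Icc_eq)
  have "norm (u z) \<le> norm (B * indicator {-a..a} z :: real)" for z
    using assms(2,3)[of z] by (cases "\<bar>z\<bar> > a") (auto simp: indicator_def)
  then show "AE z in lborel. norm (u z) \<le> norm (B * indicator {-a..a} z :: real)" by simp
qed simp

lemma
  assumes u: "kernel_base l u"
  shows continuous_kernel_l: "continuous_on UNIV (kernel_l u l)"
    and kernel_l_support: "\<bar>z\<bar> > 1 / 2 \<Longrightarrow> kernel_l u l z = 0"
proof -
  show "continuous_on UNIV (kernel_l u l)"
  proof -
    have "continuous_on UNIV (\<lambda>z. u (z / real i))" for i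
    proof (rule continuous_on_compose2[of UNIV u UNIV "\<lambda>z. z / real i"])
      show "continuous_on UNIV (\<lambda>z. z / real i)"
        unfolding divide_inverse by (intro continuous_on_mult_right continuous_on_id)
    qed (use u in \<open>simp_all add: kernel_base_def\<close>)
    then show ?thesis unfolding kernel_l_def[abs_def] by (intro continuous_intros)
  qed
  assume z: "\<bar>z\<bar> > 1 / 2"
  have "u (z / real i) = 0" if "i \<in> {1..l}" for i
  proof -
    have "1 / (2 * real l) \<le> 1 / (2 * real i)" using that by (intro divide_left_mono) auto
    also have "1 / (2 * real i) < \<bar>z\<bar> / real i" using z that by (simp add: field_simps)
    finally show ?thesis using u by (simp add: kernel_base_def abs_divide)
  qed
  then show "kernel_l u l z = 0" by (simp add: kernel_l_def)
qed

text \<open>This identity explains the form of \<open>kernel_l\<close>. Substituting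
  \<open>z = j * z'\<close> turns the summand \<open>1/j * u (z / j)\<close> into \<open>u\<close>
  with \<open>a\<close> read at \<open>j * z'\<close>, so the distance of \<open>a 0\<close> from
  its kernel average is the \<open>u\<close>-average of the \<open>l\<close>-th order alternating
  sum of \<open>a\<close> along 0, z, ..., l z. The bound on \<open>a\<close> gives
  integrability.\<close>

lemma kernel_l_identity:
  fixes a :: "real \<Rightarrow> real"
  assumes u: "kernel_base l u" and [measurable]: "a \<in> borel_measurable borel" and ab: "\<And>z. \<bar>a z\<bar> \<le> M"
  shows "a 0 - (\<integral>z. kernel_l u l z * a z \<partial>lborel)
    = (\<integral>z. u z * (\<Sum>j\<le>l. (-1) ^ j * real (l choose j) * a (real j * z)) \<partial>lborel)"
proof -
  have um[measurable]: "u \<in> borel_measurable borel"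
    using u by (intro borel_measurable_continuous_onI) (simp add: kernel_base_def)
  obtain B where "\<And>z. \<bar>u z\<bar> \<le> B"
    using u bounded_compact_support[of u "1 / (2 * real l)"] unfolding kernel_base_def by metis
  then have ui: "integrable lborel u"
    using u by (intro integrable_compact_support[where a="1 / (2 * real l)"]) (auto simp: kernel_base_def)
  have int: "integrable lborel (\<lambda>z. u z * a (c * z))" for c
  proof (rule Bochner_Integration.integrable_bound)
    show "integrable lborel (\<lambda>z. M * \<bar>u z\<bar>)" using ui by auto
    have "norm (u z * a (c * z)) \<le> norm (M * \<bar>u z\<bar>)" for z
      using ab[of "c * z"] by (simp add: abs_mult mult.commute[of "\<bar>u z\<bar>"] mult_right_mono)
    then show "AE z in lborel. norm (u z * a (c * z)) \<le> norm (M * \<bar>u z\<bar>)" by simp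
  qed measurable
  have sub: "integrable lborel (\<lambda>z. (1 / real j) * u (z / real j) * a z)"
    "(\<integral>z. (1 / real j) * u (z / real j) * a z \<partial>lborel) = (\<integral>z. u z * a (real j * z) \<partial>lborel)" if "j \<ge> 1" for j
  proof -
    have j: "real j \<noteq> 0" using that by simp
    have "integrable lborel (\<lambda>z. (\<lambda>z. (1 / real j) * u (z / real j) * a z) (0 + real j * z))"
      using int[of "real j"] j by simp
    then show "integrable lborel (\<lambda>z. (1 / real j) * u (z / real j) * a z)"
      using lborel_integrable_real_affine_iff[OF j, of "\<lambda>z. (1 / real j) * u (z / real j) * a z" 0] by blast
    show "(\<integral>z. (1 / real j) * u (z / real j) * a z \<partial>lborel) = (\<integral>z. u z * a (real j * z) \<partial>lborel)"
      using j by (subst lborel_integral_real_affine[OF j, where t=0]) simp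
  qed
  have "(\<integral>z. kernel_l u l z * a z \<partial>lborel)
     = (\<integral>z. (\<Sum>i=1..l. (real (l choose i) * (-1) ^ (i + 1)) * ((1 / real i) * u (z / real i) * a z)) \<partial>lborel)"
    by (intro Bochner_Integration.integral_cong) (auto simp: kernel_l_def sum_distrib_right intro!: sum.cong)
  also have "\<dots> = (\<Sum>i=1..l. (real (l choose i) * (-1) ^ (i + 1)) * (\<integral>z. (1 / real i) * u (z / real i) * a z \<partial>lborel))"
  proof (subst Bochner_Integration.integral_sum)
    fix i assume "i \<in> {1..l}"
    then show "integrable lborel (\<lambda>z. (real (l choose i) * (-1) ^ (i + 1)) * ((1 / real i) * u (z / real i) * a z))"
      by (intro integrable_mult_right sub(1)) auto
  qed (simp only: integral_mult_right_zero)
  also have "\<dots> = (\<Sum>i=1..l. (real (l choose i) * (-1) ^ (i + 1)) * (\<integral>z. u z * a (real i * z) \<partial>lborel))"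
    using sub(2) by (intro sum.cong) auto
  finally have 1: "(\<integral>z. kernel_l u l z * a z \<partial>lborel)
    = (\<Sum>i=1..l. (real (l choose i) * (-1) ^ (i + 1)) * (\<integral>z. u z * a (real i * z) \<partial>lborel))" .
  have "(\<integral>z. u z * (\<Sum>j\<le>l. (-1) ^ j * real (l choose j) * a (real j * z)) \<partial>lborel)
    = (\<integral>z. (\<Sum>j\<le>l. ((-1) ^ j * real (l choose j)) * (u z * a (real j * z))) \<partial>lborel)"
    by (intro Bochner_Integration.integral_cong) (auto simp: sum_distrib_left mult_ac)
  also have "\<dots> = (\<Sum>j\<le>l. ((-1) ^ j * real (l choose j)) * (\<integral>z. u z * a (real j * z) \<partial>lborel))"
    using int by (subst Bochner_Integration.integral_sum) auto
  \<comment> \<open>The term \<open>j = 0\<close> is constant in \<open>z\<close> apart from the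
    factor \<open>u\<close>, whose integral is 1. The other terms are those of the kernel average
    with opposite sign.\<close>
  also have "\<dots> = a 0 + (\<Sum>j=1..l. ((-1) ^ j * real (l choose j)) * (\<integral>z. u z * a (real j * z) \<partial>lborel))"
    using u unfolding atMost_atLeast0 by (subst sum.atLeast_Suc_atMost) (auto simp: kernel_base_def)
  also have "\<dots> = a 0 - (\<integral>z. kernel_l u l z * a z \<partial>lborel)"
    unfolding 1 by (simp add: sum_negf[symmetric] mult_ac)
  finally show ?thesis ..
qed

text \<open>The identity for the constant function 1: the alternating sum of the binomial
  coefficients vanishes for \<open>l \<ge> 1\<close>.\<close>

lemma integral_kernel_l:
  assumes u: "kernel_base l u" shows "(\<integral>z. kernel_l u l z \<partial>lborel) = 1"
proof -
  have "(\<Sum>j\<le>l. (-1) ^ j * real (l choose j)) = 0"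
    using u choose_alternating_sum[of l, where ?'a=real] by (simp add: kernel_base_def)
  then show ?thesis using kernel_l_identity[OF u, of "\<lambda>_. 1" 1] by simp
qed

section \<open>Product kernels as test functions\<close>

definition prod_kernel :: "(real \<Rightarrow> real) \<Rightarrow> (nat \<Rightarrow> real) \<Rightarrow> nat set \<Rightarrow> point \<Rightarrow> point \<Rightarrow> real" where
  "prod_kernel K h I x y = (\<Prod>i\<in>I. 1 / h i * K ((y i - x i) / h i))"

text \<open>This makes differences of a smoothed function in its argument into differences of the
  kernel.\<close>

lemma prod_kernel_translate:
  assumes "finite I" "i \<in> I"
  shows "prod_kernel K h I (x(i := x i + s)) = shift i (- s) (prod_kernel K h I x)"
  unfolding prod_kernel_def shift_def
  by (rule ext, rule prod.cong) (auto simp: algebra_simps)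

lemma measurable_prod_kernel_pair:
  assumes [measurable]: "K \<in> borel_measurable borel"
  shows "(\<lambda>(x, y). prod_kernel K h I x y) \<in> borel_measurable (Leb I \<Otimes>\<^sub>M Leb I)"
  unfolding prod_kernel_def by measurable

lemma measurable_prod_kernel:
  assumes [measurable]: "K \<in> borel_measurable borel"
  shows "prod_kernel K h I x \<in> borel_measurable (Leb I)"
  unfolding prod_kernel_def by measurable

text \<open>The kernel lives on the box centred at \<open>x\<close> with sides \<open>h i\<close>,
  because \<open>K\<close> lives on an interval of length 1; the volume of the box is
  \<open>prod h I\<close>.\<close>

lemma prod_kernel_test_fun:
  assumes fin: "finite I" and K[measurable]: "K \<in> borel_measurable borel" and B: "\<And>z. \<bar>K z\<bar> \<le> B"
    and supp: "\<And>z. \<bar>z\<bar> > 1 / 2 \<Longrightarrow> K z = 0" and h: "\<And>i. i \<in> I \<Longrightarrow> h i > 0"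
  shows "prod_kernel K h I x \<in> test_fun I (B ^ card I / prod h I) (prod h I)"
proof -
  have "\<bar>prod_kernel K h I x y\<bar> \<le> B ^ card I / prod h I" for y
  proof -
    have "\<bar>prod_kernel K h I x y\<bar> = (\<Prod>i\<in>I. \<bar>K ((y i - x i) / h i)\<bar> / h i)"
      using h by (auto simp: prod_kernel_def abs_prod abs_mult abs_of_pos intro!: prod.cong)
    also have "\<dots> \<le> (\<Prod>i\<in>I. B / h i)"
      using h B by (intro prod_mono) (auto intro!: divide_right_mono divide_nonneg_pos less_imp_le[OF h])
    also have "\<dots> = B ^ card I / prod h I" by (simp add: prod_dividef)
    finally show ?thesis .
  qed
  moreover have "emeasure (Leb I) {y \<in> space (Leb I). prod_kernel K h I x y \<noteq> 0} \<le> ennreal (prod h I)"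
  proof -
    have "{y \<in> space (Leb I). prod_kernel K h I x y \<noteq> 0} \<subseteq> PiE I (\<lambda>i. {x i - h i / 2..x i + h i / 2})"
    proof (intro subsetI)
      fix y assume y: "y \<in> {y \<in> space (Leb I). prod_kernel K h I x y \<noteq> 0}"
      have "y i \<in> {x i - h i / 2..x i + h i / 2}" if "i \<in> I" for i
      proof -
        have "K ((y i - x i) / h i) \<noteq> 0" using y that fin by (auto simp: prod_kernel_def)
        then have "\<bar>(y i - x i) / h i\<bar> \<le> 1 / 2" using supp by force
        then have "\<bar>y i - x i\<bar> \<le> h i / 2" using h[OF that] by (simp add: abs_divide field_simps)
        then show ?thesis by (simp add: abs_if split: if_splits)
      qed
      then show "y \<in> PiE I (\<lambda>i. {x i - h i / 2..x i + h i / 2})"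
        using y by (auto simp: space_Leb PiE_def)
    qed
    then have "emeasure (Leb I) {y \<in> space (Leb I). prod_kernel K h I x y \<noteq> 0}
        \<le> emeasure (Leb I) (PiE I (\<lambda>i. {x i - h i / 2..x i + h i / 2}))"
      using fin by (intro emeasure_mono) (auto simp: Leb_def intro!: sets_PiM_I_finite)
    also have "\<dots> = (\<Prod>i\<in>I. emeasure lborel {x i - h i / 2..x i + h i / 2})"
      unfolding Leb_def using fin by (intro lborel_product.emeasure_PiM) auto
    also have "\<dots> = (\<Prod>i\<in>I. ennreal (h i))"
      using h by (intro prod.cong) (auto simp: emeasure_lborel_Icc_eq ennreal_neg dest: h)
    also have "\<dots> = ennreal (prod h I)"
      using h by (intro prod_ennreal) (auto intro: less_imp_le)
    finally show ?thesis .
  qed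
  ultimately show ?thesis
    using measurable_prod_kernel[OF K] by (simp add: test_fun_def)
qed

lemma integral_scaled_kernel:
  fixes \<phi> :: "real \<Rightarrow> real"
  assumes "h > 0"
  shows "(\<integral>w. 1 / h * K ((w - a) / h) * \<phi> w \<partial>lborel) = (\<integral>z. K z * \<phi> (a + h * z) \<partial>lborel)"
  using assms by (subst lborel_integral_real_affine[where c=h and t=a]) auto

lemma integrable_scaled_kernel:
  fixes K :: "real \<Rightarrow> real"
  assumes "h > 0" "integrable lborel K"
  shows "integrable lborel (\<lambda>w. 1 / h * K ((w - a) / h))"
proof -
  have "integrable lborel (\<lambda>z. (\<lambda>w. K ((w - a) / h)) (a + h * z))" using assms by simp
  then have "integrable lborel (\<lambda>w. K ((w - a) / h))"
    using lborel_integrable_real_affine_iff[of h "\<lambda>w. K ((w - a) / h)" a] assms by auto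
  then show ?thesis by (rule integrable_mult_right)
qed

lemma integrable_prod_kernel:
  assumes "finite I" "integrable lborel K" "\<And>i. i \<in> I \<Longrightarrow> h i > 0"
  shows "integrable (Leb I) (prod_kernel K h I x)"
  unfolding Leb_def prod_kernel_def[abs_def] using assms
  by (intro lborel_product.product_integrable_prod integrable_scaled_kernel) auto

lemma integral_prod_kernel:
  assumes "finite I" "integrable lborel K" "\<And>i. i \<in> I \<Longrightarrow> h i > 0"
  shows "(\<integral>y. prod_kernel K h I x y \<partial>Leb I) = (\<integral>z. K z \<partial>lborel) ^ card I"
proof -
  have "(\<integral>y. prod_kernel K h I x y \<partial>Leb I) = (\<Prod>i\<in>I. \<integral>w. 1 / h i * K ((w - x i) / h i) \<partial>lborel)"
    unfolding Leb_def prod_kernel_def[abs_def] using assms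
    by (intro lborel_product.product_integral_prod integrable_scaled_kernel) auto
  also have "\<dots> = (\<Prod>i\<in>I. \<integral>z. K z \<partial>lborel)"
    using assms integral_scaled_kernel[where \<phi>="\<lambda>_. 1"] by (intro prod.cong) auto
  finally show ?thesis by simp
qed

lemma abs_prod_kernel:
  assumes "\<And>i. i \<in> I \<Longrightarrow> h i > 0"
  shows "\<bar>prod_kernel K h I x y\<bar> = prod_kernel (\<lambda>z. \<bar>K z\<bar>) h I x y"
  using assms by (auto simp: prod_kernel_def abs_prod abs_mult abs_of_pos intro!: prod.cong)

subsection \<open>Kernel smoothing\<close>

definition smooth :: "(real \<Rightarrow> real) \<Rightarrow> (nat \<Rightarrow> real) \<Rightarrow> nat set \<Rightarrow> (point \<Rightarrow> real) \<Rightarrow> point \<Rightarrow> real" where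
  "smooth K h I g x = (\<integral>y. prod_kernel K h I x y * g y \<partial>Leb I)"

lemma measurable_smooth:
  assumes fin: "finite I" and [measurable]: "K \<in> borel_measurable borel" "g \<in> borel_measurable (Leb I)"
  shows "smooth K h I g \<in> borel_measurable (Leb I)"
proof -
  interpret sigma_finite_measure "Leb I" by (rule sigma_finite_Leb[OF fin])
  have [measurable]: "(\<lambda>(x, y). prod_kernel K h I x y) \<in> borel_measurable (Leb I \<Otimes>\<^sub>M Leb I)"
    by (rule measurable_prod_kernel_pair) measurable
  show ?thesis unfolding smooth_def[abs_def] by measurable
qed

lemma measurable_override_on_Leb:
  assumes "J \<subseteq> I" "x \<in> space (Leb I)"
  shows "(\<lambda>w. override_on x w J) \<in> measurable (Leb J) (Leb I)"
proof -
  have "(\<lambda>w. override_on x w J) \<in> measurable (Leb J) (PiM I (\<lambda>_. lborel))"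
  proof (rule measurable_PiM_single')
    show "(\<lambda>w. override_on x w J i) \<in> measurable (Leb J) lborel" if "i \<in> I" for i
      by (cases "i \<in> J") (simp_all add: override_on_def)
    show "(\<lambda>w. override_on x w J) \<in> space (Leb J) \<rightarrow> (\<Pi>\<^sub>E i\<in>I. space lborel)"
      using assms by (auto simp: space_Leb override_on_def extensional_def)
  qed
  then show ?thesis by (simp add: Leb_def)
qed

text \<open>The coordinates are treated one after the other; those outside \<open>J\<close> are frozen at \<open>x\<close>.\<close>

lemma prod_kernel_average_error:
  assumes fin: "finite J" "J \<subseteq> I" and K[measurable]: "K \<in> borel_measurable borel" "integrable lborel K"
    and h: "\<And>i. i \<in> I \<Longrightarrow> h i > 0"
    and A: "(\<integral>z. \<bar>K z\<bar> \<partial>lborel) \<le> A" "A \<ge> 1"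
    and G[measurable]: "G \<in> borel_measurable (Leb I)" and GM: "\<And>y. y \<in> space (Leb I) \<Longrightarrow> \<bar>G y\<bar> \<le> M"
    and \<epsilon>: "\<And>i y. i \<in> I \<Longrightarrow> y \<in> space (Leb I) \<Longrightarrow> \<bar>G y - (\<integral>z. K z * G (y(i := y i + h i * z)) \<partial>lborel)\<bar> \<le> \<epsilon> i"
    and x: "x \<in> space (Leb I)"
  shows "\<bar>G x - (\<integral>w. prod_kernel K h J x w * G (override_on x w J) \<partial>Leb J)\<bar> \<le> A ^ card J * sum \<epsilon> J"
  using fin
proof (induction J)
  case empty
  have "(\<integral>w. prod_kernel K h {} x w * G (override_on x w {}) \<partial>Leb {}) = G x"
    by (simp add: prod_kernel_def Leb_def PiM_empty lebesgue_integral_count_space_finite)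
  then show ?case by simp
next
  case (insert j J)
  have J: "finite J" "J \<subseteq> I" "j \<in> I" "j \<notin> J" and hJ: "\<And>i. i \<in> J \<Longrightarrow> h i > 0" and hj: "h j > 0"
    using insert h by auto
  have Mn: "M \<ge> 0" using GM[OF x] by linarith
  have ov: "override_on x w J' \<in> space (Leb I)" if "J' \<subseteq> I" "w \<in> space (Leb J')" for w J'
    using measurable_space[OF measurable_override_on_Leb[OF that(1) x] that(2)] .
  have int: "integrable (Leb J') (\<lambda>w. prod_kernel K h J' x w * G (override_on x w J'))" if "finite J'" "J' \<subseteq> I" for J'
  proof (rule Bochner_Integration.integrable_bound)
    show "integrable (Leb J') (\<lambda>w. M * prod_kernel K h J' x w)"
      using that h K by (intro integrable_mult_right integrable_prod_kernel) auto
    have [measurable]: "(\<lambda>w. override_on x w J') \<in> measurable (Leb J') (Leb I)" "prod_kernel K h J' x \<in> borel_measurable (Leb J')"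
      using that x K by (auto intro: measurable_override_on_Leb measurable_prod_kernel)
    show "(\<lambda>w. prod_kernel K h J' x w * G (override_on x w J')) \<in> borel_measurable (Leb J')" by measurable
    show "AE w in Leb J'. norm (prod_kernel K h J' x w * G (override_on x w J')) \<le> norm (M * prod_kernel K h J' x w)"
    proof (rule AE_I2)
      fix w assume "w \<in> space (Leb J')"
      then have "\<bar>G (override_on x w J')\<bar> \<le> M" by (intro GM ov that)
      then show "norm (prod_kernel K h J' x w * G (override_on x w J')) \<le> norm (M * prod_kernel K h J' x w)"
        using Mn by (simp add: abs_mult mult.commute[of "\<bar>prod_kernel K h J' x w\<bar>"] mult_right_mono)
    qed
  qed
  \<comment> \<open>\<open>T w\<close> averages in the new coordinate \<open>j\<close> only. As
    \<open>j\<close> is not in \<open>J\<close>, the product kernel factors, and Fubini reduces the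
    integral over \<open>insert j J\<close> to that of \<open>T\<close> over \<open>J\<close>.
    Replacing \<open>G\<close> by \<open>T\<close> costs \<open>\<epsilon> j\<close> times the L^1
    norm of the remaining kernel.\<close>
  define T where "T w = (\<integral>z. K z * G ((override_on x w J)(j := x j + h j * z)) \<partial>lborel)" for w
  have inner: "(\<integral>y. prod_kernel K h (insert j J) x (w(j := y)) * G (override_on x (w(j := y)) (insert j J)) \<partial>lborel)
      = prod_kernel K h J x w * T w" for w
  proof -
    have 1: "prod_kernel K h (insert j J) x (w(j := y)) = 1 / h j * K ((y - x j) / h j) * prod_kernel K h J x w" for y
    proof -
      have "(\<Prod>i\<in>J. 1 / h i * K (((w(j := y)) i - x i) / h i)) = (\<Prod>i\<in>J. 1 / h i * K ((w i - x i) / h i))"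
        using J by (intro prod.cong) auto
      then show ?thesis unfolding prod_kernel_def using J by simp
    qed
    have 2: "override_on x (w(j := y)) (insert j J) = (override_on x w J)(j := y)" for y
      using J by (auto simp: override_on_def)
    have "(\<integral>y. prod_kernel K h (insert j J) x (w(j := y)) * G (override_on x (w(j := y)) (insert j J)) \<partial>lborel)
       = (\<integral>y. prod_kernel K h J x w * (1 / h j * K ((y - x j) / h j) * G ((override_on x w J)(j := y))) \<partial>lborel)"
      unfolding 1 2 by (simp add: mult_ac)
    also have "\<dots> = prod_kernel K h J x w * (\<integral>y. 1 / h j * K ((y - x j) / h j) * G ((override_on x w J)(j := y)) \<partial>lborel)"
      by (rule integral_mult_right_zero)
    also have "(\<integral>y. 1 / h j * K ((y - x j) / h j) * G ((override_on x w J)(j := y)) \<partial>lborel) = T w"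
      unfolding T_def by (rule integral_scaled_kernel[OF hj])
    finally show ?thesis .
  qed
  have fub: "(\<integral>w. prod_kernel K h (insert j J) x w * G (override_on x w (insert j J)) \<partial>Leb (insert j J))
      = (\<integral>w. prod_kernel K h J x w * T w \<partial>Leb J)"
    using int[of "insert j J"] J unfolding inner[symmetric] Leb_def
    by (intro lborel_product.product_integral_insert) auto
  have T: "\<bar>G (override_on x w J) - T w\<bar> \<le> \<epsilon> j" if "w \<in> space (Leb J)" for w
  proof -
    have "override_on x w J j = x j" using J by (simp add: override_on_def)
    then show ?thesis using \<epsilon>[OF J(3) ov[OF J(2) that]] by (simp add: T_def)
  qed
  have \<epsilon>j: "\<epsilon> j \<ge> 0" using \<epsilon>[OF J(3) x] by linarith
  have \<epsilon>0: "sum \<epsilon> J \<ge> 0"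
  proof (rule sum_nonneg)
    fix i assume "i \<in> J"
    then show "\<epsilon> i \<ge> 0" using \<epsilon>[OF _ x, of i] J by fastforce
  qed
  have iJ: "integrable (Leb J) (\<lambda>w. prod_kernel K h J x w * G (override_on x w J))"
    using int[of J] J by simp
  have iPK: "integrable (Leb J) (prod_kernel K h J x)"
    using J hJ K by (intro integrable_prod_kernel) auto
  have Tm: "(\<lambda>w. prod_kernel K h J x w * T w) \<in> borel_measurable (Leb J)"
  proof -
    have [measurable]: "(\<lambda>w. override_on x w J) \<in> measurable (Leb J) (Leb I)" "prod_kernel K h J x \<in> borel_measurable (Leb J)"
      using J x K by (auto intro: measurable_override_on_Leb measurable_prod_kernel)
    have [measurable]: "j \<in> I" by fact
    show ?thesis unfolding T_def by measurable
  qed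
  have iT: "integrable (Leb J) (\<lambda>w. prod_kernel K h J x w * T w)"
  proof (rule Bochner_Integration.integrable_bound[OF _ Tm])
    show "integrable (Leb J) (\<lambda>w. (M + \<epsilon> j) * prod_kernel K h J x w)" using iPK by simp
    show "AE w in Leb J. norm (prod_kernel K h J x w * T w) \<le> norm ((M + \<epsilon> j) * prod_kernel K h J x w)"
    proof (rule AE_I2)
      fix w assume "w \<in> space (Leb J)"
      then have "\<bar>T w\<bar> \<le> M + \<epsilon> j" using T[of w] GM[OF ov[OF J(2), of w]] by linarith
      then show "norm (prod_kernel K h J x w * T w) \<le> norm ((M + \<epsilon> j) * prod_kernel K h J x w)"
        using Mn \<epsilon>j by (simp add: abs_mult mult.commute[of "\<bar>prod_kernel K h J x w\<bar>"] mult_right_mono)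
    qed
  qed
  have "\<bar>(\<integral>w. prod_kernel K h J x w * G (override_on x w J) \<partial>Leb J) - (\<integral>w. prod_kernel K h J x w * T w \<partial>Leb J)\<bar>
      = \<bar>\<integral>w. prod_kernel K h J x w * (G (override_on x w J) - T w) \<partial>Leb J\<bar>"
    using iJ iT by (simp add: right_diff_distrib)
  also have "\<dots> \<le> (\<integral>w. \<bar>prod_kernel K h J x w * (G (override_on x w J) - T w)\<bar> \<partial>Leb J)"
    by (rule integral_abs_bound)
  also have "\<dots> \<le> (\<integral>w. \<bar>prod_kernel K h J x w\<bar> * \<epsilon> j \<partial>Leb J)"
  proof (rule integral_mono)
    show "integrable (Leb J) (\<lambda>w. \<bar>prod_kernel K h J x w * (G (override_on x w J) - T w)\<bar>)"
      using iJ iT by (simp add: right_diff_distrib)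
  qed (use iPK T in \<open>auto simp: abs_mult intro!: mult_left_mono\<close>)
  also have "\<dots> = (\<integral>z. \<bar>K z\<bar> \<partial>lborel) ^ card J * \<epsilon> j"
    using integral_prod_kernel[of J "\<lambda>z. \<bar>K z\<bar>" h x] J hJ K by (simp add: abs_prod_kernel)
  also have "\<dots> \<le> A ^ card J * \<epsilon> j"
    using A \<epsilon>j by (intro mult_right_mono power_mono) auto
  finally have "\<bar>G x - (\<integral>w. prod_kernel K h J x w * T w \<partial>Leb J)\<bar> \<le> A ^ card J * (\<epsilon> j + sum \<epsilon> J)"
    using insert.IH[OF J(2)] unfolding distrib_left by linarith
  also have "\<dots> \<le> A ^ card (insert j J) * (\<epsilon> j + sum \<epsilon> J)"
    using A \<epsilon>j \<epsilon>0 J by (intro mult_right_mono power_increasing) auto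
  finally show ?case unfolding fub using J by simp
qed

text \<open>Either order is integration of \<open>f\<close> against a composed kernel
  \<open>conv\<close>. The composed kernel is a product of one-dimensional convolutions, and these
  are symmetric in the two bandwidths.\<close>

lemma smooth_commute:
  assumes fin: "finite I" and K[measurable]: "K \<in> borel_measurable borel" "integrable lborel K"
    and B: "\<And>z. \<bar>K z\<bar> \<le> B"
    and h: "\<And>i. i \<in> I \<Longrightarrow> h i > 0" "\<And>i. i \<in> I \<Longrightarrow> h' i > 0"
    and f: "integrable (Leb I) f"
  shows "smooth K h' I (smooth K h I f) x = smooth K h I (smooth K h' I f) x"
proof -
  interpret pair_sigma_finite "Leb I" "Leb I" by (rule pair_sigma_finite_Leb[OF fin fin])
  have [measurable]: "f \<in> borel_measurable (Leb I)" using f by auto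
  define conv where "conv h h' w = (\<integral>y. prod_kernel K h' I x y * prod_kernel K h I y w \<partial>Leb I)" for h h' w
  have *: "smooth K h' I (smooth K h I f) x = (\<integral>w. conv h h' w * f w \<partial>Leb I)"
    if h: "\<And>i. i \<in> I \<Longrightarrow> h i > 0" "\<And>i. i \<in> I \<Longrightarrow> h' i > 0" for h h'
  proof -
    define N where "N = (\<Prod>i\<in>I. B / h i)"
    have N: "\<bar>prod_kernel K h I y w\<bar> \<le> N" for y w
      unfolding prod_kernel_def abs_prod N_def using h B
      by (intro prod_mono) (auto simp: abs_mult abs_of_pos intro!: divide_right_mono divide_nonneg_pos less_imp_le[OF h(1)] h(1))
    then have Nn: "N \<ge> 0" using order_trans[OF abs_ge_zero] by blast
    have PKi: "integrable (Leb I) (prod_kernel K h' I x)"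
      using fin h K by (intro integrable_prod_kernel) auto
    have [measurable]: "(\<lambda>(x, y). prod_kernel K h I x y) \<in> borel_measurable (Leb I \<Otimes>\<^sub>M Leb I)"
       "prod_kernel K h' I x \<in> borel_measurable (Leb I)"
      using measurable_prod_kernel_pair[OF K(1)] measurable_prod_kernel[OF K(1)] by auto
    \<comment> \<open>The inner kernel is bounded by \<open>N\<close>, so a product of two
      integrable functions of separate variables dominates the integrand.\<close>
    have dom: "integrable (Leb I \<Otimes>\<^sub>M Leb I) (\<lambda>(y, w). prod_kernel K h' I x y * f w)"
    proof (rule Fubini_integrable)
      show "integrable (Leb I) (\<lambda>y. \<integral>w. norm (case (y, w) of (y, w) \<Rightarrow> prod_kernel K h' I x y * f w) \<partial>Leb I)"
        using PKi by (simp add: abs_mult)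
      show "AE y in Leb I. integrable (Leb I) (\<lambda>w. case (y, w) of (y, w) \<Rightarrow> prod_kernel K h' I x y * f w)"
        using f by simp
    qed measurable
    have int: "integrable (Leb I \<Otimes>\<^sub>M Leb I) (\<lambda>(y, w). prod_kernel K h' I x y * prod_kernel K h I y w * f w)"
    proof (rule Bochner_Integration.integrable_bound)
      show "integrable (Leb I \<Otimes>\<^sub>M Leb I) (\<lambda>z. N * (case z of (y, w) \<Rightarrow> prod_kernel K h' I x y * f w))"
        using dom by (rule integrable_mult_right)
      show "AE z in Leb I \<Otimes>\<^sub>M Leb I. norm (case z of (y, w) \<Rightarrow> prod_kernel K h' I x y * prod_kernel K h I y w * f w)
         \<le> norm (N * (case z of (y, w) \<Rightarrow> prod_kernel K h' I x y * f w))"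
      proof (rule AE_I2, clarsimp simp: abs_mult)
        fix y w
        have "\<bar>prod_kernel K h I y w\<bar> * (\<bar>prod_kernel K h' I x y\<bar> * \<bar>f w\<bar>) \<le> N * (\<bar>prod_kernel K h' I x y\<bar> * \<bar>f w\<bar>)"
          using N by (intro mult_right_mono) auto
        then show "\<bar>prod_kernel K h' I x y\<bar> * \<bar>prod_kernel K h I y w\<bar> * \<bar>f w\<bar> \<le> \<bar>N\<bar> * (\<bar>prod_kernel K h' I x y\<bar> * \<bar>f w\<bar>)"
          using Nn by (simp add: mult_ac)
      qed
    qed measurable
    have "smooth K h' I (smooth K h I f) x
       = (\<integral>y. \<integral>w. prod_kernel K h' I x y * prod_kernel K h I y w * f w \<partial>Leb I \<partial>Leb I)"
      by (simp add: smooth_def mult.assoc)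
    also have "\<dots> = (\<integral>w. \<integral>y. prod_kernel K h' I x y * prod_kernel K h I y w * f w \<partial>Leb I \<partial>Leb I)"
      by (rule Fubini_integral[OF int, symmetric])
    finally show ?thesis by (simp add: conv_def)
  qed
  have "conv h h' w = conv h' h w" for w
  proof -
    \<comment> \<open>The reflection \<open>y \<mapsto> a + v - y\<close> interchanges the two
      arguments \<open>y - a\<close> and \<open>v - y\<close>.\<close>
    have one: "(\<integral>y. 1 / b * K ((y - a) / b) * (1 / c * K ((v - y) / c)) \<partial>lborel)
      = (\<integral>y. 1 / c * K ((y - a) / c) * (1 / b * K ((v - y) / b)) \<partial>lborel)" for a v b c :: real
      by (subst lborel_integral_real_affine[where c="-1" and t="a + v"]) (simp_all add: mult_ac)
    have int1: "integrable lborel (\<lambda>y. 1 / b * K ((y - a) / b) * (1 / c * K ((v - y) / c)))" if "b > 0" for a v b c :: real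
    proof (rule Bochner_Integration.integrable_bound)
      show "integrable lborel (\<lambda>y. (\<bar>1 / c\<bar> * B) * (1 / b * K ((y - a) / b)))"
        by (intro integrable_mult_right integrable_scaled_kernel that K)
      have "norm (1 / b * K ((y - a) / b) * (1 / c * K ((v - y) / c))) \<le> norm ((\<bar>1 / c\<bar> * B) * (1 / b * K ((y - a) / b)))" for y
      proof -
        have "\<bar>1 / c * K ((v - y) / c)\<bar> \<le> \<bar>1 / c\<bar> * B" unfolding abs_mult by (intro mult_left_mono B) auto
        then have "\<bar>1 / c * K ((v - y) / c)\<bar> \<le> \<bar>\<bar>1 / c\<bar> * B\<bar>" by linarith
        then have "\<bar>1 / c * K ((v - y) / c)\<bar> * \<bar>1 / b * K ((y - a) / b)\<bar> \<le> \<bar>\<bar>1 / c\<bar> * B\<bar> * \<bar>1 / b * K ((y - a) / b)\<bar>"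
          by (intro mult_right_mono) auto
        then show ?thesis
          unfolding real_norm_def abs_mult[of "1 / b * K ((y - a) / b)"] abs_mult[of "\<bar>1 / c\<bar> * B"]
          by (simp only: mult.commute)
      qed
      then show "AE y in lborel. norm (1 / b * K ((y - a) / b) * (1 / c * K ((v - y) / c)))
           \<le> norm ((\<bar>1 / c\<bar> * B) * (1 / b * K ((y - a) / b)))" by simp
    qed measurable
    have c: "conv h h' w = (\<Prod>i\<in>I. \<integral>y. 1 / h' i * K ((y - x i) / h' i) * (1 / h i * K ((w i - y) / h i)) \<partial>lborel)"
      if "\<And>i. i \<in> I \<Longrightarrow> h' i > 0" for h h' :: "nat \<Rightarrow> real"
    proof -
      have "conv h h' w = (\<integral>y. (\<Prod>i\<in>I. 1 / h' i * K ((y i - x i) / h' i) * (1 / h i * K ((w i - y i) / h i))) \<partial>Leb I)"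
        by (simp only: conv_def prod_kernel_def prod.distrib)
      also have "\<dots> = (\<Prod>i\<in>I. \<integral>y. 1 / h' i * K ((y - x i) / h' i) * (1 / h i * K ((w i - y) / h i)) \<partial>lborel)"
        unfolding Leb_def using fin that by (intro lborel_product.product_integral_prod int1) auto
      finally show ?thesis .
    qed
    have "conv h h' w = (\<Prod>i\<in>I. \<integral>y. 1 / h' i * K ((y - x i) / h' i) * (1 / h i * K ((w i - y) / h i)) \<partial>lborel)"
      by (rule c) (rule h)
    also have "\<dots> = (\<Prod>i\<in>I. \<integral>y. 1 / h i * K ((y - x i) / h i) * (1 / h' i * K ((w i - y) / h' i)) \<partial>lborel)"
      by (intro prod.cong refl one)
    also have "\<dots> = conv h' h w"
      by (rule c[symmetric]) (rule h)
    finally show ?thesis .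
  qed
  then show ?thesis using *[of h h'] *[of h' h] h by simp
qed

text \<open>An approximate identity at a point of continuity. A neighbourhood in the product
  topology contains a box, which contains the support of the kernel once all bandwidths are small.
  Since \<open>K\<close> may change sign, the oscillation of \<open>f\<close> is weighted by the L^1
  norm \<open>A ^ card I\<close> of the kernel instead of 1.\<close>

lemma smooth_tendsto:
  assumes fin: "finite I" and K[measurable]: "K \<in> borel_measurable borel" and B: "\<And>z. \<bar>K z\<bar> \<le> B"
    and supp: "\<And>z. \<bar>z\<bar> > 1 / 2 \<Longrightarrow> K z = 0" and K1: "(\<integral>z. K z \<partial>lborel) = 1"
    and h: "\<And>n i. i \<in> I \<Longrightarrow> h n i > 0" "\<And>i. i \<in> I \<Longrightarrow> (\<lambda>n. h n i) \<longlonglongrightarrow> 0"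
    and f: "integrable (Leb I) f" and cont: "continuous_map (product_topology (\<lambda>_. euclideanreal) I) euclideanreal f"
    and x: "x \<in> space (Leb I)"
  shows "(\<lambda>n. smooth K (h n) I f x) \<longlonglongrightarrow> f x"
proof (rule tendstoI)
  fix e :: real assume e: "e > 0"
  have Ki: "integrable lborel K" by (rule integrable_compact_support[OF K B supp])
  define A where "A = (\<integral>z. \<bar>K z\<bar> \<partial>lborel)"
  have A0: "A \<ge> 0" by (simp add: A_def)
  define \<epsilon> where "\<epsilon> = e / (2 * (A ^ card I + 1))"
  have \<epsilon>: "\<epsilon> > 0" using e A0 by (simp add: \<epsilon>_def add_nonneg_pos)
  have Ae: "A ^ card I * \<epsilon> < e"
  proof -
    have "A ^ card I \<ge> 0" using A0 by simp
    then have "A ^ card I * e < e * (2 * (A ^ card I + 1))" using e by (simp add: algebra_simps add_strict_increasing)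
    then show ?thesis using \<open>A ^ card I \<ge> 0\<close> by (simp add: \<epsilon>_def field_simps add_nonneg_pos)
  qed
  define S where "S = {y \<in> topspace (product_topology (\<lambda>_. euclideanreal) I). f y \<in> ball (f x) \<epsilon>}"
  have "openin (product_topology (\<lambda>_. euclideanreal) I) S"
    unfolding S_def by (rule openin_continuous_map_preimage[OF cont]) simp
  moreover have "x \<in> S" using x \<epsilon> by (simp add: S_def space_Leb PiE_def)
  ultimately obtain U where "\<forall>i\<in>I. openin euclideanreal (U i)" and U: "x \<in> PiE I U" "PiE I U \<subseteq> S"
    unfolding openin_product_topology_alt by blast
  then have Uo: "open (U i)" if "i \<in> I" for i using that by simp
  have "\<exists>r>0. ball (x i) r \<subseteq> U i" if "i \<in> I" for i
    using Uo[OF that] PiE_mem[OF U(1) that] openE by blast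
  then obtain r where r: "\<And>i. i \<in> I \<Longrightarrow> r i > 0 \<and> ball (x i) (r i) \<subseteq> U i" by metis
  have "\<forall>\<^sub>F n in sequentially. \<forall>i\<in>I. h n i < r i"
  proof (intro eventually_ball_finite fin ballI)
    fix i assume "i \<in> I"
    then show "\<forall>\<^sub>F n in sequentially. h n i < r i"
      using order_tendstoD(2)[OF h(2), of i "r i"] r by blast
  qed
  then show "\<forall>\<^sub>F n in sequentially. dist (smooth K (h n) I f x) (f x) < e"
  proof eventually_elim
    case (elim n)
    have [measurable]: "f \<in> borel_measurable (Leb I)" "prod_kernel K (h n) I x \<in> borel_measurable (Leb I)"
      using f measurable_prod_kernel[OF K] by auto
    have iPK: "integrable (Leb I) (prod_kernel K (h n) I x)"
      using fin h(1) Ki by (intro integrable_prod_kernel) auto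
    have near: "\<bar>prod_kernel K (h n) I x y * (f y - f x)\<bar> \<le> \<bar>prod_kernel K (h n) I x y\<bar> * \<epsilon>"
      if y: "y \<in> space (Leb I)" for y
    proof (cases "prod_kernel K (h n) I x y = 0")
      case False
      have "y i \<in> U i" if "i \<in> I" for i
      proof -
        have "K ((y i - x i) / h n i) \<noteq> 0" using False that fin by (auto simp: prod_kernel_def)
        then have "\<bar>(y i - x i) / h n i\<bar> \<le> 1 / 2" using supp by force
        then have "\<bar>y i - x i\<bar> \<le> h n i / 2" using h(1)[OF that, of n] by (simp add: field_simps)
        also have "\<dots> < r i" using elim that h(1)[OF that, of n] by force
        finally have "y i \<in> ball (x i) (r i)" by (simp add: dist_real_def abs_minus_commute)
        then show ?thesis using r[OF that] by blast
      qed
      then have "y \<in> S" using U(2) y by (auto simp: space_Leb PiE_def)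
      then have "\<bar>f y - f x\<bar> \<le> \<epsilon>" by (auto simp: S_def dist_real_def)
      then show ?thesis by (simp add: abs_mult mult_left_mono)
    qed simp
    have iPf: "integrable (Leb I) (\<lambda>y. prod_kernel K (h n) I x y * f y)"
    proof (rule Bochner_Integration.integrable_bound)
      show "integrable (Leb I) (\<lambda>y. (B ^ card I / prod (h n) I) * f y)" using f by (rule integrable_mult_right)
      have T: "prod_kernel K (h n) I x \<in> test_fun I (B ^ card I / prod (h n) I) (prod (h n) I)"
        using fin K B supp h(1) by (intro prod_kernel_test_fun) auto
      have "\<bar>prod_kernel K (h n) I x y\<bar> \<le> \<bar>B ^ card I / prod (h n) I\<bar>" for y
      proof -
        have "\<bar>prod_kernel K (h n) I x y\<bar> \<le> B ^ card I / prod (h n) I" using T by (simp add: test_fun_def)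
        then show ?thesis by linarith
      qed
      then show "AE y in Leb I. norm (prod_kernel K (h n) I x y * f y) \<le> norm (B ^ card I / prod (h n) I * f y)"
        unfolding real_norm_def abs_mult by (intro AE_I2 mult_right_mono) auto
    qed measurable
    have "smooth K (h n) I f x - f x = smooth K (h n) I f x - (\<integral>y. prod_kernel K (h n) I x y \<partial>Leb I) * f x"
      using integral_prod_kernel[of I K "h n" x] fin h(1) Ki K1 by simp
    also have "\<dots> = (\<integral>y. prod_kernel K (h n) I x y * (f y - f x) \<partial>Leb I)"
      using iPK iPf by (simp add: smooth_def right_diff_distrib)
    finally have "\<bar>smooth K (h n) I f x - f x\<bar> \<le> (\<integral>y. \<bar>prod_kernel K (h n) I x y * (f y - f x)\<bar> \<partial>Leb I)"
      using integral_abs_bound[of "Leb I"] by simp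
    also have "\<dots> \<le> (\<integral>y. \<bar>prod_kernel K (h n) I x y\<bar> * \<epsilon> \<partial>Leb I)"
      using iPK iPf near by (intro integral_mono) (auto simp: right_diff_distrib)
    also have "\<dots> = A ^ card I * \<epsilon>"
      using integral_prod_kernel[of I "\<lambda>z. \<bar>K z\<bar>" "h n" x] fin h(1) Ki by (simp add: abs_prod_kernel A_def)
    finally show ?case using Ae by (simp add: dist_real_def)
  qed
qed

section \<open>The bias in one block\<close>

locale nikolskii_kernel =
  fixes I :: "nat set" and u :: "real \<Rightarrow> real" and l :: nat
    and \<beta> L :: "nat \<Rightarrow> real" and p :: "nat \<Rightarrow> ennreal" and B :: real
  assumes fin: "finite I" and u: "kernel_base l u"
    and \<beta>: "\<And>i. i \<in> I \<Longrightarrow> 0 < \<beta> i" "\<And>i. i \<in> I \<Longrightarrow> \<beta> i \<le> real l"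
    and p: "\<And>i. i \<in> I \<Longrightarrow> 1 \<le> p i" and L: "\<And>i. i \<in> I \<Longrightarrow> 0 < L i"
    and B: "\<And>z. \<bar>kernel_l u l z\<bar> \<le> B"
begin

abbreviation "K \<equiv> kernel_l u l"

lemma K_measurable [measurable]: "K \<in> borel_measurable borel"
  by (rule borel_measurable_continuous_onI[OF continuous_kernel_l[OF u]])

lemma K_integrable: "integrable lborel K"
  by (rule integrable_compact_support[OF K_measurable B kernel_l_support[OF u]])

lemma B_nonneg: "B \<ge> 0"
  using order_trans[OF abs_ge_zero B] .

lemma u_measurable [measurable]: "u \<in> borel_measurable borel"
  using u by (intro borel_measurable_continuous_onI) (simp add: kernel_base_def)

lemma u_integrable: "integrable lborel u"
proof -
  obtain b where "\<And>z. \<bar>u z\<bar> \<le> b"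
    using u bounded_compact_support[of u "1 / (2 * real l)"] unfolding kernel_base_def by metis
  then show ?thesis
    using u by (intro integrable_compact_support[where a="1 / (2 * real l)"]) (auto simp: kernel_base_def)
qed

lemma prod_kernel_test:
  "(\<And>i. i \<in> I \<Longrightarrow> h i > 0) \<Longrightarrow> prod_kernel K h I x \<in> test_fun I (B ^ card I / prod h I) (prod h I)"
  by (rule prod_kernel_test_fun[OF fin K_measurable B kernel_l_support[OF u]])

lemma Nikolskii_D:
  assumes "f \<in> Nikolskii I p \<beta> L" "i \<in> I"
  shows "f \<in> borel_measurable (Leb I)" "Lp_norm (Leb I) (p i) f \<le> ennreal (L i)"
  using assms unfolding Nikolskii_def by auto

text \<open>The bound of \<open>pairing_iterated_difference_le\<close> for the product kernel with
  bandwidth \<open>h\<close> as test function and step size at most \<eta>, integrated against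
  |u|.\<close>

definition coord_err :: "(nat \<Rightarrow> real) \<Rightarrow> real \<Rightarrow> nat \<Rightarrow> real" where
  "coord_err h \<eta> i = (\<integral>z. \<bar>u z\<bar> \<partial>lborel) *
     (2 ^ l * (2 * (B ^ card I / prod h I) * L i * \<eta> powr \<beta> i * prod h I powr (1 - rec (p i))))"

text \<open>\<open>kernel_l_identity\<close> is applied to the smoothed function along the
  \<open>i\<close>-th axis, read at distance \<open>\<eta> * z\<close> from \<open>x\<close>. Moving
  the centre translates the kernel, so the alternating sum is, up to sign, the pairing of
  \<open>f\<close> with \<open>(dif i (\<eta> * z) ^^ l) W\<close>, which is already
  estimated.\<close>

lemma smooth_coordinate_error:
  assumes f: "f \<in> Nikolskii I p \<beta> L" and i: "i \<in> I" and h: "\<And>i. i \<in> I \<Longrightarrow> h i > 0" and \<eta>: "\<eta> > 0"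
    and x: "x \<in> space (Leb I)"
    and M: "\<And>y. \<bar>smooth K h I f y\<bar> \<le> M"
  shows "\<bar>smooth K h I f x - (\<integral>z. K z * smooth K h I f (x(i := x i + \<eta> * z)) \<partial>lborel)\<bar> \<le> coord_err h \<eta> i"
proof -
  define W where "W = prod_kernel K h I x"
  define V where "V = prod h I"
  have V: "V > 0" unfolding V_def by (intro prod_pos h)
  have W: "W \<in> test_fun I (B ^ card I / V) V" unfolding W_def V_def by (rule prod_kernel_test[OF h])
  have fm[measurable]: "f \<in> borel_measurable (Leb I)" and fL: "Lp_norm (Leb I) (p i) f \<le> ennreal (L i)"
    using Nikolskii_D[OF f i] .
  define a where "a z = smooth K h I f (x(i := x i + \<eta> * z))" for z
  have [measurable]: "smooth K h I f \<in> borel_measurable (Leb I)"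
    by (rule measurable_smooth[OF fin K_measurable fm])
  have am: "a \<in> borel_measurable borel"
  proof -
    have "(\<lambda>z. x(i := x i + \<eta> * z)) \<in> measurable borel (Leb I)"
      using i x by measurable
    then show ?thesis unfolding a_def[abs_def] by measurable
  qed
  define C where "C = 2 ^ l * (2 * (B ^ card I / V) * L i * \<eta> powr \<beta> i * V powr (1 - rec (p i)))"
  have C0: "C \<ge> 0" unfolding C_def using B_nonneg V L[OF i] by simp
  have bound: "\<bar>u z * (\<Sum>j\<le>l. (-1) ^ j * real (l choose j) * a (real j * z))\<bar> \<le> \<bar>u z\<bar> * C" for z
  proof (cases "u z = 0")
    case False
    have l1: "l \<ge> 1" using u by (simp add: kernel_base_def)
    have "\<bar>z\<bar> \<le> 1 / (2 * real l)" using False u by (force simp: kernel_base_def)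
    also have "\<dots> \<le> 1" using l1 by simp
    \<comment> \<open>On the support of \<open>u\<close> the step \<open>\<eta> * z\<close> is thus
      at most \<eta> in absolute value, which gives a bound uniform in \<open>z\<close>.\<close>
    finally have z1: "\<bar>z\<bar> \<le> 1" .
    have int: "integrable (Leb I) (\<lambda>y. shift i s W y * f y)" for s
      using fm fL L[OF i] p[OF i] V W fin i
      by (intro integrable_test_fun[where p="p i" and A="L i" and V=V] shift_test_fun) auto
    have "(\<Sum>j\<le>l. (-1) ^ j * real (l choose j) * a (real j * z))
       = (\<Sum>j\<le>l. (-1) ^ j * real (l choose j) * (\<integral>y. shift i (- (real j * (\<eta> * z))) W y * f y \<partial>Leb I))"
      unfolding a_def smooth_def prod_kernel_translate[OF fin i] W_def
      by (intro sum.cong refl) (simp add: mult_ac)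
    also have "\<dots> = (\<integral>y. (\<Sum>j\<le>l. (-1) ^ j * real (l choose j) * (shift i (- (real j * (\<eta> * z))) W y * f y)) \<partial>Leb I)"
      using int by (subst Bochner_Integration.integral_sum) auto
    also have "\<dots> = (\<integral>y. (-1) ^ l * ((dif i (\<eta> * z) ^^ l) W y * f y) \<partial>Leb I)"
    proof (intro Bochner_Integration.integral_cong refl)
      fix y
      have sq: "(-1) ^ l * ((-1) ^ l * c) = c" for c :: real
        by (simp flip: mult.assoc power_mult_distrib)
      have "(-1) ^ l * ((dif i (\<eta> * z) ^^ l) W y * f y)
        = (\<Sum>j\<le>l. (-1) ^ j * real (l choose j) * shift i (- (real j * (\<eta> * z))) W y) * f y"
        unfolding dif_iter_eq mult.assoc[of "(-1) ^ l"] sq ..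
      then show "(\<Sum>j\<le>l. (-1) ^ j * real (l choose j) * (shift i (- (real j * (\<eta> * z))) W y * f y))
        = (-1) ^ l * ((dif i (\<eta> * z) ^^ l) W y * f y)"
        by (simp only: sum_distrib_right mult.assoc)
    qed
    also have "\<dots> = (-1) ^ l * (\<integral>y. (dif i (\<eta> * z) ^^ l) W y * f y \<partial>Leb I)"
      by (rule integral_mult_right_zero)
    finally have "\<bar>\<Sum>j\<le>l. (-1) ^ j * real (l choose j) * a (real j * z)\<bar> = \<bar>\<integral>y. (dif i (\<eta> * z) ^^ l) W y * f y \<partial>Leb I\<bar>"
      by (simp add: abs_mult)
    also have "\<dots> \<le> C"
    proof (cases "z = 0")
      case True
      obtain l' where "l = Suc l'" using l1 by (cases l) auto
      then show ?thesis using C0 True by (simp add: dif_def shift_0)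
    next
      case False
      then have "\<bar>\<integral>y. (dif i (\<eta> * z) ^^ l) W y * f y \<partial>Leb I\<bar>
        \<le> 2 ^ l * (2 * (B ^ card I / V) * L i * \<bar>\<eta> * z\<bar> powr \<beta> i * V powr (1 - rec (p i)))"
        using \<eta> by (intro pairing_iterated_difference_le[OF fin i f \<beta>(1)[OF i] \<beta>(2)[OF i] L[OF i] p[OF i] V W]) auto
      also have "\<dots> \<le> C"
      proof -
        have "\<bar>\<eta> * z\<bar> powr \<beta> i \<le> \<eta> powr \<beta> i"
          using z1 \<eta> \<beta>(1)[OF i] by (intro powr_mono2) (auto simp: abs_mult mult_left_le)
        then show ?thesis unfolding C_def
          using B_nonneg V L[OF i] by (intro mult_left_mono mult_right_mono) auto
      qed
      finally show ?thesis .
    qed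
    finally show ?thesis by (simp add: abs_mult mult_left_mono)
  qed simp
  have "smooth K h I f x - (\<integral>z. K z * smooth K h I f (x(i := x i + \<eta> * z)) \<partial>lborel) = a 0 - (\<integral>z. K z * a z \<partial>lborel)"
    by (simp add: a_def)
  also have "\<dots> = (\<integral>z. u z * (\<Sum>j\<le>l. (-1) ^ j * real (l choose j) * a (real j * z)) \<partial>lborel)"
    using M by (intro kernel_l_identity[OF u am]) (simp add: a_def)
  finally have "\<bar>smooth K h I f x - (\<integral>z. K z * smooth K h I f (x(i := x i + \<eta> * z)) \<partial>lborel)\<bar>
     \<le> (\<integral>z. \<bar>u z * (\<Sum>j\<le>l. (-1) ^ j * real (l choose j) * a (real j * z))\<bar> \<partial>lborel)"
    using integral_abs_bound by simp
  also have "\<dots> \<le> (\<integral>z. \<bar>u z\<bar> * C \<partial>lborel)"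
  proof (rule integral_mono)
    note am[measurable]
    show "integrable lborel (\<lambda>z. \<bar>u z * (\<Sum>j\<le>l. (-1) ^ j * real (l choose j) * a (real j * z))\<bar>)"
    proof (rule Bochner_Integration.integrable_bound)
      show "integrable lborel (\<lambda>z. \<bar>u z\<bar> * C)" using u_integrable by auto
      show "AE z in lborel. norm \<bar>u z * (\<Sum>j\<le>l. (-1) ^ j * real (l choose j) * a (real j * z))\<bar> \<le> norm (\<bar>u z\<bar> * C)"
        using bound C0 by (intro AE_I2) (simp only: real_norm_def abs_abs abs_mult abs_of_nonneg)
    qed measurable
  qed (use bound u_integrable in auto)
  also have "\<dots> = coord_err h \<eta> i" by (simp add: coord_err_def C_def V_def)
  finally show ?thesis .
qed

text \<open>The bound depends on \<open>h\<close>; it is used only qualitatively, for integrability,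
  and enters no later constant.\<close>

lemma smooth_bounded:
  assumes f: "f \<in> Nikolskii I p \<beta> L" and h: "\<And>i. i \<in> I \<Longrightarrow> h i > 0" and I: "I \<noteq> {}"
  obtains M where "\<And>y. \<bar>smooth K h I f y\<bar> \<le> M"
proof -
  obtain i where i: "i \<in> I" using I by auto
  define V where "V = prod h I"
  have V: "V > 0" unfolding V_def by (intro prod_pos h)
  define M where "M = 2 * (B ^ card I / V) * L i * V powr (1 - rec (p i))"
  have M0: "M \<ge> 0" unfolding M_def using B_nonneg V L[OF i] by simp
  have "\<bar>smooth K h I f y\<bar> \<le> M" for y
  proof -
    have W: "prod_kernel K h I y \<in> test_fun I (B ^ card I / V) V" unfolding V_def by (rule prod_kernel_test[OF h])
    have "integrable (Leb I) (\<lambda>z. prod_kernel K h I y z * f z)"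
      by (rule integrable_test_fun[OF Nikolskii_D[OF f i] L[OF i] p[OF i] W V])
    then have "ennreal (norm (smooth K h I f y)) \<le> (\<integral>\<^sup>+z. norm (prod_kernel K h I y z * f z) \<partial>Leb I)"
      unfolding smooth_def by (rule integral_norm_bound_ennreal)
    also have "\<dots> \<le> ennreal M"
      unfolding M_def real_norm_def
      by (rule nn_integral_test_fun_le[OF Nikolskii_D[OF f i] L[OF i] p[OF i] W V])
    finally show ?thesis using M0 by simp
  qed
  then show ?thesis using that by blast
qed

abbreviation "A \<equiv> (\<integral>z. \<bar>K z\<bar> \<partial>lborel)"

lemma A_ge_1: "A \<ge> 1"
proof -
  have "1 = \<bar>\<integral>z. K z \<partial>lborel\<bar>" by (simp add: integral_kernel_l[OF u])
  also have "\<dots> \<le> A" by (rule integral_abs_bound)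
  finally show ?thesis .
qed

text \<open>\<open>prod_kernel_average_error\<close> with the smoothed function in place of
  \<open>G\<close>: smoothing with \<open>h\<close> supplies the pointwise control that
  \<open>f\<close> alone lacks, and the error is measured at the scale \<open>h'\<close>.\<close>

lemma smooth_smooth_error:
  assumes f: "f \<in> Nikolskii I p \<beta> L" and I: "I \<noteq> {}"
    and h: "\<And>i. i \<in> I \<Longrightarrow> h i > 0" and h': "\<And>i. i \<in> I \<Longrightarrow> h' i > 0" and x: "x \<in> space (Leb I)"
  shows "\<bar>smooth K h I f x - smooth K h' I (smooth K h I f) x\<bar> \<le> A ^ card I * (\<Sum>i\<in>I. coord_err h (h' i) i)"
proof -
  obtain i where i: "i \<in> I" using I by auto
  obtain M where M: "\<And>y. \<bar>smooth K h I f y\<bar> \<le> M" by (rule smooth_bounded[of f h]) (use f h I in auto)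
  have err: "\<bar>smooth K h I f y - (\<integral>z. K z * smooth K h I f (y(i := y i + h' i * z)) \<partial>lborel)\<bar> \<le> coord_err h (h' i) i"
    if "i \<in> I" "y \<in> space (Leb I)" for i y
    using that h h' M by (intro smooth_coordinate_error[OF f]) auto
  have "\<bar>smooth K h I f x - (\<integral>w. prod_kernel K h' I x w * smooth K h I f (override_on x w I) \<partial>Leb I)\<bar>
     \<le> A ^ card I * (\<Sum>i\<in>I. coord_err h (h' i) i)"
    using fin K_measurable K_integrable h' A_ge_1 M x
      measurable_smooth[OF fin K_measurable Nikolskii_D(1)[OF f i]]
    by (intro prod_kernel_average_error[where M=M and I=I and K=K])
       (use err in \<open>auto simp del: fun_upd_apply\<close>)
  also have "(\<integral>w. prod_kernel K h' I x w * smooth K h I f (override_on x w I) \<partial>Leb I) = smooth K h' I (smooth K h I f) x"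
    unfolding smooth_def[of K h' I "smooth K h I f"]
  proof (rule Bochner_Integration.integral_cong[OF refl])
    fix w assume "w \<in> space (Leb I)"
    then have "override_on x w I = w" using x by (auto simp: space_Leb override_on_def extensional_def fun_eq_iff)
    then show "prod_kernel K h' I x w * smooth K h I f (override_on x w I) = prod_kernel K h' I x w * smooth K h I f w" by simp
  qed
  finally show ?thesis .
qed

lemma smooth_diff_error:
  assumes f: "f \<in> Nikolskii I p \<beta> L" "integrable (Leb I) f" and I: "I \<noteq> {}"
    and h: "\<And>i. i \<in> I \<Longrightarrow> h i > 0" and h': "\<And>i. i \<in> I \<Longrightarrow> h' i > 0" and x: "x \<in> space (Leb I)"
  shows "\<bar>smooth K h I f x - smooth K h' I f x\<bar>
     \<le> A ^ card I * (\<Sum>i\<in>I. coord_err h (h' i) i) + A ^ card I * (\<Sum>i\<in>I. coord_err h' (h i) i)"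
proof -
  have "smooth K h' I (smooth K h I f) x = smooth K h I (smooth K h' I f) x"
    by (rule smooth_commute[OF fin K_measurable K_integrable B _ _ f(2)]) (use h h' in auto)
  moreover have "\<bar>smooth K h I f x - smooth K h' I (smooth K h I f) x\<bar> \<le> A ^ card I * (\<Sum>i\<in>I. coord_err h (h' i) i)"
    by (rule smooth_smooth_error[OF f(1) I _ _ x]) (use h h' in auto)
  moreover have "\<bar>smooth K h' I f x - smooth K h I (smooth K h' I f) x\<bar> \<le> A ^ card I * (\<Sum>i\<in>I. coord_err h' (h i) i)"
    by (rule smooth_smooth_error[OF f(1) I _ _ x]) (use h h' in auto)
  ultimately show ?thesis by linarith
qed

text \<open>The outer factor 2 counts the two sums of \<open>smooth_diff_error\<close>; the powers
  of 2 inside come from comparing bandwidths whose parameters differ by a factor at most 2.\<close>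

definition bias_const :: "(nat \<Rightarrow> real) \<Rightarrow> real" where
  "bias_const e = 2 * A ^ card I * (\<Sum>i\<in>I. (\<integral>z. \<bar>u z\<bar> \<partial>lborel) * (2 ^ l * (2 * B ^ card I * L i * 2 powr (\<beta> i * e i))))"

text \<open>The step contributes \<open>\<delta>' powr (\<beta> i * e i)\<close>, the volume
  \<open>\<delta> powr (- rec (p i) * sum e I)\<close>, and the balance equation makes the exponents
  add up to 1. Allowing \<open>\<delta>' \<le> 2 * \<delta>\<close> covers both orders in which a
  parameter and its half occur.\<close>

lemma coord_err_le:
  assumes \<delta>: "\<delta> > 0" "\<delta>' > 0" "\<delta>' \<le> 2 * \<delta>" and i: "i \<in> I" and e: "e i > 0"
    and bal: "\<beta> i * e i - rec (p i) * sum e I = 1"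
  shows "coord_err (\<lambda>i. \<delta> powr e i) (\<delta>' powr e i) i
    \<le> (\<integral>z. \<bar>u z\<bar> \<partial>lborel) * (2 ^ l * (2 * B ^ card I * L i * 2 powr (\<beta> i * e i))) * \<delta>"
proof -
  define V where "V = (\<Prod>i\<in>I. \<delta> powr e i)"
  have V: "V = \<delta> powr sum e I" unfolding V_def using \<delta> by (simp add: powr_sum)
  have V0: "V > 0" using \<delta> by (simp add: V)
  have "(\<delta>' powr e i) powr \<beta> i = \<delta>' powr (\<beta> i * e i)" by (simp add: powr_powr mult.commute)
  also have "\<dots> \<le> (2 * \<delta>) powr (\<beta> i * e i)" using \<delta> e \<beta>(1)[OF i] by (intro powr_mono2) auto
  also have "\<dots> = 2 powr (\<beta> i * e i) * \<delta> powr (\<beta> i * e i)" using \<delta> by (simp add: powr_mult)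
  finally have 1: "(\<delta>' powr e i) powr \<beta> i \<le> 2 powr (\<beta> i * e i) * \<delta> powr (\<beta> i * e i)" .
  have "V powr (1 - rec (p i)) / V = V powr (- rec (p i))"
    using V0 by (simp add: powr_diff powr_minus field_simps)
  also have "\<dots> = \<delta> powr (- rec (p i) * sum e I)" unfolding V powr_powr by (simp add: mult.commute)
  finally have 2: "V powr (1 - rec (p i)) / V = \<delta> powr (- rec (p i) * sum e I)" .
  have 3: "\<delta> powr (\<beta> i * e i) * \<delta> powr (- rec (p i) * sum e I) = \<delta>"
    using \<delta> bal by (simp flip: powr_add)
  have "coord_err (\<lambda>i. \<delta> powr e i) (\<delta>' powr e i) i
     = (\<integral>z. \<bar>u z\<bar> \<partial>lborel) * (2 ^ l * (2 * B ^ card I * L i * ((\<delta>' powr e i) powr \<beta> i * (V powr (1 - rec (p i)) / V))))"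
    unfolding coord_err_def V_def[symmetric] by simp
  also have "\<dots> \<le> (\<integral>z. \<bar>u z\<bar> \<partial>lborel) * (2 ^ l * (2 * B ^ card I * L i * ((2 powr (\<beta> i * e i) * \<delta> powr (\<beta> i * e i)) * (V powr (1 - rec (p i)) / V))))"
    using 1 B_nonneg L[OF i] V0 by (intro mult_left_mono mult_right_mono) auto
  also have "\<dots> = (\<integral>z. \<bar>u z\<bar> \<partial>lborel) * (2 ^ l * (2 * B ^ card I * L i * 2 powr (\<beta> i * e i))) * (\<delta> powr (\<beta> i * e i) * \<delta> powr (- rec (p i) * sum e I))"
    unfolding 2 by (simp add: mult_ac)
  finally show ?thesis unfolding 3 .
qed

lemma bias_const_nonneg: "bias_const e \<ge> 0"
  unfolding bias_const_def using B_nonneg L A_ge_1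
  by (intro mult_nonneg_nonneg sum_nonneg) (auto intro: less_imp_le)

lemma smooth_halving_error:
  assumes f: "f \<in> Nikolskii I p \<beta> L" "integrable (Leb I) f" and I: "I \<noteq> {}"
    and e: "\<And>i. i \<in> I \<Longrightarrow> e i > 0" "\<And>i. i \<in> I \<Longrightarrow> \<beta> i * e i - rec (p i) * sum e I = 1"
    and \<delta>: "\<delta> > 0" and x: "x \<in> space (Leb I)"
  shows "\<bar>smooth K (\<lambda>i. \<delta> powr e i) I f x - smooth K (\<lambda>i. (\<delta> / 2) powr e i) I f x\<bar> \<le> bias_const e * \<delta>"
proof -
  define c where "c i = (\<integral>z. \<bar>u z\<bar> \<partial>lborel) * (2 ^ l * (2 * B ^ card I * L i * 2 powr (\<beta> i * e i)))" for i
  have c0: "c i \<ge> 0" if "i \<in> I" for i unfolding c_def using B_nonneg L[OF that] by simp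
  have "(\<Sum>i\<in>I. coord_err (\<lambda>i. \<delta> powr e i) ((\<delta> / 2) powr e i) i) \<le> (\<Sum>i\<in>I. c i * \<delta>)"
    unfolding c_def using \<delta> e by (intro sum_mono coord_err_le) auto
  moreover have "(\<Sum>i\<in>I. coord_err (\<lambda>i. (\<delta> / 2) powr e i) (\<delta> powr e i) i) \<le> (\<Sum>i\<in>I. c i * (\<delta> / 2))"
    unfolding c_def using \<delta> e by (intro sum_mono coord_err_le) auto
  moreover have "(\<Sum>i\<in>I. c i * (\<delta> / 2)) \<le> (\<Sum>i\<in>I. c i * \<delta>)"
    using \<delta> c0 by (intro sum_mono mult_left_mono) auto
  ultimately have "A ^ card I * (\<Sum>i\<in>I. coord_err (\<lambda>i. \<delta> powr e i) ((\<delta> / 2) powr e i) i) \<le> A ^ card I * (\<Sum>i\<in>I. c i * \<delta>)"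
    "A ^ card I * (\<Sum>i\<in>I. coord_err (\<lambda>i. (\<delta> / 2) powr e i) (\<delta> powr e i) i) \<le> A ^ card I * (\<Sum>i\<in>I. c i * \<delta>)"
    using A_ge_1 by (auto intro!: mult_left_mono)
  moreover have "bias_const e * \<delta> = 2 * (A ^ card I * (\<Sum>i\<in>I. c i * \<delta>))"
    unfolding bias_const_def c_def[symmetric] by (simp add: sum_distrib_right[symmetric])
  ultimately show ?thesis
    using smooth_diff_error[OF f I _ _ x, of "\<lambda>i. \<delta> powr e i" "\<lambda>i. (\<delta> / 2) powr e i"] \<delta> by auto
qed

lemma smooth_bias:
  assumes f: "f \<in> Nikolskii I p \<beta> L" "integrable (Leb I) f" and I: "I \<noteq> {}"
    and cont: "continuous_map (product_topology (\<lambda>_. euclideanreal) I) euclideanreal f"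
    and e: "\<And>i. i \<in> I \<Longrightarrow> e i > 0" "\<And>i. i \<in> I \<Longrightarrow> \<beta> i * e i - rec (p i) * sum e I = 1"
    and \<delta>: "\<delta> > 0" and x: "x \<in> space (Leb I)"
  shows "\<bar>smooth K (\<lambda>i. \<delta> powr e i) I f x - f x\<bar> \<le> 2 * bias_const e * \<delta>"
proof -
  define T where "T n = smooth K (\<lambda>i. (\<delta> / 2 ^ n) powr e i) I f x" for n :: nat
  have step: "\<bar>T n - T (Suc n)\<bar> \<le> bias_const e * (\<delta> / 2 ^ n)" for n
    using smooth_halving_error[OF f I _ _ _ x, of e "\<delta> / 2 ^ n"] e \<delta> by (simp add: T_def mult.commute[of 2])
  \<comment> \<open>The factor \<open>1 - 1 / 2 ^ n\<close> is the exact partial sum of the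
    geometric series; without it the induction would not close.\<close>
  have tele: "\<bar>T 0 - T n\<bar> \<le> 2 * bias_const e * \<delta> * (1 - 1 / 2 ^ n)" for n
  proof (induction n)
    case (Suc n)
    have "2 * bias_const e * \<delta> * (1 - 1 / 2 ^ n) + bias_const e * (\<delta> / 2 ^ n) = 2 * bias_const e * \<delta> * (1 - 1 / 2 ^ Suc n)"
      by (simp add: field_simps)
    then show ?case using Suc step[of n] by linarith
  qed simp
  have bd: "\<bar>T 0 - T n\<bar> \<le> 2 * bias_const e * \<delta>" for n
  proof -
    have "2 * bias_const e * \<delta> * (1 - 1 / 2 ^ n) \<le> 2 * bias_const e * \<delta> * 1"
      using bias_const_nonneg[of e] \<delta> by (intro mult_left_mono) auto
    then show ?thesis using tele[of n] by simp
  qed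
  have "T \<longlonglongrightarrow> f x"
    unfolding T_def
  proof (rule smooth_tendsto[OF fin K_measurable B kernel_l_support[OF u] integral_kernel_l[OF u] _ _ f(2) cont x])
    show "(\<lambda>n. (\<delta> / 2 ^ n) powr e i) \<longlonglongrightarrow> 0" if "i \<in> I" for i
    proof (rule tendsto_zero_powrI)
      have "(\<lambda>n. \<delta> * (1 / 2) ^ n) \<longlonglongrightarrow> \<delta> * 0" by (intro tendsto_mult_left LIMSEQ_power_zero) simp
      then show "(\<lambda>n. \<delta> / 2 ^ n) \<longlonglongrightarrow> 0" by (simp add: power_one_over)
      show "(\<lambda>n. e i) \<longlonglongrightarrow> e i" by simp
    qed (use e that \<delta> in auto)
  qed (use \<delta> in auto)
  then have "(\<lambda>n. \<bar>T 0 - T n\<bar>) \<longlonglongrightarrow> \<bar>T 0 - f x\<bar>" by (intro tendsto_intros)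
  then have "\<bar>T 0 - f x\<bar> \<le> 2 * bias_const e * \<delta>"
    by (rule LIMSEQ_le_const2) (use bd in auto)
  then show ?thesis by (simp add: T_def)
qed

end

subsection \<open>Exponential moments of sample means\<close>

text \<open>For t = -s < 0 the claim amounts to \<open>1 \<le> (1 - s + s\<^sup>2) * exp s\<close>.
  Replacing \<open>exp s\<close> by its quadratic Taylor polynomial leaves 1 plus nonnegative
  terms.\<close>

lemma exp_le_quadratic:
  fixes t :: real
  assumes "\<bar>t\<bar> \<le> 1" shows "exp t \<le> 1 + t + t\<^sup>2"
proof (cases "t \<ge> 0")
  case True
  then show ?thesis using assms exp_bound[of t] by simp
next
  case False
  define s where "s = - t"
  have s: "0 \<le> s" "s \<le> 1" "t = - s" using False assms by (auto simp: s_def)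
  have "1 \<le> (1 - s + s\<^sup>2) * (1 + s + s\<^sup>2 / 2)"
  proof -
    have "(1 - s + s\<^sup>2) * (1 + s + s\<^sup>2 / 2) = 1 + s\<^sup>2 / 2 + s ^ 3 / 2 + s ^ 4 / 2"
      by (simp add: power2_eq_square power3_eq_cube power4_eq_xxxx field_simps)
    then show ?thesis using s by simp
  qed
  also have "\<dots> \<le> (1 - s + s\<^sup>2) * exp s"
    using s exp_lower_Taylor_quadratic[of s] by (intro mult_left_mono) auto
  finally have "exp t \<le> (1 - s + s\<^sup>2) * exp s * exp t" by simp
  also have "\<dots> = 1 + t + t\<^sup>2" by (simp add: s(3) mult.assoc flip: exp_add)
  finally show ?thesis .
qed

text \<open>A Bernstein-type bound. With \<open>s = \<theta> / n\<close> the moment factors over the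
  sample. The condition on \<theta> gives \<open>\<bar>s * (Y x - m)\<bar> \<le> 1\<close>, so the
  quadratic bound for exp applies; the linear term is centred, and each factor is at most
  \<open>exp (s\<^sup>2 * v)\<close>.\<close>

lemma exp_moment_sample_mean:
  assumes "prob_space N" and Y[measurable]: "Y \<in> borel_measurable N" and b: "\<And>x. \<bar>Y x\<bar> \<le> M"
    and v: "(\<integral>x. (Y x)\<^sup>2 \<partial>N) \<le> v" and n: "n \<ge> 1" and \<theta>: "\<bar>\<theta>\<bar> * (2 * M) \<le> real n"
  shows "(\<integral>\<^sup>+X. ennreal (exp (\<theta> * (1 / real n * (\<Sum>k=1..n. Y (X k)) - (\<integral>x. Y x \<partial>N)))) \<partial>PiM {1..n} (\<lambda>_. N))
    \<le> ennreal (exp (\<theta>\<^sup>2 * v / real n))"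
proof -
  interpret N: prob_space N by fact
  interpret product_sigma_finite "\<lambda>_::nat. N" by standard
  define s where "s = \<theta> / real n"
  define m where "m = (\<integral>x. Y x \<partial>N)"
  have Yi: "integrable N Y" by (rule N.integrable_const_bound[where B=M]) (use b in auto)
  have Y2i: "integrable N (\<lambda>x. (Y x)\<^sup>2)"
  proof (rule N.integrable_const_bound[where B="M\<^sup>2"])
    show "AE x in N. norm ((Y x)\<^sup>2) \<le> M\<^sup>2" using power_mono[OF b abs_ge_zero, of _ 2] by simp
  qed simp
  have mM: "\<bar>m\<bar> \<le> M"
  proof -
    have "\<bar>m\<bar> \<le> (\<integral>x. \<bar>Y x\<bar> \<partial>N)" unfolding m_def by (rule integral_abs_bound)
    also have "\<dots> \<le> (\<integral>x. M \<partial>N)" using Yi b by (intro integral_mono) auto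
    finally show ?thesis by (simp add: N.prob_space)
  qed
  have one: "(\<integral>\<^sup>+x. ennreal (exp (s * (Y x - m))) \<partial>N) \<le> ennreal (exp (s\<^sup>2 * v))"
  proof -
    have t: "\<bar>s * (Y x - m)\<bar> \<le> 1" for x
    proof -
      have "\<bar>Y x - m\<bar> \<le> 2 * M" using b[of x] mM by linarith
      then have "\<bar>\<theta>\<bar> * \<bar>Y x - m\<bar> \<le> \<bar>\<theta>\<bar> * (2 * M)" by (intro mult_left_mono) auto
      then have "\<bar>\<theta>\<bar> * \<bar>Y x - m\<bar> \<le> real n" using \<theta> by linarith
      then show ?thesis using n by (simp add: s_def abs_mult)
    qed
    have int: "integrable N (\<lambda>x. 1 + s * (Y x - m) + (s * (Y x - m))\<^sup>2)"
      using Yi Y2i by (simp add: power_mult_distrib power2_diff)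
    have "(\<integral>\<^sup>+x. ennreal (exp (s * (Y x - m))) \<partial>N) \<le> (\<integral>\<^sup>+x. ennreal (1 + s * (Y x - m) + (s * (Y x - m))\<^sup>2) \<partial>N)"
      using t by (intro nn_integral_mono ennreal_leI exp_le_quadratic)
    also have "\<dots> = ennreal (\<integral>x. 1 + s * (Y x - m) + (s * (Y x - m))\<^sup>2 \<partial>N)"
    proof (rule nn_integral_eq_integral[OF int], rule AE_I2)
      fix x
      have "0 \<le> exp (s * (Y x - m))" by simp
      also have "\<dots> \<le> 1 + s * (Y x - m) + (s * (Y x - m))\<^sup>2" by (rule exp_le_quadratic[OF t])
      finally show "0 \<le> 1 + s * (Y x - m) + (s * (Y x - m))\<^sup>2" .
    qed
    also have "(\<integral>x. 1 + s * (Y x - m) + (s * (Y x - m))\<^sup>2 \<partial>N) = 1 + s\<^sup>2 * ((\<integral>x. (Y x)\<^sup>2 \<partial>N) - m\<^sup>2)"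
      using Yi Y2i by (simp add: power_mult_distrib power2_diff N.prob_space m_def[symmetric] algebra_simps power2_eq_square)
    also have "\<dots> \<le> 1 + s\<^sup>2 * v"
    proof -
      have "(\<integral>x. (Y x)\<^sup>2 \<partial>N) - m\<^sup>2 \<le> v" using v zero_le_power2[of m] by linarith
      then show ?thesis by (simp add: mult_left_mono)
    qed
    also have "\<dots> \<le> exp (s\<^sup>2 * v)" by (rule exp_ge_add_one_self)
    finally show ?thesis by (simp add: ennreal_leI)
  qed
  have "(\<integral>\<^sup>+X. ennreal (exp (\<theta> * (1 / real n * (\<Sum>k=1..n. Y (X k)) - m))) \<partial>PiM {1..n} (\<lambda>_. N))
    = (\<integral>\<^sup>+X. (\<Prod>k\<in>{1..n}. ennreal (exp (s * (Y (X k) - m)))) \<partial>PiM {1..n} (\<lambda>_. N))"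
  proof (intro nn_integral_cong)
    fix X :: "nat \<Rightarrow> 'a"
    have "\<theta> * (1 / real n * (\<Sum>k=1..n. Y (X k)) - m) = (\<Sum>k=1..n. s * (Y (X k) - m))"
    proof -
      have "(\<Sum>k=1..n. s * (Y (X k) - m)) = s * (\<Sum>k=1..n. Y (X k) - m)"
        by (rule sum_distrib_left[symmetric])
      also have "\<dots> = s * ((\<Sum>k=1..n. Y (X k)) - real n * m)" by (simp add: sum_subtractf)
      also have "\<dots> = \<theta> * (1 / real n * (\<Sum>k=1..n. Y (X k)) - m)"
        using n by (simp add: s_def right_diff_distrib)
      finally show ?thesis ..
    qed
    then show "ennreal (exp (\<theta> * (1 / real n * (\<Sum>k=1..n. Y (X k)) - m))) = (\<Prod>k\<in>{1..n}. ennreal (exp (s * (Y (X k) - m))))"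
      by (simp add: exp_sum prod_ennreal)
  qed
  also have "\<dots> = (\<Prod>k\<in>{1..n}. \<integral>\<^sup>+x. ennreal (exp (s * (Y x - m))) \<partial>N)"
    by (rule product_nn_integral_prod) auto
  also have "\<dots> \<le> (\<Prod>k\<in>{1..n}. ennreal (exp (s\<^sup>2 * v)))"
    using one by (intro prod_mono_ennreal) auto
  also have "\<dots> = ennreal (exp (\<theta>\<^sup>2 * v / real n))"
    using n by (simp add: ennreal_power s_def flip: exp_of_nat_mult) (simp add: power2_eq_square)
  finally show ?thesis by (simp add: m_def)
qed

subsection \<open>Marginals\<close>

lemma merge_in_space_Leb:
  assumes "I \<subseteq> {1..d}" "y \<in> space (Leb I)"
  shows "merge I ({1..d} - I) (y, z) \<in> space (Leb {1..d})"
  using assms by (auto simp: space_Leb merge_def extensional_def)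

lemma marginal_nonneg:
  assumes "I \<subseteq> {1..d}" "\<And>x. x \<in> space (Leb {1..d}) \<Longrightarrow> 0 \<le> f x" "y \<in> space (Leb I)"
  shows "0 \<le> marginal d I f y"
  unfolding marginal_def by (rule integral_nonneg_AE) (use assms merge_in_space_Leb in auto)

lemma measurable_restrict_Leb: "I \<subseteq> J \<Longrightarrow> (\<lambda>x. restrict x I) \<in> measurable (Leb J) (Leb I)"
  unfolding Leb_def by (rule measurable_restrict_subset)

text \<open>\<open>marginal\<close> is a Bochner integral, hence 0 by convention where a section is
  not integrable. The nonnegative integral \<open>m\<close> of the sections has total mass 1, so
  this happens only on a null set; elsewhere both agree, and Tonelli identifies the law of the
  coordinates in \<open>I\<close>.\<close>

lemma distr_restrict_density:
  assumes I: "I \<subseteq> {1..d}" and f[measurable]: "f \<in> borel_measurable (Leb {1..d})"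
    and f0: "\<And>x. x \<in> space (Leb {1..d}) \<Longrightarrow> 0 \<le> f x"
    and f1: "(\<integral>\<^sup>+x. ennreal (f x) \<partial>Leb {1..d}) = 1"
    and mm[measurable]: "marginal d I f \<in> borel_measurable (Leb I)"
  shows "distr (density (Leb {1..d}) (\<lambda>x. ennreal (f x))) (Leb I) (\<lambda>x. restrict x I)
    = density (Leb I) (\<lambda>y. ennreal (marginal d I f y))"
proof -
  define J where "J = {1..d} - I"
  have IJ: "I \<inter> J = {}" "I \<union> J = {1..d}" "finite I" "finite J"
    using I finite_subset[OF I] by (auto simp: J_def)
  interpret J: sigma_finite_measure "Leb J" by (rule sigma_finite_Leb[OF IJ(4)])
  have fold: "(\<integral>\<^sup>+x. F x \<partial>Leb {1..d}) = (\<integral>\<^sup>+y. (\<integral>\<^sup>+z. F (merge I J (y, z)) \<partial>Leb J) \<partial>Leb I)"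
    if "F \<in> borel_measurable (Leb {1..d})" for F
    using lborel_product.product_nn_integral_fold[OF IJ(1,3,4), of F] that unfolding Leb_def IJ(2) by simp
  have mg: "(\<lambda>(y, z). merge I J (y, z)) \<in> measurable (Leb I \<Otimes>\<^sub>M Leb J) (Leb {1..d})"
    using measurable_merge[of I J "\<lambda>_. lborel"] unfolding Leb_def IJ(2) by (simp add: case_prod_eta)
  have fm[measurable]: "(\<lambda>(y, z). f (merge I J (y, z))) \<in> borel_measurable (Leb I \<Otimes>\<^sub>M Leb J)"
    using measurable_compose[OF mg f] by (simp add: case_prod_beta)
  define m where "m y = (\<integral>\<^sup>+z. ennreal (f (merge I J (y, z))) \<partial>Leb J)" for y
  have [measurable]: "m \<in> borel_measurable (Leb I)" unfolding m_def by measurable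
  have "(\<integral>\<^sup>+x. ennreal (f x) \<partial>Leb {1..d}) = (\<integral>\<^sup>+y. m y \<partial>Leb I)"
    unfolding m_def by (rule fold) measurable
  then have "(\<integral>\<^sup>+y. m y \<partial>Leb I) = 1" unfolding f1 ..
  then have "AE y in Leb I. m y \<noteq> \<infinity>" by (intro nn_integral_PInf_AE) auto
  then have AE: "AE y in Leb I. m y = ennreal (marginal d I f y)"
  proof (rule AE_mp, intro AE_I2 impI)
    fix y assume y: "y \<in> space (Leb I)" and fin: "m y \<noteq> \<infinity>"
    have [measurable]: "(\<lambda>z. f (merge I J (y, z))) \<in> borel_measurable (Leb J)"
      using measurable_Pair2[OF fm y] by simp
    have nn: "0 \<le> f (merge I J (y, z))" for z
      using f0 merge_in_space_Leb[OF I y] by (auto simp: J_def)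
    have "integrable (Leb J) (\<lambda>z. f (merge I J (y, z)))"
      using fin nn by (intro integrableI_nonneg) (auto simp: m_def less_top)
    then show "m y = ennreal (marginal d I f y)"
      unfolding m_def marginal_def J_def[symmetric] using nn by (intro nn_integral_eq_integral) auto
  qed
  have rm[measurable]: "(\<lambda>x. restrict x I) \<in> measurable (Leb {1..d}) (Leb I)"
    by (rule measurable_restrict_Leb[OF I])
  show ?thesis
  proof (rule measure_eqI)
    fix S assume "S \<in> sets (distr (density (Leb {1..d}) (\<lambda>x. ennreal (f x))) (Leb I) (\<lambda>x. restrict x I))"
    then have S[measurable]: "S \<in> sets (Leb I)" by simp
    have "emeasure (distr (density (Leb {1..d}) (\<lambda>x. ennreal (f x))) (Leb I) (\<lambda>x. restrict x I)) S
      = (\<integral>\<^sup>+x. ennreal (f x) * indicator S (restrict x I) \<partial>Leb {1..d})"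
    proof -
      have "(\<lambda>x. restrict x I) -` S \<inter> space (Leb {1..d}) \<in> sets (Leb {1..d})" by measurable
      then have v: "(\<lambda>x. restrict x I) -` S \<inter> space (Leb {1..d}) \<in> sets (Leb {1..d})" .
      have rm': "(\<lambda>x. restrict x I) \<in> measurable (density (Leb {1..d}) (\<lambda>x. ennreal (f x))) (Leb I)"
        by (simp only: measurable_density_eq1 rm)
      have "emeasure (distr (density (Leb {1..d}) (\<lambda>x. ennreal (f x))) (Leb I) (\<lambda>x. restrict x I)) S
        = emeasure (density (Leb {1..d}) (\<lambda>x. ennreal (f x))) ((\<lambda>x. restrict x I) -` S \<inter> space (Leb {1..d}))"
        using emeasure_distr[OF rm' S] by (simp only: space_density)
      also have "\<dots> = (\<integral>\<^sup>+x. ennreal (f x) * indicator ((\<lambda>x. restrict x I) -` S \<inter> space (Leb {1..d})) x \<partial>Leb {1..d})"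
        by (rule emeasure_density[OF _ v]) measurable
      also have "\<dots> = (\<integral>\<^sup>+x. ennreal (f x) * indicator S (restrict x I) \<partial>Leb {1..d})"
        by (intro nn_integral_cong) (auto simp del: restrict_apply split: split_indicator)
      finally show ?thesis .
    qed
    also have "\<dots> = (\<integral>\<^sup>+y. (\<integral>\<^sup>+z. ennreal (f (merge I J (y, z))) * indicator S (restrict (merge I J (y, z)) I) \<partial>Leb J) \<partial>Leb I)"
      by (rule fold) measurable
    also have "\<dots> = (\<integral>\<^sup>+y. m y * indicator S y \<partial>Leb I)"
    proof (intro nn_integral_cong)
      fix y assume y: "y \<in> space (Leb I)"
      have [measurable]: "(\<lambda>z. f (merge I J (y, z))) \<in> borel_measurable (Leb J)"
        using measurable_Pair2[OF fm y] by simp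
      have "restrict (merge I J (y, z)) I = y" for z
        using y by (auto simp: space_Leb merge_def restrict_def extensional_def fun_eq_iff)
      then show "(\<integral>\<^sup>+z. ennreal (f (merge I J (y, z))) * indicator S (restrict (merge I J (y, z)) I) \<partial>Leb J) = m y * indicator S y"
        by (simp add: m_def nn_integral_multc)
    qed
    also have "\<dots> = (\<integral>\<^sup>+y. ennreal (marginal d I f y) * indicator S y \<partial>Leb I)"
      using AE by (intro nn_integral_cong_AE) (auto elim!: eventually_mono)
    also have "\<dots> = emeasure (density (Leb I) (\<lambda>y. ennreal (marginal d I f y))) S"
      by (simp add: emeasure_density)
    finally show "emeasure (distr (density (Leb {1..d}) (\<lambda>x. ennreal (f x))) (Leb I) (\<lambda>x. restrict x I)) S
      = emeasure (density (Leb I) (\<lambda>y. ennreal (marginal d I f y))) S" .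
  qed simp
qed

lemma prob_space_density_Leb:
  assumes "f \<in> borel_measurable (Leb J)" "(\<integral>\<^sup>+x. ennreal (f x) \<partial>Leb J) = 1"
  shows "prob_space (density (Leb J) (\<lambda>x. ennreal (f x)))"
  by (rule prob_spaceI) (use assms in \<open>simp add: emeasure_density cong: nn_integral_cong\<close>)

lemma nn_integral_marginal:
  assumes I: "I \<subseteq> {1..d}" and f: "f \<in> borel_measurable (Leb {1..d})"
    and f0: "\<And>x. x \<in> space (Leb {1..d}) \<Longrightarrow> 0 \<le> f x"
    and f1: "(\<integral>\<^sup>+x. ennreal (f x) \<partial>Leb {1..d}) = 1"
    and mm: "marginal d I f \<in> borel_measurable (Leb I)"
  shows "(\<integral>\<^sup>+y. ennreal (marginal d I f y) \<partial>Leb I) = 1"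
proof -
  interpret N: prob_space "density (Leb {1..d}) (\<lambda>x. ennreal (f x))"
    by (rule prob_space_density_Leb[OF f f1])
  have "(\<lambda>x. restrict x I) \<in> measurable (density (Leb {1..d}) (\<lambda>x. ennreal (f x))) (Leb I)"
    by (simp only: measurable_density_eq1 measurable_restrict_Leb[OF I])
  then have "prob_space (distr (density (Leb {1..d}) (\<lambda>x. ennreal (f x))) (Leb I) (\<lambda>x. restrict x I))"
    by (rule N.prob_space_distr)
  then interpret G: prob_space "density (Leb I) (\<lambda>y. ennreal (marginal d I f y))"
    by (simp only: distr_restrict_density[OF I f f0 f1 mm])
  have "(\<integral>\<^sup>+y. ennreal (marginal d I f y) \<partial>Leb I)
      = emeasure (density (Leb I) (\<lambda>y. ennreal (marginal d I f y))) (space (Leb I))"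
    using mm by (simp add: emeasure_density cong: nn_integral_cong)
  also have "\<dots> = 1" using G.emeasure_space_1 by simp
  finally show ?thesis .
qed

lemma integral_restrict_density:
  fixes F :: "point \<Rightarrow> real"
  assumes I: "I \<subseteq> {1..d}" and f[measurable]: "f \<in> borel_measurable (Leb {1..d})"
    and f0: "\<And>x. x \<in> space (Leb {1..d}) \<Longrightarrow> 0 \<le> f x"
    and f1: "(\<integral>\<^sup>+x. ennreal (f x) \<partial>Leb {1..d}) = 1"
    and mm[measurable]: "marginal d I f \<in> borel_measurable (Leb I)"
    and F[measurable]: "F \<in> borel_measurable (Leb I)"
  shows "(\<integral>x. F (restrict x I) \<partial>density (Leb {1..d}) (\<lambda>x. ennreal (f x))) = (\<integral>y. F y * marginal d I f y \<partial>Leb I)"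
proof -
  have rm[measurable]: "(\<lambda>x. restrict x I) \<in> measurable (Leb {1..d}) (Leb I)"
    by (rule measurable_restrict_Leb[OF I])
  have "(\<integral>x. F (restrict x I) \<partial>density (Leb {1..d}) (\<lambda>x. ennreal (f x)))
     = (\<integral>y. F y \<partial>distr (density (Leb {1..d}) (\<lambda>x. ennreal (f x))) (Leb I) (\<lambda>x. restrict x I))"
    by (rule integral_distr[symmetric]) (use rm F in \<open>simp_all only: measurable_density_eq1\<close>)
  also have "\<dots> = (\<integral>y. F y \<partial>density (Leb I) (\<lambda>y. ennreal (marginal d I f y)))"
    by (simp only: distr_restrict_density[OF I f f0 f1 mm])
  also have "\<dots> = (\<integral>y. marginal d I f y *\<^sub>R F y \<partial>Leb I)"
    using marginal_nonneg[OF I f0] by (intro integral_density) auto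
  finally show ?thesis by (simp add: mult.commute)
qed

subsection \<open>The error in one block\<close>

context nikolskii_kernel
begin

text \<open>The first summand bounds the smoothing of a probability density with all bandwidths 1,
  the second its bias.\<close>

definition sup_const :: "(nat \<Rightarrow> real) \<Rightarrow> real" where
  "sup_const e = B ^ card I + 2 * bias_const e"

text \<open>The bias bound at \<delta> = 1, which is why the bandwidths appear as
  \<open>1 powr e i\<close>: the kernel is then at most \<open>B ^ card I\<close> and the density
  has integral 1. This takes the place of an embedding into L^\<infinity>.\<close>

lemma density_bounded:
  assumes f: "f \<in> Nikolskii I p \<beta> L" and I: "I \<noteq> {}"
    and f0: "\<And>y. y \<in> space (Leb I) \<Longrightarrow> 0 \<le> f y" and f1: "(\<integral>\<^sup>+y. ennreal (f y) \<partial>Leb I) = 1"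
    and cont: "continuous_map (product_topology (\<lambda>_. euclideanreal) I) euclideanreal f"
    and e: "\<And>i. i \<in> I \<Longrightarrow> e i > 0" "\<And>i. i \<in> I \<Longrightarrow> \<beta> i * e i - rec (p i) * sum e I = 1"
    and x: "x \<in> space (Leb I)"
  shows "f x \<le> sup_const e"
proof -
  have fm[measurable]: "f \<in> borel_measurable (Leb I)" using f by (simp add: Nikolskii_def)
  have fi: "integrable (Leb I) f" by (rule integrableI_nonneg) (use f0 f1 in auto)
  have "ennreal (\<integral>y. f y \<partial>Leb I) = 1" using nn_integral_eq_integral[OF fi] f0 f1 by simp
  then have int1: "(\<integral>y. f y \<partial>Leb I) = 1" by (simp add: ennreal_eq_1)
  have bias: "\<bar>smooth K (\<lambda>i. 1 powr e i) I f x - f x\<bar> \<le> 2 * bias_const e * 1"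
    by (rule smooth_bias[OF f fi I cont e _ x]) auto
  have T: "prod_kernel K (\<lambda>i. 1 powr e i) I x \<in> test_fun I (B ^ card I / (\<Prod>i\<in>I. 1 powr e i)) (\<Prod>i\<in>I. 1 powr e i)"
    by (rule prod_kernel_test) auto
  then have b: "\<bar>prod_kernel K (\<lambda>i. 1 powr e i) I x y\<bar> \<le> B ^ card I" for y by (simp add: test_fun_def)
  have [measurable]: "prod_kernel K (\<lambda>i. 1 powr e i) I x \<in> borel_measurable (Leb I)" using test_fun_measurable[OF T] .
  have bf: "\<bar>prod_kernel K (\<lambda>i. 1 powr e i) I x y * f y\<bar> \<le> B ^ card I * f y" if "y \<in> space (Leb I)" for y
    using b[of y] f0[OF that] by (simp add: abs_mult mult_right_mono)
  have "\<bar>smooth K (\<lambda>i. 1 powr e i) I f x\<bar> \<le> (\<integral>y. \<bar>prod_kernel K (\<lambda>i. 1 powr e i) I x y * f y\<bar> \<partial>Leb I)"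
    unfolding smooth_def by (rule integral_abs_bound)
  also have "\<dots> \<le> (\<integral>y. B ^ card I * f y \<partial>Leb I)"
  proof (rule integral_mono)
    show "integrable (Leb I) (\<lambda>y. \<bar>prod_kernel K (\<lambda>i. 1 powr e i) I x y * f y\<bar>)"
    proof (rule Bochner_Integration.integrable_bound)
      show "integrable (Leb I) (\<lambda>y. B ^ card I * f y)" using fi by (rule integrable_mult_right)
      show "AE y in Leb I. norm \<bar>prod_kernel K (\<lambda>i. 1 powr e i) I x y * f y\<bar> \<le> norm (B ^ card I * f y)"
        using bf by (intro AE_I2) (force intro: order_trans)
    qed measurable
  qed (use fi bf in auto)
  also have "\<dots> = B ^ card I" using int1 by simp
  finally show ?thesis using bias by (simp add: sup_const_def)
qed

text \<open>The first exponential pays for the bias in units of \<delta>, the factor 2 for replacing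
  \<open>exp \<bar>z\<bar>\<close> by \<open>exp z + exp (- z)\<close>, and the last exponential is
  the moment bound for the centred mean.\<close>

definition dev_const :: "(nat \<Rightarrow> real) \<Rightarrow> real" where
  "dev_const e = exp (2 * bias_const e) * (2 * exp (sup_const e * B ^ card I * A ^ card I))"

text \<open>Chosen so that \<open>\<theta> = dev_scale / \<delta>\<close> meets the size condition
  of \<open>exp_moment_sample_mean\<close>; the summand 1 keeps the value at most 1.\<close>

definition dev_scale :: real where
  "dev_scale = 1 / (2 * B ^ card I + 1)"

lemma dev_scale_bounds: "dev_scale > 0" "dev_scale \<le> 1" "dev_scale * (2 * B ^ card I) \<le> 1"
  using B_nonneg by (auto simp: dev_scale_def add_nonneg_pos divide_simps)

definition block_error :: "nat \<Rightarrow> (nat \<Rightarrow> real) \<Rightarrow> real \<Rightarrow> real \<Rightarrow> point \<Rightarrow> (nat \<Rightarrow> point) \<Rightarrow> real" where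
  "block_error n e \<delta> b x X = (1 / real n * (\<Sum>k=1..n. prod_kernel K (\<lambda>i. \<delta> powr e i) I x (X k)) - b)"

text \<open>The condition \<open>real n * \<delta> powr sum e I * \<delta>\<^sup>2 \<ge> 1\<close>
  serves twice, with \<theta> equal to plus or minus \<open>dev_scale / \<delta>\<close>: it bounds
  \<open>\<theta>\<^sup>2 * v / n\<close> by a constant and, because
  \<open>\<delta> \<le> 1\<close>, it yields the size condition on \<theta>. The bias is of order
  \<delta> and changes the moment by a constant factor only.\<close>

lemma block_error_moment:
  assumes Id: "I \<subseteq> {1..d}" "I \<noteq> {}" and f[measurable]: "f \<in> borel_measurable (Leb {1..d})"
    and f0: "\<And>x. x \<in> space (Leb {1..d}) \<Longrightarrow> 0 \<le> f x"
    and f1: "(\<integral>\<^sup>+x. ennreal (f x) \<partial>Leb {1..d}) = 1"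
    and g: "marginal d I f \<in> Nikolskii I p \<beta> L"
    and cont: "continuous_map (product_topology (\<lambda>_. euclideanreal) I) euclideanreal (marginal d I f)"
    and e: "\<And>i. i \<in> I \<Longrightarrow> e i > 0" "\<And>i. i \<in> I \<Longrightarrow> \<beta> i * e i - rec (p i) * sum e I = 1"
    and n: "n \<ge> 1" and \<delta>: "0 < \<delta>" "\<delta> \<le> 1" "real n * \<delta> powr sum e I * \<delta>\<^sup>2 \<ge> 1"
    and x: "x \<in> space (Leb {1..d})"
  shows "(\<integral>\<^sup>+X. ennreal (exp (dev_scale * \<bar>block_error n e \<delta> (marginal d I f (restrict x I)) x X\<bar> / \<delta>)) \<partial>sample_law n d f)
     \<le> ennreal (dev_const e)"
    and "block_error n e \<delta> (marginal d I f (restrict x I)) x \<in> borel_measurable (sample_law n d f)"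
proof -
  define g where "g = marginal d I f"
  define N where "N = density (Leb {1..d}) (\<lambda>x. ennreal (f x))"
  have mgm: "marginal d I f \<in> borel_measurable (Leb I)" using g by (simp add: Nikolskii_def)
  then have gm[measurable]: "g \<in> borel_measurable (Leb I)" by (simp only: g_def)
  have g0: "0 \<le> g y" if "y \<in> space (Leb I)" for y
    unfolding g_def by (rule marginal_nonneg[OF Id(1) f0 that])
  have "prob_space N" unfolding N_def by (rule prob_space_density_Leb[OF f f1])
  then interpret N: prob_space N .
  have rm: "(\<lambda>x. restrict x I) \<in> measurable N (Leb I)"
    unfolding N_def by (simp only: measurable_density_eq1 measurable_restrict_Leb[OF Id(1)])
  have g1: "(\<integral>\<^sup>+y. ennreal (g y) \<partial>Leb I) = 1"
    unfolding g_def by (rule nn_integral_marginal[OF Id(1) f f0 f1 mgm])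
  have gi: "integrable (Leb I) g" by (rule integrableI_nonneg) (use g0 g1 in auto)
  have rx: "restrict x I \<in> space (Leb I)" by (simp add: space_Leb)
  define h where "h i = \<delta> powr e i" for i
  have h: "h i > 0" for i using \<delta> by (simp add: h_def)
  define V where "V = prod h I"
  have V: "V = \<delta> powr sum e I" unfolding V_def h_def using \<delta> by (simp add: powr_sum)
  have V0: "V > 0" using \<delta> by (simp add: V)
  define y0 where "y0 = restrict x I"
  define PK where "PK = prod_kernel K h I y0"
  have PKm[measurable]: "PK \<in> borel_measurable (Leb I)" unfolding PK_def by (rule measurable_prod_kernel) measurable
  define M where "M = B ^ card I / V"
  have PKT: "PK \<in> test_fun I M V" unfolding PK_def M_def V_def by (rule prod_kernel_test[OF h])
  have PKb: "\<bar>PK y\<bar> \<le> M" for y using PKT by (simp add: test_fun_def)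
  have M0: "M \<ge> 0" using B_nonneg V0 by (simp add: M_def)
  define Y where "Y X = PK (restrict X I)" for X
  have Y: "prod_kernel K h I x X = Y X" for X
    unfolding Y_def PK_def prod_kernel_def y0_def by (intro prod.cong) auto
  have Ym: "Y \<in> borel_measurable N" unfolding Y_def[abs_def] by (rule measurable_compose[OF rm PKm])
  have EY: "(\<integral>X. F (restrict X I) \<partial>N) = (\<integral>y. F y * g y \<partial>Leb I)" if "F \<in> borel_measurable (Leb I)" for F :: "point \<Rightarrow> real"
    unfolding N_def g_def by (rule integral_restrict_density[OF Id(1) f f0 f1 mgm that])
  have mean: "(\<integral>X. Y X \<partial>N) = smooth K h I g y0"
    unfolding Y_def EY[OF PKm] by (simp add: smooth_def PK_def)
  have bias: "\<bar>(\<integral>X. Y X \<partial>N) - g y0\<bar> \<le> 2 * bias_const e * \<delta>"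
    unfolding mean h_def y0_def
    by (rule smooth_bias[OF g[folded g_def] gi Id(2) cont[folded g_def] e \<delta>(1) rx]) auto
  define v where "v = sup_const e * B ^ card I * A ^ card I / V"
  have var: "(\<integral>X. (Y X)\<^sup>2 \<partial>N) \<le> v"
  proof -
    have PKi: "integrable (Leb I) PK" unfolding PK_def by (rule integrable_prod_kernel[OF fin K_integrable h])
    have sup: "g y \<le> sup_const e" if "y \<in> space (Leb I)" for y
      by (rule density_bounded[OF g[folded g_def] Id(2) g0 g1 cont[folded g_def] e that]) auto
    have s0: "sup_const e \<ge> 0" using sup[OF rx] g0[OF rx] by linarith
    \<comment> \<open>Only one factor of the square is bounded by \<open>M\<close>; the other one is
      integrated. The second moment is therefore of order 1/V and not 1/V^2.\<close>
    have bd: "(PK y)\<^sup>2 * g y \<le> M * sup_const e * \<bar>PK y\<bar>" if "y \<in> space (Leb I)" for y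
    proof -
      have "(PK y)\<^sup>2 \<le> M * \<bar>PK y\<bar>"
        using mult_right_mono[OF PKb[of y], of "\<bar>PK y\<bar>"] by (simp add: power2_eq_square flip: abs_mult)
      then have "(PK y)\<^sup>2 * g y \<le> (M * \<bar>PK y\<bar>) * sup_const e"
        using sup[OF that] g0[OF that] M0 by (intro mult_mono) auto
      then show ?thesis by (simp add: mult_ac)
    qed
    have "(\<integral>X. (Y X)\<^sup>2 \<partial>N) = (\<integral>y. (PK y)\<^sup>2 * g y \<partial>Leb I)"
      unfolding Y_def by (rule EY) measurable
    also have "\<dots> \<le> (\<integral>y. M * sup_const e * \<bar>PK y\<bar> \<partial>Leb I)"
    proof (rule integral_mono)
      show "integrable (Leb I) (\<lambda>y. (PK y)\<^sup>2 * g y)"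
      proof (rule Bochner_Integration.integrable_bound)
        show "integrable (Leb I) (\<lambda>y. M * sup_const e * \<bar>PK y\<bar>)" using PKi by (intro integrable_mult_right) auto
        show "AE y in Leb I. norm ((PK y)\<^sup>2 * g y) \<le> norm (M * sup_const e * \<bar>PK y\<bar>)"
          using bd g0 M0 s0 by (intro AE_I2) simp
      qed measurable
    qed (use PKi bd in auto)
    also have "\<dots> = M * sup_const e * A ^ card I"
      using integral_prod_kernel[of I "\<lambda>z. \<bar>K z\<bar>" h y0] fin h K_integrable by (simp add: PK_def abs_prod_kernel)
    finally show ?thesis by (simp add: v_def M_def mult_ac)
  qed
  have nV: "1 \<le> real n * V * \<delta>\<^sup>2" using \<delta>(3) by (simp add: V)
  have nV0: "real n * V > 0" using n V0 by simp
  define c where "c = dev_scale"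
  have c: "c > 0" "c \<le> 1" "c * (2 * B ^ card I) \<le> 1" using dev_scale_bounds by (auto simp: c_def)
  define S where "S = PiM {1..n} (\<lambda>_. N)"
  have S: "sample_law n d f = S" by (simp add: S_def sample_law_def N_def)
  define Z where "Z X = 1 / real n * (\<Sum>k=1..n. Y (X k)) - (\<integral>x. Y x \<partial>N)" for X
  have Zm[measurable]: "Z \<in> borel_measurable S"
  proof -
    have "(\<lambda>X. Y (X k)) \<in> borel_measurable S" if "k \<in> {1..n}" for k
      unfolding S_def by (rule measurable_compose[OF _ Ym]) (rule measurable_component_singleton[OF that])
    then have "(\<lambda>X. \<Sum>k=1..n. Y (X k)) \<in> borel_measurable S" by (intro borel_measurable_sum)
    then show ?thesis unfolding Z_def[abs_def] by measurable
  qed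
  define D where "D X = block_error n e \<delta> (marginal d I f (restrict x I)) x X" for X
  have D: "D X = Z X + ((\<integral>x. Y x \<partial>N) - g y0)" for X
    unfolding D_def block_error_def h_def[symmetric] Y Z_def g_def[symmetric] y0_def[symmetric] by simp
  show "block_error n e \<delta> (marginal d I f (restrict x I)) x \<in> borel_measurable (sample_law n d f)"
    unfolding S D_def[abs_def, symmetric] D[abs_def] by measurable
  have moment: "(\<integral>\<^sup>+X. ennreal (exp (\<theta> * Z X)) \<partial>S) \<le> ennreal (exp (sup_const e * B ^ card I * A ^ card I))"
    if \<theta>: "\<bar>\<theta>\<bar> = c / \<delta>" for \<theta>
  proof -
    have "\<bar>\<theta>\<bar> * (2 * M) \<le> real n"
    proof -
      have "\<bar>\<theta>\<bar> * (2 * M) = (c * (2 * B ^ card I)) / (\<delta> * V)" by (simp add: \<theta> M_def)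
      also have "\<dots> \<le> 1 / (\<delta> * V)" using c \<delta> V0 by (intro divide_right_mono) auto
      also have "\<dots> \<le> real n"
      proof -
        have "real n * V * \<delta>\<^sup>2 \<le> real n * V * \<delta>"
          using nV0 \<delta> by (intro mult_left_mono) (auto simp: power2_eq_square mult_left_le)
        then have "1 \<le> real n * V * \<delta>" using nV by linarith
        then show ?thesis using V0 \<delta> by (simp add: field_simps)
      qed
      finally show ?thesis .
    qed
    then have "(\<integral>\<^sup>+X. ennreal (exp (\<theta> * Z X)) \<partial>S) \<le> ennreal (exp (\<theta>\<^sup>2 * v / real n))"
      unfolding Z_def S_def using PKb n var by (intro exp_moment_sample_mean[OF \<open>prob_space N\<close> Ym]) (auto simp: Y_def)
    also have "\<dots> \<le> ennreal (exp (sup_const e * B ^ card I * A ^ card I))"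
    proof (intro ennreal_leI, simp only: exp_le_cancel_iff)
      have s: "sup_const e * B ^ card I * A ^ card I \<ge> 0"
        using B_nonneg A_ge_1 bias_const_nonneg[of e] by (auto simp: sup_const_def intro!: mult_nonneg_nonneg add_nonneg_nonneg)
      have "\<theta>\<^sup>2 = c\<^sup>2 / \<delta>\<^sup>2" using \<theta> by (metis power2_abs power_divide)
      then have "\<theta>\<^sup>2 * v / real n = (sup_const e * B ^ card I * A ^ card I) * (c\<^sup>2 / (real n * V * \<delta>\<^sup>2))"
        by (simp add: v_def mult_ac)
      also have "\<dots> \<le> (sup_const e * B ^ card I * A ^ card I) * 1"
      proof (rule mult_left_mono[OF _ s])
        have "c\<^sup>2 \<le> 1" using c by (simp add: power_le_one)
        then show "c\<^sup>2 / (real n * V * \<delta>\<^sup>2) \<le> 1" using nV by (simp add: divide_le_eq)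
      qed
      finally show "\<theta>\<^sup>2 * v / real n \<le> sup_const e * B ^ card I * A ^ card I" by simp
    qed
    finally show ?thesis .
  qed
  have pt: "exp (c * \<bar>D X\<bar> / \<delta>) \<le> exp (2 * bias_const e) * (exp (c / \<delta> * Z X) + exp (- (c / \<delta>) * Z X))" for X
  proof -
    have "c * \<bar>D X\<bar> / \<delta> \<le> c * (\<bar>Z X\<bar> + 2 * bias_const e * \<delta>) / \<delta>"
      using bias c \<delta> by (intro divide_right_mono mult_left_mono) (auto simp: D)
    also have "\<dots> = \<bar>c / \<delta> * Z X\<bar> + c * (2 * bias_const e)"
      using c \<delta> by (simp add: field_simps abs_mult)
    also have "\<dots> \<le> \<bar>c / \<delta> * Z X\<bar> + 1 * (2 * bias_const e)"
      using c bias_const_nonneg[of e] by (intro add_left_mono mult_right_mono) auto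
    finally have "exp (c * \<bar>D X\<bar> / \<delta>) \<le> exp (\<bar>c / \<delta> * Z X\<bar> + 1 * (2 * bias_const e))" by simp
    also have "\<dots> = exp (2 * bias_const e) * exp \<bar>c / \<delta> * Z X\<bar>" by (simp add: exp_add)
    also have "\<dots> \<le> exp (2 * bias_const e) * (exp (c / \<delta> * Z X) + exp (- (c / \<delta>) * Z X))"
      by (intro mult_left_mono) (auto simp: abs_if)
    finally show ?thesis .
  qed
  have "(\<integral>\<^sup>+X. ennreal (exp (c * \<bar>D X\<bar> / \<delta>)) \<partial>S)
    \<le> (\<integral>\<^sup>+X. ennreal (exp (2 * bias_const e)) * (ennreal (exp (c / \<delta> * Z X)) + ennreal (exp (- (c / \<delta>) * Z X))) \<partial>S)"
  proof (rule nn_integral_mono)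
    fix X
    have "ennreal (exp (c * \<bar>D X\<bar> / \<delta>)) \<le> ennreal (exp (2 * bias_const e) * (exp (c / \<delta> * Z X) + exp (- (c / \<delta>) * Z X)))"
      by (rule ennreal_leI[OF pt])
    also have "\<dots> = ennreal (exp (2 * bias_const e)) * (ennreal (exp (c / \<delta> * Z X)) + ennreal (exp (- (c / \<delta>) * Z X)))"
      by (simp add: ennreal_mult)
    finally show "ennreal (exp (c * \<bar>D X\<bar> / \<delta>))
      \<le> ennreal (exp (2 * bias_const e)) * (ennreal (exp (c / \<delta> * Z X)) + ennreal (exp (- (c / \<delta>) * Z X)))" .
  qed
  also have "\<dots> = ennreal (exp (2 * bias_const e)) *
     ((\<integral>\<^sup>+X. ennreal (exp (c / \<delta> * Z X)) \<partial>S) + (\<integral>\<^sup>+X. ennreal (exp (- (c / \<delta>) * Z X)) \<partial>S))"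
    by (subst nn_integral_cmult, measurable, subst nn_integral_add) measurable
  also have "\<dots> \<le> ennreal (exp (2 * bias_const e)) *
     (ennreal (exp (sup_const e * B ^ card I * A ^ card I)) + ennreal (exp (sup_const e * B ^ card I * A ^ card I)))"
    using c \<delta> by (intro mult_left_mono add_mono moment) auto
  also have "\<dots> = ennreal (dev_const e)"
    unfolding dev_const_def by (simp add: ennreal_mult flip: ennreal_plus)
  finally show "(\<integral>\<^sup>+X. ennreal (exp (dev_scale * \<bar>block_error n e \<delta> (marginal d I f (restrict x I)) x X\<bar> / \<delta>)) \<partial>sample_law n d f)
     \<le> ennreal (dev_const e)"
    unfolding S D_def c_def .
qed

end

subsection \<open>Products over blocks\<close>

text \<open>One factor is exchanged at a time. A single power of \<phi> is extracted, and all
  further errors are absorbed into the product of the \<open>1 + t I\<close>, using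
  \<open>\<bar>a I\<bar> \<le> G * (1 + t I)\<close>. Each step adds two terms of the same size,
  which is why the base is \<open>2 * G\<close>.\<close>

lemma abs_prod_diff_le:
  fixes a b t :: "'i \<Rightarrow> real"
  assumes "finite P" and b: "\<And>I. I \<in> P \<Longrightarrow> \<bar>b I\<bar> \<le> G" and ab: "\<And>I. I \<in> P \<Longrightarrow> \<bar>a I - b I\<bar> \<le> \<phi> * t I"
    and G: "G \<ge> 1" and \<phi>: "0 \<le> \<phi>" "\<phi> \<le> 1" and t: "\<And>I. I \<in> P \<Longrightarrow> t I \<ge> 0"
  shows "\<bar>prod a P - prod b P\<bar> \<le> \<phi> * (2 * G) ^ card P * (\<Prod>I\<in>P. 1 + t I)"
  using assms(1) b ab t
proof (induction P)
  case empty
  then show ?case using \<phi> by simp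
next
  case (insert J P)
  define R where "R = (\<Prod>I\<in>P. 1 + t I)"
  have R: "R \<ge> 1" unfolding R_def using insert.prems(3) by (intro prod_ge_1) auto
  have tJ: "t J \<ge> 0" using insert.prems by simp
  have IH: "\<bar>prod a P - prod b P\<bar> \<le> \<phi> * (2 * G) ^ card P * R"
    unfolding R_def using insert by auto
  have pb: "\<bar>prod b P\<bar> \<le> G ^ card P"
  proof -
    have "(\<Prod>I\<in>P. \<bar>b I\<bar>) \<le> (\<Prod>I\<in>P. G)" using insert.prems(1) by (intro prod_mono) auto
    then show ?thesis by (simp add: abs_prod)
  qed
  have aJ: "\<bar>a J\<bar> \<le> G * (1 + t J)"
  proof -
    have "\<bar>a J\<bar> \<le> \<bar>b J\<bar> + \<bar>a J - b J\<bar>" by linarith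
    also have "\<dots> \<le> G + \<phi> * t J" using insert.prems by (intro add_mono) auto
    also have "\<dots> \<le> G + G * t J" using \<phi> G tJ by (intro add_left_mono mult_right_mono) auto
    finally show ?thesis by (simp add: algebra_simps)
  qed
  have "prod a (insert J P) - prod b (insert J P) = a J * (prod a P - prod b P) + (a J - b J) * prod b P"
    using insert.hyps by (simp add: algebra_simps)
  then have "\<bar>prod a (insert J P) - prod b (insert J P)\<bar> \<le> \<bar>a J\<bar> * \<bar>prod a P - prod b P\<bar> + \<bar>a J - b J\<bar> * \<bar>prod b P\<bar>"
    by (metis abs_mult abs_triangle_ineq)
  also have "\<dots> \<le> (G * (1 + t J)) * (\<phi> * (2 * G) ^ card P * R) + (\<phi> * t J) * G ^ card P"
    using aJ IH pb insert.prems G \<phi> tJ by (intro add_mono mult_mono) auto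
  also have "(\<phi> * t J) * G ^ card P \<le> (\<phi> * (1 + t J)) * (G * (2 * G) ^ card P * R)"
  proof (rule mult_mono)
    have "G ^ card P \<le> (2 * G) ^ card P" using G by (intro power_mono) auto
    also have "\<dots> \<le> G * (2 * G) ^ card P * R"
    proof -
      have "1 * 1 \<le> G * R" using G R by (intro mult_mono) auto
      then have "1 * (2 * G) ^ card P \<le> (G * R) * (2 * G) ^ card P" using G by (intro mult_right_mono) auto
      then show ?thesis by (simp add: mult_ac)
    qed
    finally show "G ^ card P \<le> G * (2 * G) ^ card P * R" .
  qed (use \<phi> tJ G in \<open>auto intro!: mult_left_mono\<close>)
  finally show ?case using insert.hyps by (simp add: R_def algebra_simps)
qed

text \<open>With \<open>N = q * card P\<close> each factor satisfies
  \<open>1 + s \<le> (N / c) * exp (c * s / N)\<close>. The power \<open>q\<close> of the product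
  then contains the exponential of the average of the \<open>c * t I\<close>, which is at most the
  largest single exponential and so at most the sum.\<close>

lemma prod_one_plus_powr_le:
  fixes t :: "'i \<Rightarrow> real"
  assumes P: "finite P" "P \<noteq> {}" and q: "q \<ge> 1" and c: "0 < c" "c \<le> 1" and t: "\<And>I. I \<in> P \<Longrightarrow> t I \<ge> 0"
  shows "(\<Prod>I\<in>P. 1 + t I) powr q \<le> ((q * real (card P) / c) ^ card P) powr q * (\<Sum>I\<in>P. exp (c * t I))"
proof -
  define m where "m = real (card P)"
  have m: "m \<ge> 1" using P by (simp add: m_def card_gt_0_iff Suc_leI)
  define N where "N = q * m"
  have N: "N \<ge> 1" unfolding N_def using q m mult_mono[of 1 q 1 m] by simp
  have one: "1 + s \<le> (N / c) * exp (c * s / N)" if "s \<ge> 0" for s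
  proof -
    have "1 \<le> N / c" using N c by simp
    then have "1 + s \<le> N / c + s" by simp
    also have "\<dots> = (N / c) * (1 + c * s / N)" using N c by (simp add: field_simps)
    also have "\<dots> \<le> (N / c) * exp (c * s / N)" using N c by (intro mult_left_mono exp_ge_add_one_self) auto
    finally show ?thesis .
  qed
  have "(\<Prod>I\<in>P. 1 + t I) \<le> (\<Prod>I\<in>P. (N / c) * exp (c * t I / N))"
    using one t by (intro prod_mono) (auto simp: add_nonneg_nonneg)
  also have "\<dots> = (N / c) ^ card P * exp ((\<Sum>I\<in>P. c * t I) / N)"
    by (simp only: prod.distrib prod_constant sum_divide_distrib exp_sum[OF P(1)])
  finally have "(\<Prod>I\<in>P. 1 + t I) powr q \<le> ((N / c) ^ card P * exp ((\<Sum>I\<in>P. c * t I) / N)) powr q"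
    using q t by (intro powr_mono2) (auto intro!: prod_nonneg add_nonneg_nonneg)
  also have "\<dots> = ((N / c) ^ card P) powr q * exp ((\<Sum>I\<in>P. c * t I) / m)"
  proof -
    have "exp ((\<Sum>I\<in>P. c * t I) / N) powr q = exp (q * ((\<Sum>I\<in>P. c * t I) / N))"
      by (simp add: powr_def)
    also have "q * ((\<Sum>I\<in>P. c * t I) / N) = (\<Sum>I\<in>P. c * t I) / m" using q by (simp add: N_def)
    finally show ?thesis using N c by (subst powr_mult) auto
  qed
  also have "exp ((\<Sum>I\<in>P. c * t I) / m) \<le> (\<Sum>I\<in>P. exp (c * t I))"
  proof -
    obtain J where J: "J \<in> P" "\<And>I. I \<in> P \<Longrightarrow> t I \<le> t J"
      using Max_in[of "t ` P"] Max_ge[of "t ` P"] P by (metis (no_types, lifting) finite_imageI image_iff image_is_empty)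
    have "(\<Sum>I\<in>P. c * t I) \<le> (\<Sum>I\<in>P. c * t J)" using J c by (intro sum_mono mult_left_mono) auto
    then have "(\<Sum>I\<in>P. c * t I) / m \<le> c * t J" using m by (simp add: m_def field_simps)
    then have "exp ((\<Sum>I\<in>P. c * t I) / m) \<le> exp (c * t J)" by simp
    also have "\<dots> \<le> (\<Sum>I\<in>P. exp (c * t I))" using J P by (intro member_le_sum) auto
    finally show ?thesis .
  qed
  finally show ?thesis by (simp add: N_def m_def mult_left_mono)
qed

lemma measurable_exp_abs:
  assumes [measurable]: "D \<in> borel_measurable M"
  shows "(\<lambda>X. ennreal (exp (c * (\<bar>D X\<bar> / s)))) \<in> borel_measurable M"
  by measurable

lemma epowr_le:
  assumes "y \<le> ennreal z" "z \<ge> 0" "a > 0" shows "epowr y a \<le> ennreal (z powr a)"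
proof -
  have y: "y \<noteq> \<infinity>" using assms(1) by (auto simp: top_unique)
  have "enn2real y \<le> z" using assms enn2real_mono[OF assms(1)] by simp
  then have "enn2real y powr a \<le> z powr a" using assms by (intro powr_mono2) auto
  then show ?thesis using y by (simp add: epowr_def ennreal_leI)
qed

text \<open>Writing s for the sum of the \<open>1 / \<beta> i\<close>, one has
  \<open>kap_i \<beta> p I i = kap \<beta> p I + rec (p i) * s\<close>, and therefore
  \<open>1 / beta_i \<beta> p I i\<close> is
  \<open>(1 + rec (p i) / gam \<beta> p I) / \<beta> i\<close>. Positivity is immediate, summation
  gives \<open>1 / gam \<beta> p I\<close>, and multiplication by \<open>\<beta> i\<close> gives the
  balance equation required by \<open>coord_err_le\<close>.\<close>

lemma exponent_balance:
  assumes fin: "finite I" "I \<noteq> {}" and \<beta>: "\<And>i. i \<in> I \<Longrightarrow> 0 < \<beta> i" and g: "gam \<beta> p I > 0"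
  shows "(\<Sum>i\<in>I. 1 / beta_i \<beta> p I i) = 1 / gam \<beta> p I"
    and "i \<in> I \<Longrightarrow> 1 / beta_i \<beta> p I i > 0"
    and "i \<in> I \<Longrightarrow> \<beta> i * (1 / beta_i \<beta> p I i) - rec (p i) * (\<Sum>i\<in>I. 1 / beta_i \<beta> p I i) = 1"
proof -
  define s where "s = (\<Sum>i\<in>I. 1 / \<beta> i)"
  define w where "w = (\<Sum>i\<in>I. rec (p i) / \<beta> i)"
  have s: "s > 0" unfolding s_def using fin \<beta> by (intro sum_pos) auto
  have gk: "gam \<beta> p I = kap \<beta> p I / s" by (simp add: gam_def kap_def s_def)
  have k: "kap \<beta> p I > 0" using g s by (simp add: gk zero_less_divide_iff)
  have kw: "kap \<beta> p I = 1 - w" by (simp add: kap_def w_def)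
  have ki: "kap_i \<beta> p I i = kap \<beta> p I + rec (p i) * s" for i
    by (simp add: kap_i_def kap_def s_def diff_divide_distrib sum_subtractf sum_distrib_left)
  have ki0: "kap_i \<beta> p I i > 0" for i
    using k s rec_nonneg[of "p i"] by (simp add: ki add_pos_nonneg)
  have e: "1 / beta_i \<beta> p I i = kap_i \<beta> p I i / (kap \<beta> p I * \<beta> i)" for i by (simp add: beta_i_def)
  have "(\<Sum>i\<in>I. 1 / beta_i \<beta> p I i) = (\<Sum>i\<in>I. 1 / \<beta> i + (s / kap \<beta> p I) * (rec (p i) / \<beta> i))"
    using k by (intro sum.cong refl) (simp add: e ki add_divide_distrib)
  also have "\<dots> = s + (s / kap \<beta> p I) * w"
    by (simp add: sum.distrib s_def w_def sum_distrib_left)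
  also have "\<dots> = 1 / gam \<beta> p I" using k s by (simp add: gk kw field_simps)
  finally show sum: "(\<Sum>i\<in>I. 1 / beta_i \<beta> p I i) = 1 / gam \<beta> p I" .
  {
    assume i: "i \<in> I"
    show "1 / beta_i \<beta> p I i > 0" using ki0[of i] k \<beta>[OF i] by (simp add: e)
    show "\<beta> i * (1 / beta_i \<beta> p I i) - rec (p i) * (\<Sum>i\<in>I. 1 / beta_i \<beta> p I i) = 1"
      unfolding sum using k s \<beta>[OF i] by (simp add: e ki gk field_simps)
  }
qed

lemma block_eq: "partition_on D P \<Longrightarrow> I \<in> P \<Longrightarrow> i \<in> I \<Longrightarrow> block P i = I"
  unfolding block_def partition_on_def disjoint_def by (rule the_equality) auto

text \<open>The constants are chosen before \<open>f\<close> and \<open>n\<close>; this uniformity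
  is what the supremum in the risk and the limit superior require. Errors are measured in the common
  rate instead of the block's own \<delta>, which is smaller because \<open>rate_exp\<close> is the
  infimum of the \<open>gam \<beta> p I\<close>.\<close>

lemma block_estimate:
  assumes u: "kernel_base l u"
    and \<beta>: "\<forall>i\<in>{1..d}. 0 < \<beta> i \<and> \<beta> i \<le> real l" and p: "\<forall>i\<in>{1..d}. 1 \<le> p i"
    and P: "partition_on {1..d} P" and r: "rate_exp \<beta> p P > 0" and L: "\<forall>i\<in>{1..d}. 0 < L i"
    and x: "x0 \<in> space (Leb {1..d})" and I: "I \<in> P"
  shows "\<exists>c C G. 0 < c \<and> c \<le> 1 \<and> (\<forall>f\<in>indep_class d p \<beta> L P.
     0 \<le> marginal d I f (restrict x0 I) \<and> marginal d I f (restrict x0 I) \<le> G \<and>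
     (\<forall>n\<ge>1. let h = bandwidth n \<beta> p P;
          D = (\<lambda>X. 1 / real n * (\<Sum>k=1..n. \<Prod>i\<in>I. 1 / h i * kernel_l u l ((X k i - x0 i) / h i)) - marginal d I f (restrict x0 I))
       in D \<in> borel_measurable (sample_law n d f) \<and>
          (\<integral>\<^sup>+X. ennreal (exp (c * (\<bar>D X\<bar> / rate n \<beta> p P))) \<partial>sample_law n d f) \<le> ennreal C))"
proof -
  have Id: "I \<subseteq> {1..d}" "I \<noteq> {}" using P I by (auto simp: partition_on_def)
  have fP: "finite P" using P finite_elements[of "{1..d}" P] by simp
  have fin: "finite I" using Id finite_subset by blast
  obtain B where B: "\<And>z. \<bar>kernel_l u l z\<bar> \<le> B"
    using bounded_compact_support[OF continuous_kernel_l[OF u], of "1 / 2"] kernel_l_support[OF u] by metis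
  interpret nikolskii_kernel I u l \<beta> L p B
    by standard (use fin u \<beta> p L Id B in auto)
  define \<gamma> where "\<gamma> = gam \<beta> p I"
  have rg: "rate_exp \<beta> p P \<le> \<gamma>"
    unfolding rate_exp_def \<gamma>_def using fP I by (intro cINF_lower) auto
  then have \<gamma>: "\<gamma> > 0" using r by linarith
  define e where "e i = 1 / beta_i \<beta> p I i" for i
  have \<beta>I: "0 < \<beta> i" if "i \<in> I" for i using \<beta> Id that by blast
  have sum_e: "sum e I = 1 / \<gamma>"
    unfolding e_def \<gamma>_def
    by (rule exponent_balance(1)) (use fin Id(2) \<beta>I \<gamma> in \<open>simp_all add: \<gamma>_def\<close>)
  have e0: "e i > 0" if "i \<in> I" for i
    unfolding e_def
    by (rule exponent_balance(2)) (use fin Id(2) \<beta>I \<gamma> that in \<open>simp_all add: \<gamma>_def\<close>)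
  have bal: "\<beta> i * e i - rec (p i) * sum e I = 1" if "i \<in> I" for i
    unfolding e_def
    by (rule exponent_balance(3)) (use fin Id(2) \<beta>I \<gamma> that in \<open>simp_all add: \<gamma>_def\<close>)
  define \<delta> where "\<delta> n = real n powr (- (\<gamma> / (2 * \<gamma> + 1)))" for n
  have bw: "bandwidth n \<beta> p P i = \<delta> n powr e i" if "i \<in> I" for n i
    using block_eq[OF P I that] by (simp add: bandwidth_def \<delta>_def e_def \<gamma>_def Let_def powr_powr)
  have pk: "(\<Prod>i\<in>I. 1 / bandwidth n \<beta> p P i * K ((X k i - x0 i) / bandwidth n \<beta> p P i))
      = prod_kernel K (\<lambda>i. \<delta> n powr e i) I x0 (X k)" for n k and X :: "nat \<Rightarrow> point"
    unfolding prod_kernel_def by (intro prod.cong refl) (simp only: bw)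
  have \<delta>n: "0 < \<delta> n" "\<delta> n \<le> 1" "real n * \<delta> n powr sum e I * (\<delta> n)\<^sup>2 \<ge> 1" "\<delta> n \<le> rate n \<beta> p P" if n: "n \<ge> 1" for n
  proof -
    define x where "x = real n"
    have x1: "x \<ge> 1" using n by (simp add: x_def)
    show "0 < \<delta> n" using n by (simp add: \<delta>_def)
    have "x powr (- (\<gamma> / (2 * \<gamma> + 1))) \<le> x powr 0" using x1 \<gamma> by (intro powr_mono) auto
    then show "\<delta> n \<le> 1" using x1 by (simp add: \<delta>_def x_def)
    have "x * \<delta> n powr sum e I * (\<delta> n)\<^sup>2 = x powr 1 * x powr (- (\<gamma> / (2 * \<gamma> + 1)) * (1 / \<gamma>)) * x powr (- (\<gamma> / (2 * \<gamma> + 1)) * 2)"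
      using x1 by (simp add: \<delta>_def sum_e powr_powr x_def[symmetric] flip: powr_numeral)
    also have "\<dots> = x powr (1 + - (\<gamma> / (2 * \<gamma> + 1)) * (1 / \<gamma>) + - (\<gamma> / (2 * \<gamma> + 1)) * 2)"
      by (simp only: powr_add)
    \<comment> \<open>Since \<open>sum e I = 1 / \<gamma>\<close>, the last two terms add up to
      \<open>- (1 + 2 * \<gamma>) / (2 * \<gamma> + 1)\<close>: variance and squared bias balance
      exactly.\<close>
    also have "1 + - (\<gamma> / (2 * \<gamma> + 1)) * (1 / \<gamma>) + - (\<gamma> / (2 * \<gamma> + 1)) * 2 = 0"
      using \<gamma> by (simp add: divide_simps)
    finally show "real n * \<delta> n powr sum e I * (\<delta> n)\<^sup>2 \<ge> 1" using x1 by (simp add: x_def)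
    define \<rho> where "\<rho> = rate_exp \<beta> p P"
    \<comment> \<open>The map r \<mapsto> r / (2 r + 1) is increasing on positive arguments, so the
      block with the smallest \<gamma> dictates the rate.\<close>
    have "\<rho> / (2 * \<rho> + 1) \<le> \<gamma> / (2 * \<gamma> + 1)"
    proof -
      have \<rho>: "0 < \<rho>" "\<rho> \<le> \<gamma>" using r rg by (simp_all add: \<rho>_def)
      then have "\<rho> \<le> \<gamma> * (2 * \<rho> + 1) / (2 * \<gamma> + 1)" using \<gamma> by (simp add: pos_le_divide_eq algebra_simps)
      then show ?thesis using \<rho>(1) by (simp add: pos_divide_le_eq)
    qed
    then have "x powr (- (\<gamma> / (2 * \<gamma> + 1))) \<le> x powr (- (\<rho> / (2 * \<rho> + 1)))"
      using x1 by (intro powr_mono) auto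
    also have "\<dots> = rate n \<beta> p P"
      using x1 unfolding rate_def \<rho>_def[symmetric] x_def[symmetric] by (simp add: powr_divide powr_minus_divide)
    finally show "\<delta> n \<le> rate n \<beta> p P" by (simp add: \<delta>_def x_def)
  qed
  show ?thesis
  proof (rule exI[of _ dev_scale], rule exI[of _ "dev_const e"], rule exI[of _ "sup_const e"], intro conjI ballI allI impI)
    show "0 < dev_scale" "dev_scale \<le> 1" using dev_scale_bounds by auto
    fix f assume "f \<in> indep_class d p \<beta> L P"
    then have f[measurable]: "f \<in> borel_measurable (Leb {1..d})" and f0: "\<And>x. x \<in> space (Leb {1..d}) \<Longrightarrow> 0 \<le> f x"
      and f1: "(\<integral>\<^sup>+x. ennreal (f x) \<partial>Leb {1..d}) = 1" and g: "marginal d I f \<in> Nikolskii I p \<beta> L"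
      and cont: "continuous_map (product_topology (\<lambda>_. euclideanreal) I) euclideanreal (marginal d I f)"
      using I r unfolding indep_class_def by blast+
    have rx: "restrict x0 I \<in> space (Leb I)" by (simp add: space_Leb)
    show "0 \<le> marginal d I f (restrict x0 I)" by (rule marginal_nonneg[OF Id(1) f0 rx])
    show "marginal d I f (restrict x0 I) \<le> sup_const e"
    proof (rule density_bounded[OF g Id(2) _ _ cont e0 bal rx])
      show "0 \<le> marginal d I f y" if "y \<in> space (Leb I)" for y by (rule marginal_nonneg[OF Id(1) f0 that])
      show "(\<integral>\<^sup>+y. ennreal (marginal d I f y) \<partial>Leb I) = 1"
      proof (rule nn_integral_marginal[OF Id(1) f f0 f1])
        show "marginal d I f \<in> borel_measurable (Leb I)" using g by (simp add: Nikolskii_def)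
      qed
    qed
    fix n :: nat assume n: "n \<ge> 1"
    define D where "D = block_error n e (\<delta> n) (marginal d I f (restrict x0 I)) x0"
    have D: "1 / real n * (\<Sum>k=1..n. \<Prod>i\<in>I. 1 / bandwidth n \<beta> p P i * K ((X k i - x0 i) / bandwidth n \<beta> p P i)) - marginal d I f (restrict x0 I) = D X"
      for X by (simp only: pk D_def block_error_def)
    have m: "(\<integral>\<^sup>+X. ennreal (exp (dev_scale * \<bar>D X\<bar> / \<delta> n)) \<partial>sample_law n d f) \<le> ennreal (dev_const e)"
      and Dm: "D \<in> borel_measurable (sample_law n d f)"
      unfolding D_def using block_error_moment[OF Id f f0 f1 g cont e0 bal n \<delta>n(1-3)[OF n] x] by auto
    have "(\<integral>\<^sup>+X. ennreal (exp (dev_scale * (\<bar>D X\<bar> / rate n \<beta> p P))) \<partial>sample_law n d f)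
       \<le> (\<integral>\<^sup>+X. ennreal (exp (dev_scale * \<bar>D X\<bar> / \<delta> n)) \<partial>sample_law n d f)"
    proof (intro nn_integral_mono ennreal_leI)
      fix X
      have "\<bar>D X\<bar> / rate n \<beta> p P \<le> \<bar>D X\<bar> / \<delta> n" using \<delta>n[OF n] by (intro divide_left_mono) auto
      then have "dev_scale * (\<bar>D X\<bar> / rate n \<beta> p P) \<le> dev_scale * (\<bar>D X\<bar> / \<delta> n)"
        using dev_scale_bounds by (intro mult_left_mono) auto
      then show "exp (dev_scale * (\<bar>D X\<bar> / rate n \<beta> p P)) \<le> exp (dev_scale * \<bar>D X\<bar> / \<delta> n)" by simp
    qed
    then show "let h = bandwidth n \<beta> p P;
          D = (\<lambda>X. 1 / real n * (\<Sum>k=1..n. \<Prod>i\<in>I. 1 / h i * K ((X k i - x0 i) / h i)) - marginal d I f (restrict x0 I))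
       in D \<in> borel_measurable (sample_law n d f) \<and>
          (\<integral>\<^sup>+X. ennreal (exp (dev_scale * (\<bar>D X\<bar> / rate n \<beta> p P))) \<partial>sample_law n d f) \<le> ennreal (dev_const e)"
      unfolding Let_def D using m Dm order_trans by blast
  qed
qed

text \<open>The finitely many block constants are merged into one \<open>W\<close> that bounds the
  normalized risk for every \<open>n \<ge> 1\<close>; the limit superior disregards n = 0.\<close>

theorem theorem3:
  fixes d l :: nat and q :: real and x0 :: point and u :: "real \<Rightarrow> real"
    and \<beta> L :: "nat \<Rightarrow> real" and p :: "nat \<Rightarrow> ennreal" and P :: "nat set set"
  assumes "d \<ge> 1" and "q \<ge> 1" and "x0 \<in> space (Leb {1..d})" and "l \<ge> 2"
    and "\<And>z. u (- z) = u z"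
    and "\<exists>C. C-lipschitz_on UNIV u"
    and "closure {z. u z \<noteq> 0} \<subseteq> {- (1 / (2 * real l)) .. 1 / (2 * real l)}"
    and "(\<integral>z. u z \<partial>lborel) = 1"
    and "\<And>i. i \<in> {1..d} \<Longrightarrow> 0 < \<beta> i \<and> \<beta> i \<le> real l"
    and "\<And>i. i \<in> {1..d} \<Longrightarrow> 1 \<le> p i"
    and "partition_on {1..d} P"
    and "rate_exp \<beta> p P > 0"
    and "\<And>i. i \<in> {1..d} \<Longrightarrow> 0 < L i"
  shows "limsup (\<lambda>n. ennreal (inverse (rate n \<beta> p P)) *
           risk n d q x0 (estimator n (kernel_l u l) (bandwidth n \<beta> p P) P x0)
             (indep_class d p \<beta> L P)) < \<infinity>"
proof -
  have fP: "finite P" using assms(11) finite_elements[of "{1..d}" P] by simp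
  have P0: "P \<noteq> {}" using assms(1,11) by (auto simp: partition_on_def)
  have supp: "u z = 0" if "\<bar>z\<bar> > 1 / (2 * real l)" for z
  proof (rule ccontr)
    assume "u z \<noteq> 0"
    then have "z \<in> closure {z. u z \<noteq> 0}" using closure_subset[of "{z. u z \<noteq> 0}"] by auto
    then show False using assms(7) that by (auto simp: abs_if split: if_splits)
  qed
  have u: "kernel_base l u"
    unfolding kernel_base_def using assms(4,6,8) supp lipschitz_on_continuous_on by auto
  define err where "err I f n X = 1 / real n * (\<Sum>k=1..n. \<Prod>i\<in>I. 1 / bandwidth n \<beta> p P i *
      kernel_l u l ((X k i - x0 i) / bandwidth n \<beta> p P i)) - marginal d I f (restrict x0 I)" for I f n and X :: "nat \<Rightarrow> point"
  have "\<forall>I\<in>P. \<exists>c C G. 0 < c \<and> c \<le> 1 \<and> (\<forall>f\<in>indep_class d p \<beta> L P.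
     0 \<le> marginal d I f (restrict x0 I) \<and> marginal d I f (restrict x0 I) \<le> G \<and>
     (\<forall>n\<ge>1. err I f n \<in> borel_measurable (sample_law n d f) \<and>
          (\<integral>\<^sup>+X. ennreal (exp (c * (\<bar>err I f n X\<bar> / rate n \<beta> p P))) \<partial>sample_law n d f) \<le> ennreal C))"
    using block_estimate[OF u _ _ assms(11,12) _ assms(3), of L] assms(9,10,13) unfolding Let_def err_def[symmetric] err_def[abs_def, symmetric] by blast
  then obtain c C G where c0: "\<And>I. I \<in> P \<Longrightarrow> 0 < c I \<and> c I \<le> 1"
    and mg: "\<And>I f. I \<in> P \<Longrightarrow> f \<in> indep_class d p \<beta> L P \<Longrightarrow>
        0 \<le> marginal d I f (restrict x0 I) \<and> marginal d I f (restrict x0 I) \<le> G I"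
    and ex: "\<And>I f n. I \<in> P \<Longrightarrow> f \<in> indep_class d p \<beta> L P \<Longrightarrow> n \<ge> 1 \<Longrightarrow> err I f n \<in> borel_measurable (sample_law n d f) \<and>
        (\<integral>\<^sup>+X. ennreal (exp (c I * (\<bar>err I f n X\<bar> / rate n \<beta> p P))) \<partial>sample_law n d f) \<le> ennreal (C I)"
    by metis
  \<comment> \<open>\<open>prod_one_plus_powr_le\<close> works with one scale for all blocks. As the
    errors are nonnegative, the smaller scale can be raised back to \<open>c I\<close> inside each
    exponential.\<close>
  define c' where "c' = Min (c ` P)"
  have c': "0 < c'" "c' \<le> 1" and c'le: "\<And>I. I \<in> P \<Longrightarrow> c' \<le> c I"
  proof -
    have "c' \<in> c ` P" unfolding c'_def using fP P0 by (intro Min_in) auto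
    then show "0 < c'" "c' \<le> 1" using c0 by auto
    show "c' \<le> c I" if "I \<in> P" for I unfolding c'_def using fP that by simp
  qed
  \<comment> \<open>Bounds all marginal values at once and is at least 1, as
    \<open>abs_prod_diff_le\<close> demands.\<close>
  define G' where "G' = 1 + (\<Sum>I\<in>P. \<bar>G I\<bar>)"
  have G': "G' \<ge> 1" by (simp add: G'_def sum_nonneg)
  have Gle: "G I \<le> G'" if "I \<in> P" for I
  proof -
    have "\<bar>G I\<bar> \<le> (\<Sum>I\<in>P. \<bar>G I\<bar>)" using fP that by (intro member_le_sum) auto
    then show ?thesis by (simp add: G'_def)
  qed
  \<comment> \<open>The \<open>q\<close>-th powers of the constants of
    \<open>abs_prod_diff_le\<close> and \<open>prod_one_plus_powr_le\<close>. The absolute values in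
    \<open>C2\<close> are taken because \<open>ennreal\<close> truncates at 0 and so gives no sign
    for \<open>C I\<close>.\<close>
  define C1 where "C1 = ((2 * G') ^ card P) powr q * ((q * real (card P) / c') ^ card P) powr q"
  define C2 where "C2 = (\<Sum>I\<in>P. \<bar>C I\<bar>)"
  have C12: "C1 \<ge> 0" "C2 \<ge> 0" by (simp_all add: C1_def C2_def sum_nonneg)
  define W where "W = (C1 * C2) powr (1 / q)"
  have main: "ennreal (inverse (rate n \<beta> p P)) * risk n d q x0 (estimator n (kernel_l u l) (bandwidth n \<beta> p P) P x0) (indep_class d p \<beta> L P) \<le> ennreal W"
    if n: "n \<ge> 1" for n
  proof -
    define \<phi> where "\<phi> = rate n \<beta> p P"
    have \<phi>0: "\<phi> > 0" using n by (simp add: \<phi>_def rate_def)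
    have \<phi>1: "\<phi> \<le> 1" unfolding \<phi>_def rate_def using n assms(12) by (intro powr_le1) auto
    have "epowr (\<integral>\<^sup>+X. ennreal (\<bar>estimator n (kernel_l u l) (bandwidth n \<beta> p P) P x0 X - f x0\<bar> powr q) \<partial>sample_law n d f) (1 / q)
        \<le> ennreal (\<phi> * W)" if f: "f \<in> indep_class d p \<beta> L P" for f
    proof -
      define b where "b I = marginal d I f (restrict x0 I)" for I
      have fx: "f x0 = prod b P" using f assms(3) unfolding indep_class_def b_def by blast
      define t where "t X I = \<bar>err I f n X\<bar> / \<phi>" for X I
      have t0: "t X I \<ge> 0" for X I using \<phi>0 by (simp add: t_def)
      have pt: "\<bar>estimator n (kernel_l u l) (bandwidth n \<beta> p P) P x0 X - f x0\<bar> powr q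
          \<le> (\<phi> powr q * C1) * (\<Sum>I\<in>P. exp (c I * t X I))" for X
      proof -
        define a where "a I = 1 / real n * (\<Sum>k=1..n. \<Prod>i\<in>I. 1 / bandwidth n \<beta> p P i *
            kernel_l u l ((X k i - x0 i) / bandwidth n \<beta> p P i))" for I
        have ab: "\<bar>a I - b I\<bar> \<le> \<phi> * t X I" for I using \<phi>0 by (simp add: t_def err_def a_def b_def)
        have bb: "\<bar>b I\<bar> \<le> G'" if "I \<in> P" for I using mg[OF that f] Gle[OF that] by (simp add: b_def)
        have "\<bar>estimator n (kernel_l u l) (bandwidth n \<beta> p P) P x0 X - f x0\<bar> = \<bar>prod a P - prod b P\<bar>"
          by (simp only: estimator_def fx a_def[abs_def])
        also have "\<dots> \<le> \<phi> * (2 * G') ^ card P * (\<Prod>I\<in>P. 1 + t X I)"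
          by (rule abs_prod_diff_le[OF fP bb ab G' less_imp_le[OF \<phi>0] \<phi>1 t0])
        finally have "\<bar>estimator n (kernel_l u l) (bandwidth n \<beta> p P) P x0 X - f x0\<bar> powr q
           \<le> (\<phi> * (2 * G') ^ card P * (\<Prod>I\<in>P. 1 + t X I)) powr q"
          using assms(2) by (intro powr_mono2) auto
        also have "\<dots> = (\<phi> powr q * ((2 * G') ^ card P) powr q) * (\<Prod>I\<in>P. 1 + t X I) powr q"
          using \<phi>0 G' t0 by (simp add: powr_mult prod_nonneg add_nonneg_nonneg)
        also have "\<dots> \<le> (\<phi> powr q * ((2 * G') ^ card P) powr q) * (((q * real (card P) / c') ^ card P) powr q * (\<Sum>I\<in>P. exp (c' * t X I)))"
          using fP P0 assms(2) c' t0 by (intro mult_left_mono prod_one_plus_powr_le) auto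
        also have "\<dots> = (\<phi> powr q * C1) * (\<Sum>I\<in>P. exp (c' * t X I))" by (simp add: C1_def)
        also have "\<dots> \<le> (\<phi> powr q * C1) * (\<Sum>I\<in>P. exp (c I * t X I))"
          using c'le t0 C12 by (intro mult_left_mono sum_mono) (auto intro!: mult_right_mono)
        finally show ?thesis .
      qed
      \<comment> \<open>Measurability for each block allows the integral to be exchanged with the
        sum over blocks; no joint law of the blocks enters.\<close>
      have em: "(\<lambda>X. ennreal (exp (c I * t X I))) \<in> borel_measurable (sample_law n d f)" if "I \<in> P" for I
      proof -
        have "err I f n \<in> borel_measurable (sample_law n d f)" using ex[OF that f n] by blast
        then show ?thesis unfolding t_def by (rule measurable_exp_abs)
      qed
      have "(\<integral>\<^sup>+X. ennreal (\<bar>estimator n (kernel_l u l) (bandwidth n \<beta> p P) P x0 X - f x0\<bar> powr q) \<partial>sample_law n d f)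
         \<le> (\<integral>\<^sup>+X. ennreal (\<phi> powr q * C1) * (\<Sum>I\<in>P. ennreal (exp (c I * t X I))) \<partial>sample_law n d f)"
      proof (rule nn_integral_mono)
        fix X
        have "ennreal (\<bar>estimator n (kernel_l u l) (bandwidth n \<beta> p P) P x0 X - f x0\<bar> powr q)
          \<le> ennreal ((\<phi> powr q * C1) * (\<Sum>I\<in>P. exp (c I * t X I)))" by (rule ennreal_leI[OF pt])
        also have "\<dots> = ennreal (\<phi> powr q * C1) * (\<Sum>I\<in>P. ennreal (exp (c I * t X I)))"
          using C12 by (simp add: ennreal_mult sum_nonneg flip: sum_ennreal)
        finally show "ennreal (\<bar>estimator n (kernel_l u l) (bandwidth n \<beta> p P) P x0 X - f x0\<bar> powr q)
          \<le> ennreal (\<phi> powr q * C1) * (\<Sum>I\<in>P. ennreal (exp (c I * t X I)))" .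
      qed
      also have "\<dots> = ennreal (\<phi> powr q * C1) * (\<Sum>I\<in>P. \<integral>\<^sup>+X. ennreal (exp (c I * t X I)) \<partial>sample_law n d f)"
      proof -
        have "(\<integral>\<^sup>+X. (\<Sum>I\<in>P. ennreal (exp (c I * t X I))) \<partial>sample_law n d f)
          = (\<Sum>I\<in>P. \<integral>\<^sup>+X. ennreal (exp (c I * t X I)) \<partial>sample_law n d f)"
          by (rule nn_integral_sum[OF em])
        moreover have "(\<lambda>X. \<Sum>I\<in>P. ennreal (exp (c I * t X I))) \<in> borel_measurable (sample_law n d f)"
          by (intro borel_measurable_sum em)
        ultimately show ?thesis by (simp only: nn_integral_cmult)
      qed
      also have "\<dots> \<le> ennreal (\<phi> powr q * C1) * (\<Sum>I\<in>P. ennreal \<bar>C I\<bar>)"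
      proof (intro mult_left_mono sum_mono)
        fix I assume "I \<in> P"
        then have "(\<integral>\<^sup>+X. ennreal (exp (c I * t X I)) \<partial>sample_law n d f) \<le> ennreal (C I)"
          using ex[OF _ f n, of I] unfolding t_def \<phi>_def by blast
        also have "\<dots> \<le> ennreal \<bar>C I\<bar>" by (intro ennreal_leI) auto
        finally show "(\<integral>\<^sup>+X. ennreal (exp (c I * t X I)) \<partial>sample_law n d f) \<le> ennreal \<bar>C I\<bar>" .
      qed simp
      also have "\<dots> = ennreal (\<phi> powr q * (C1 * C2))"
        using C12 by (simp add: C2_def ennreal_mult sum_nonneg mult.assoc flip: sum_ennreal)
      finally have "epowr (\<integral>\<^sup>+X. ennreal (\<bar>estimator n (kernel_l u l) (bandwidth n \<beta> p P) P x0 X - f x0\<bar> powr q) \<partial>sample_law n d f) (1 / q)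
         \<le> ennreal ((\<phi> powr q * (C1 * C2)) powr (1 / q))"
        using C12 assms(2) by (intro epowr_le) auto
      also have "(\<phi> powr q * (C1 * C2)) powr (1 / q) = \<phi> * W"
        using \<phi>0 C12 assms(2) by (simp add: W_def powr_mult powr_powr)
      finally show ?thesis .
    qed
    then have "risk n d q x0 (estimator n (kernel_l u l) (bandwidth n \<beta> p P) P x0) (indep_class d p \<beta> L P) \<le> ennreal (\<phi> * W)"
      unfolding risk_def by (intro SUP_least)
    then have "ennreal (inverse \<phi>) * risk n d q x0 (estimator n (kernel_l u l) (bandwidth n \<beta> p P) P x0) (indep_class d p \<beta> L P)
      \<le> ennreal (inverse \<phi>) * ennreal (\<phi> * W)" by (intro mult_left_mono) auto
    also have "\<dots> = ennreal (inverse \<phi> * (\<phi> * W))" using \<phi>0 by (simp add: ennreal_mult' W_def)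
    also have "inverse \<phi> * (\<phi> * W) = W" using \<phi>0 by simp
    finally show ?thesis by (simp add: \<phi>_def)
  qed
  have "limsup (\<lambda>n. ennreal (inverse (rate n \<beta> p P)) *
           risk n d q x0 (estimator n (kernel_l u l) (bandwidth n \<beta> p P) P x0)
             (indep_class d p \<beta> L P)) \<le> ennreal W"
    using main by (intro Limsup_bounded) (auto simp: eventually_sequentially)
  also have "\<dots> < \<infinity>" by simp
  finally show ?thesis .
qed

end
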